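(* Let $k$ be any field with $\operatorname{char} k=0$, and let $M$ be an intermediate field $k\subset M\subset k(\mathbf{x})=k(x_1,\ldots,x_n)$. Assume that $\operatorname{tr.deg}_kM\ge 2$, $M\ne k(\mathbf{x})$ and $M$ is minimal. Then there exists $\phi\in\operatorname{Aut}_kk(\mathbf{x})$ such that the field $\phi(M)$ satisfies condition $(\dag)$ and $\phi(k[\mathbf{x}])\subset k[\mathbf{x}]$.
   Context: $k[\mathbf{x}]=k[x_1,\ldots,x_n]$ is the polynomial ring in $n$ variables over $k$, with field of fractions $k(\mathbf{x})$. For an integral domain $B$, $Q(B)$ is its field of fractions, and $k[\mathbf{x}]_{x_1}:=k[\mathbf{x}][1/x_1]$. A domain is normal if it is integrally closed in its field of fractions. An intermediate field $k\subset L\subset k(\mathbf{x})$ is minimal if the transcendence degree over $k$ of $L\cap k[\mathbf{x}]$ equals that of $L$; equivalently, $Q(L\cap k[\mathbf{x}])=L$. The map $\epsilon:k[\mathbf{x}]\to k[x_1]$ is the $k$-algebra homomorphism with $\epsilon(x_1)=x_1$ and $\epsilon(x_i)=0$ for $i=2,\ldots,n$. Condition $(\dag)$ on an intermediate field $L$ of $k(\mathbf{x})/k$: with $R:=L\cap k[\mathbf{x}]$, one has $L\cap k[\mathbf{x}]=L\cap k[\mathbf{x}]_{x_1}$, $Q(R)=L$, and $\epsilon(R)$ is not normal. *)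

theory Defs
  imports
    "HOL-Computational_Algebra.Computational_Algebra"
    "HOL-Library.Poly_Mapping"
    "HOL-Library.Extended_Nat"
begin

text \<open>
  \<open>k[x\<^sub>1,\<dots>,x\<^sub>n]\<close> is modelled by finitely supported families of coefficients indexed by
  finitely supported exponent vectors. The variables are indexed by a finite type \<open>'n\<close>, so
  \<open>n = CARD('n)\<close>; its linear order enumerates them as \<open>x\<^sub>1, \<dots>, x\<^sub>n\<close> (\<open>x\<^sub>1\<close> belongs to the least
  index) and is required by the library's integral domain instance for \<^type>\<open>poly_mapping\<close>.
\<close>

type_synonym ('n, 'k) mpoly = "('n \<Rightarrow>\<^sub>0 nat) \<Rightarrow>\<^sub>0 'k"
type_synonym ('n, 'k) ratfun = "('n, 'k) mpoly fract"

definition mconst :: "'k \<Rightarrow> ('n, 'k::zero) mpoly" where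
  "mconst a = Poly_Mapping.single 0 a"

definition mvar :: "'n \<Rightarrow> ('n, 'k::zero_neq_one) mpoly" where
  "mvar i = Poly_Mapping.single (Poly_Mapping.single i 1) 1"

definition mpoly_eval :: "('k::zero \<Rightarrow> 'a::comm_ring_1) \<Rightarrow> ('v \<Rightarrow> 'a) \<Rightarrow> ('v, 'k) mpoly \<Rightarrow> 'a" where
  "mpoly_eval c x p =
     (\<Sum>m\<in>Poly_Mapping.keys p. c (Poly_Mapping.lookup p m) *
        (\<Prod>i\<in>Poly_Mapping.keys m. x i ^ Poly_Mapping.lookup m i))"

definition first_var :: "'n::{finite,linorder}" where
  "first_var = Min UNIV"

definition of_mpoly :: "('n::linorder, 'k::field) mpoly \<Rightarrow> ('n, 'k) ratfun" where
  "of_mpoly p = Fract p 1"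

definition rat_const :: "'k \<Rightarrow> ('n::linorder, 'k::field) ratfun" where
  "rat_const a = of_mpoly (mconst a)"

definition polys :: "('n::linorder, 'k::field) ratfun set" where
  "polys = range of_mpoly"

definition polys_loc :: "('n::{finite,linorder}, 'k::field) ratfun set" where
  "polys_loc = {of_mpoly p / of_mpoly (mvar first_var) ^ j | p j. True}"

definition intermediate_field :: "('n::linorder, 'k::field) ratfun set \<Rightarrow> bool" where
  "intermediate_field L \<longleftrightarrow>
     range rat_const \<subseteq> L \<and>
     (\<forall>a\<in>L. \<forall>b\<in>L. a + b \<in> L \<and> a * b \<in> L) \<and>
     (\<forall>a\<in>L. - a \<in> L \<and> inverse a \<in> L)"

definition alg_independent :: "('n::linorder, 'k::field) ratfun set \<Rightarrow> bool" where
  "alg_independent S \<longleftrightarrow>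
     (\<forall>p :: (('n, 'k) ratfun, 'k) mpoly.
        (\<forall>m\<in>Poly_Mapping.keys p. Poly_Mapping.keys m \<subseteq> S) \<and> mpoly_eval rat_const id p = 0
        \<longrightarrow> p = 0)"

text \<open>
  Transcendence degree over \<open>k\<close> of a \<open>k\<close>-subalgebra of \<open>k(x)\<close>, in particular of an intermediate
  field: the largest number of algebraically independent elements.
\<close>

definition trdeg :: "('n::linorder, 'k::field) ratfun set \<Rightarrow> enat" where
  "trdeg A = (SUP S \<in> {S. finite S \<and> S \<subseteq> A \<and> alg_independent S}. enat (card S))"

definition minimal_field :: "('n::linorder, 'k::field) ratfun set \<Rightarrow> bool" where
  "minimal_field L \<longleftrightarrow> trdeg (L \<inter> polys) = trdeg L"

text \<open>
  The field of fractions of a subring \<open>B\<close> of a field is taken inside that field.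
\<close>

definition quot_field :: "'a::field set \<Rightarrow> 'a set" where
  "quot_field B = {a / b | a b. a \<in> B \<and> b \<in> B \<and> b \<noteq> 0}"

definition integral_over :: "'a::field set \<Rightarrow> 'a \<Rightarrow> bool" where
  "integral_over B z \<longleftrightarrow>
     (\<exists>p :: 'a poly. lead_coeff p = 1 \<and> (\<forall>i. coeff p i \<in> B) \<and> poly p z = 0)"

definition normal_domain :: "'a::field set \<Rightarrow> bool" where
  "normal_domain B \<longleftrightarrow> (\<forall>z \<in> quot_field B. integral_over B z \<longrightarrow> z \<in> B)"

text \<open>The codomain \<open>k[x\<^sub>1]\<close> is regarded as a subring of \<open>k[x\<^sub>1,\<dots>,x\<^sub>n]\<close>.\<close>

definition eps :: "('n::{finite,linorder}, 'k::field) mpoly \<Rightarrow> ('n, 'k) mpoly" where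
  "eps p = mpoly_eval mconst (\<lambda>i. if i = first_var then mvar i else 0) p"

definition eps_image :: "('n::{finite,linorder}, 'k::field) ratfun set \<Rightarrow> ('n, 'k) ratfun set" where
  "eps_image R = {of_mpoly (eps p) | p. of_mpoly p \<in> R}"

definition dagger :: "('n::{finite,linorder}, 'k::field) ratfun set \<Rightarrow> bool" where
  "dagger L \<longleftrightarrow>
     L \<inter> polys = L \<inter> polys_loc \<and>
     quot_field (L \<inter> polys) = L \<and>
     \<not> normal_domain (eps_image (L \<inter> polys))"

definition k_automorphism :: "(('n::linorder, 'k::field) ratfun \<Rightarrow> ('n, 'k) ratfun) \<Rightarrow> bool" where
  "k_automorphism \<phi> \<longleftrightarrow>
     bij \<phi> \<and>
     (\<forall>a b. \<phi> (a + b) = \<phi> a + \<phi> b) \<and>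
     (\<forall>a b. \<phi> (a * b) = \<phi> a * \<phi> b) \<and>
     (\<forall>c. \<phi> (rat_const c) = rat_const c)"

end

theory Submission
  imports Defs
begin

text \<open>
  Write \<open>R = M \<inter> k[x]\<close>. Minimality and the normality of \<open>k[x]\<close> give \<open>Q(R) = M\<close>.

  If \<open>M \<noteq> k(x)\<close>, two distinct points of \<open>n\<close>-space over an extension of \<open>k(x)\<close>, one of them generic,
  are not separated by \<open>M\<close>: a maximal proper subfield \<open>F\<close> of \<open>k(x)\<close> containing \<open>M\<close> satisfies \<open>k(x) = F(\<theta>)\<close>
  with \<open>\<theta>\<close> algebraic of degree at least \<open>2\<close>, and the second point comes from a conjugate of \<open>\<theta>\<close>. Hence, for
  general coordinates \<open>x\<^sub>1\<close>, \<open>x\<^sub>j\<close>, no element of \<open>M\<close> has poles only along \<open>x\<^sub>1 x\<^sub>j = 0\<close>, that is,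
  \<open>M \<inter> k[x, 1/(x\<^sub>1 x\<^sub>j)] = R\<close>.

  The automorphism \<open>x\<^sub>1 \<mapsto> x\<^sub>j + \<rho>(x\<^sub>1)\<close>, \<open>x\<^sub>j \<mapsto> x\<^sub>1 (x\<^sub>j + \<rho>(x\<^sub>1))\<close>, \<open>x\<^sub>i \<mapsto> x\<^sub>i + x\<^sub>1\<^bsup>b\<^sub>i\<^esup> \<rho>(x\<^sub>1)\<close> has an
  inverse with poles only along \<open>x\<^sub>1 x\<^sub>j = 0\<close>, and followed by \<open>\<epsilon>\<close> it is restriction to the
  curve \<open>\<gamma>(t) = (\<rho>(t) t\<^bsup>b\<^sub>i\<^esup>)\<^sub>i\<close>. For \<open>t\<^sup>2\<close> dividing \<open>\<rho>\<close> the ring \<open>\<gamma>\<^sup>*R\<close> lies in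
  \<open>k + t\<^sup>2 k[t]\<close>, so it does not contain \<open>t\<close>. Since \<open>tr.deg R \<ge> 2\<close>, a suitable \<open>\<rho>\<close> of large degree
  yields elements of \<open>\<gamma>\<^sup>*R\<close> of two consecutive degrees, so that \<open>t\<close> is in the field of fractions of \<open>\<gamma>\<^sup>*R\<close> and
  integral over \<open>\<gamma>\<^sup>*R\<close>.
\<close>
section \<open>Evaluation of multivariate polynomials\<close>

text \<open>The factor \<open>x_j\<close> in the pole condition comes from pulling back: the
  automorphism sends \<open>x_j / x_1\<close> to \<open>x_1\<close>, so inverting \<open>x_1\<close>
  after it amounts to inverting \<open>x_j / x_1\<close> before it. Enlarging \<open>M\<close> to a
  maximal proper subfield \<open>F\<close> makes every element outside \<open>F\<close> algebraic
  over \<open>F\<close> and a generator of \<open>k(x)\<close>. Hence every coordinate outside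
  \<open>F\<close> changes at the second point, and for general \<open>c\<close> the form
  \<open>x_l + c\<close> is a unit there along the hyperplane \<open>x_l + c = 0\<close>, although
  it vanishes at the first point. An element of \<open>F\<close> has the same value at both points,
  so it has no pole along that hyperplane. A linear shear moves all coordinates out of
  \<open>F\<close>; a translation turns the two general hyperplanes into coordinate hyperplanes.
  Characteristic 0 enters through separability, which makes the second point distinct, through the
  infinite supply of constants, and through integers that must stay non-zero when second
  coefficients are compared.\<close>

abbreviation lkp :: "('a \<Rightarrow>\<^sub>0 'b::zero) \<Rightarrow> 'a \<Rightarrow> 'b" where "lkp \<equiv> Poly_Mapping.lookup"
abbreviation supp :: "('a \<Rightarrow>\<^sub>0 'b::zero) \<Rightarrow> 'a set" where "supp \<equiv> Poly_Mapping.keys"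
abbreviation sgl :: "'a \<Rightarrow> 'b \<Rightarrow> ('a \<Rightarrow>\<^sub>0 'b::zero)" where "sgl \<equiv> Poly_Mapping.single"

text \<open>Homomorphisms are carried as hypotheses because many of them are built inside proofs,
  from substitutions into polynomials, and composed there.\<close>

locale rhom =
  fixes h :: "'a::comm_ring_1 \<Rightarrow> 'b::comm_ring_1"
  assumes add: "h (a + b) = h a + h b"
    and mult: "h (a * b) = h a * h b"
    and one: "h 1 = 1"
begin

lemma zero: "h 0 = 0"
  using add[of 0 0] by simp

lemma neg: "h (- a) = - h a"
  using add[of a "- a"] by (simp add: zero add_eq_0_iff)

lemma diff: "h (a - b) = h a - h b"
  using add[of a "- b"] by (simp add: neg)

lemma power: "h (a ^ n) = h a ^ n"
  by (induction n) (simp_all add: one mult)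

lemma sum: "h (sum f A) = (\<Sum>x\<in>A. h (f x))"
  by (induction A rule: infinite_finite_induct) (simp_all add: zero add)

lemma prod: "h (prod f A) = (\<Prod>x\<in>A. h (f x))"
  by (induction A rule: infinite_finite_induct) (simp_all add: one mult)

lemma of_nat: "h (of_nat n) = of_nat n"
  by (induction n) (simp_all add: zero one add)

lemmas hom_simps = add mult one zero neg diff power sum prod

end

lemma rhom_comp: "rhom f \<Longrightarrow> rhom g \<Longrightarrow> rhom (\<lambda>x. f (g x))"
  by (simp add: rhom_def)

lemma rhom_of_mpoly: "rhom (of_mpoly :: ('n::linorder, 'k::field) mpoly \<Rightarrow> ('n, 'k) ratfun)"
  by unfold_locales (simp_all add: of_mpoly_def One_fract_def)

interpretation of_mpoly: rhom "of_mpoly :: ('n::linorder, 'k::field) mpoly \<Rightarrow> ('n, 'k) ratfun"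
  by (rule rhom_of_mpoly)

lemma of_mpoly_inj [simp]: "of_mpoly p = of_mpoly q \<longleftrightarrow> p = q"
  by (simp add: of_mpoly_def eq_fract)

lemma of_mpoly_eq_0 [simp]: "of_mpoly p = 0 \<longleftrightarrow> p = 0"
  using of_mpoly_inj[of p 0] by (simp only: of_mpoly.zero)

lemma ratfun_cases:
  fixes z :: "('n::linorder, 'k::field) ratfun"
  obtains p q where "q \<noteq> 0" "z = of_mpoly p / of_mpoly q"
proof (cases z)
  case (Fract a b)
  show ?thesis by (rule that[of b a]) (use Fract in \<open>simp_all add: of_mpoly_def\<close>)
qed

lemma rhom_mconst: "rhom (mconst :: 'k::field \<Rightarrow> ('n::linorder, 'k) mpoly)"
  by unfold_locales (simp_all add: mconst_def single_add mult_single)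

interpretation mconst: rhom "mconst :: 'k::field \<Rightarrow> ('n::linorder, 'k) mpoly"
  by (rule rhom_mconst)

lemma mconst_inj [simp]: "mconst a = mconst b \<longleftrightarrow> a = b"
  by (metis lookup_single_eq mconst_def)

lemma mconst_eq_0 [simp]: "mconst a = 0 \<longleftrightarrow> a = 0"
  by (metis lookup_single_eq lookup_zero mconst_def single_zero)

lemma rhom_rat_const: "rhom (rat_const :: 'k::field \<Rightarrow> ('n::linorder, 'k) ratfun)"
  unfolding rat_const_def by (rule rhom_comp[OF rhom_of_mpoly rhom_mconst])

interpretation rat_const: rhom "rat_const :: 'k::field \<Rightarrow> ('n::linorder, 'k) ratfun"
  by (rule rhom_rat_const)

lemma rat_const_eq_0 [simp]: "rat_const a = 0 \<longleftrightarrow> a = 0"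
  by (simp add: rat_const_def)

lemma poly_mapping_induct [case_names single add]:
  fixes p :: "'a \<Rightarrow>\<^sub>0 'b::comm_monoid_add"
  assumes s: "\<And>m a. P (sgl m a)" and a: "\<And>p q. P p \<Longrightarrow> P q \<Longrightarrow> P (p + q)"
  shows "P p"
proof (induction p rule: update_induct)
  case const
  show ?case using s[of undefined 0] by simp
next
  case (update f a b)
  have "Poly_Mapping.update a b f = f + sgl a b"
    using update(1) by (intro poly_mapping_eqI)
      (auto simp: lookup_update lookup_add lookup_single when_def in_keys_iff)
  then show ?case using a s update(3) by simp
qed

lemma mpoly_sum: "p = (\<Sum>m\<in>supp p. sgl m (lkp p m))"
proof (rule poly_mapping_eqI)
  fix k
  have "lkp (\<Sum>m\<in>supp p. sgl m (lkp p m)) k = (\<Sum>m\<in>supp p. if k = m then lkp p m else 0)"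
    unfolding lookup_sum by (intro sum.cong) (auto simp: lookup_single when_def)
  then show "lkp p k = lkp (\<Sum>m\<in>supp p. sgl m (lkp p m)) k"
    by (simp add: in_keys_iff)
qed

definition mono_eval :: "('v \<Rightarrow> 'a::comm_ring_1) \<Rightarrow> ('v \<Rightarrow>\<^sub>0 nat) \<Rightarrow> 'a" where
  "mono_eval x m = (\<Prod>i\<in>supp m. x i ^ lkp m i)"

lemma mono_eval_superset:
  "finite A \<Longrightarrow> supp m \<subseteq> A \<Longrightarrow> mono_eval x m = (\<Prod>i\<in>A. x i ^ lkp m i)"
  unfolding mono_eval_def by (intro prod.mono_neutral_left) (auto simp: in_keys_iff)

lemma mono_eval_add: "mono_eval x (m + m') = mono_eval x m * mono_eval x m'"
proof -
  let ?A = "supp m \<union> supp m'"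
  have "mono_eval x (m + m') = (\<Prod>i\<in>?A. x i ^ lkp (m + m') i)"
    by (intro mono_eval_superset keys_add) auto
  also have "\<dots> = (\<Prod>i\<in>?A. x i ^ lkp m i) * (\<Prod>i\<in>?A. x i ^ lkp m' i)"
    by (simp add: lookup_add power_add prod.distrib)
  also have "\<dots> = mono_eval x m * mono_eval x m'"
    by (subst (1 2) mono_eval_superset[of ?A]) auto
  finally show ?thesis .
qed

lemma mono_eval_0 [simp]: "mono_eval x 0 = 1"
  by (simp add: mono_eval_def)

lemma mono_eval_single [simp]: "mono_eval x (sgl i n) = x i ^ n"
  by (cases "n = 0") (simp_all add: mono_eval_def)

lemma mpoly_eval_altdef: "mpoly_eval c x p = (\<Sum>m\<in>supp p. c (lkp p m) * mono_eval x m)"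
  by (simp add: mpoly_eval_def mono_eval_def)

lemma mpoly_eval_superset:
  assumes "rhom c" "finite A" "supp p \<subseteq> A"
  shows "mpoly_eval c x p = (\<Sum>m\<in>A. c (lkp p m) * mono_eval x m)"
  unfolding mpoly_eval_altdef
  using assms by (intro sum.mono_neutral_left) (auto simp: in_keys_iff rhom.zero)

lemma mpoly_eval_add:
  assumes "rhom c"
  shows "mpoly_eval c x (p + q) = mpoly_eval c x p + mpoly_eval c x q"
proof -
  let ?A = "supp p \<union> supp q"
  have "mpoly_eval c x (p + q) = (\<Sum>m\<in>?A. c (lkp (p + q) m) * mono_eval x m)"
    by (intro mpoly_eval_superset keys_add assms) auto
  also have "\<dots> = (\<Sum>m\<in>?A. c (lkp p m) * mono_eval x m) + (\<Sum>m\<in>?A. c (lkp q m) * mono_eval x m)"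
    by (simp add: lookup_add rhom.add[OF assms] ring_distribs sum.distrib)
  also have "\<dots> = mpoly_eval c x p + mpoly_eval c x q"
    by (subst (1 2) mpoly_eval_superset[OF assms, of ?A]) auto
  finally show ?thesis .
qed

lemma mpoly_eval_single: "rhom c \<Longrightarrow> mpoly_eval c x (sgl m a) = c a * mono_eval x m"
  by (cases "a = 0") (simp_all add: mpoly_eval_altdef rhom.zero)

lemma rhom_mpoly_eval:
  assumes "rhom c"
  shows "rhom (mpoly_eval c x)"
proof
  show add: "mpoly_eval c x (p + q) = mpoly_eval c x p + mpoly_eval c x q" for p q
    by (rule mpoly_eval_add[OF assms])
  show "mpoly_eval c x (p * q) = mpoly_eval c x p * mpoly_eval c x q" for p q
  proof (induction p rule: poly_mapping_induct)
    case (single m a)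
    show ?case
      by (induction q rule: poly_mapping_induct)
        (simp_all add: mult_single mpoly_eval_single[OF assms] mono_eval_add rhom.mult[OF assms]
          ring_distribs add)
  qed (simp add: ring_distribs add)
  show "mpoly_eval c x 1 = 1"
    using mpoly_eval_single[OF assms, of x 0 1] by (simp add: rhom.one[OF assms])
qed

lemma mpoly_eval_mconst: "rhom c \<Longrightarrow> mpoly_eval c x (mconst a) = c a"
  by (simp add: mconst_def mpoly_eval_single)

lemma mpoly_eval_mvar: "rhom c \<Longrightarrow> mpoly_eval c x (mvar i) = x i"
  by (simp add: mvar_def mpoly_eval_single rhom.one)

lemma mpoly_induct [case_names const var add mult]:
  fixes p :: "('n, 'k::comm_ring_1) mpoly"
  assumes c: "\<And>a. P (mconst a)" and v: "\<And>i. P (mvar i)"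
    and a: "\<And>p q. P p \<Longrightarrow> P q \<Longrightarrow> P (p + q)" and m: "\<And>p q. P p \<Longrightarrow> P q \<Longrightarrow> P (p * q)"
  shows "P p"
proof (induction p rule: poly_mapping_induct)
  case (single m b)
  have *: "P (sgl m 1)" for m :: "'n \<Rightarrow>\<^sub>0 nat"
  proof (induction m rule: poly_mapping_induct)
    case (single i n)
    show ?case
    proof (induction n)
      case 0
      show ?case using c[of 1] by (simp add: mconst_def)
    next
      case (Suc n)
      have "sgl (sgl i (Suc n)) (1::'k) = mvar i * sgl (sgl i n) 1"
        by (simp add: mvar_def mult_single flip: single_add)
      then show ?case using m v Suc by simp
    qed
  next
    case (add p q)
    then show ?case using m[OF add] by (simp add: mult_single)
  qed
  have "sgl m b = mconst b * sgl m 1" by (simp add: mconst_def mult_single)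
  then show ?case using m c * by simp
qed (use a in auto)

text \<open>The uniqueness half of the universal property of \<open>k[x]\<close>: identities between
  substitutions, such as inverse coordinate changes and restriction to the curve, reduce to
  generators.\<close>

lemma mpoly_hom_eqI:
  assumes "rhom f" "rhom g" "\<And>a. f (mconst a) = g (mconst a)" "\<And>i. f (mvar i) = g (mvar i)"
  shows "f p = g (p :: ('n::linorder, 'k::field) mpoly)"
  by (induction p rule: mpoly_induct)
    (use assms in \<open>simp_all add: rhom.add[OF assms(1)] rhom.add[OF assms(2)]
      rhom.mult[OF assms(1)] rhom.mult[OF assms(2)]\<close>)

lemma mpoly_eval_in:
  assumes "rhom c" "\<And>a. c a \<in> B" "\<And>i. x i \<in> B"
    "\<And>a b. a \<in> B \<Longrightarrow> b \<in> B \<Longrightarrow> a + b \<in> B" "\<And>a b. a \<in> B \<Longrightarrow> b \<in> B \<Longrightarrow> a * b \<in> B"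
  shows "mpoly_eval c x (p :: ('n::linorder, 'k::field) mpoly) \<in> B"
  by (induction p rule: mpoly_induct)
    (use assms in \<open>simp_all add: mpoly_eval_mconst mpoly_eval_mvar
      rhom.add[OF rhom_mpoly_eval] rhom.mult[OF rhom_mpoly_eval]\<close>)

lemma mpoly_eval_id: "mpoly_eval mconst mvar p = (p :: ('n::linorder, 'k::field) mpoly)"
  using mpoly_hom_eqI[OF rhom_mpoly_eval[OF rhom_mconst, of mvar], of "\<lambda>p. p" p]
  by (simp add: rhom_def mpoly_eval_mconst[OF rhom_mconst] mpoly_eval_mvar[OF rhom_mconst])

lemma rhom_map_mpoly_eval:
  assumes "rhom g" "rhom c"
  shows "g (mpoly_eval c x (p :: ('n::linorder, 'k::field) mpoly)) = mpoly_eval (\<lambda>a. g (c a)) (\<lambda>i. g (x i)) p"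
proof -
  have gc: "rhom (\<lambda>a. g (c a))"
    using assms by (rule rhom_comp)
  have ge: "rhom (\<lambda>p. g (mpoly_eval c x (p :: ('n, 'k) mpoly)))"
    using assms(1) rhom_mpoly_eval[OF assms(2)] by (rule rhom_comp)
  show ?thesis
    by (rule mpoly_hom_eqI[OF ge rhom_mpoly_eval[OF gc]])
      (simp_all add: mpoly_eval_mconst mpoly_eval_mvar assms gc)
qed

section \<open>Normality of the polynomial ring\<close>

text \<open>The order on exponent vectors is lexicographic: the least index where two vectors differ
  decides. Listing the exponents by increasing index embeds it in the lexicographic order on lists
  of one fixed length.\<close>

lemma wfp_monomial_less: "wfp ((<) :: ('n::{finite,linorder} \<Rightarrow>\<^sub>0 nat) \<Rightarrow> _)"
proof -
  let ?L = "sorted_list_of_set (UNIV :: 'n set)"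
  let ?f = "\<lambda>m :: 'n \<Rightarrow>\<^sub>0 nat. map (lkp m) ?L"
  have "(?f a, ?f b) \<in> lexn less_than (length ?L)" if "a < b" for a b
  proof -
    from that obtain k where k: "lkp a k < lkp b k" "\<And>k'. k' < k \<Longrightarrow> lkp a k' = lkp b k'"
      by (auto simp: less_poly_mapping.rep_eq less_fun_def)
    have "k \<in> set ?L" by simp
    then obtain i where i: "i < length ?L" "?L ! i = k" by (metis in_set_conv_nth)
    have "?L ! j < k" if "j < i" for j
      using sorted_wrt_nth_less[OF strict_sorted_list_of_set that, of "UNIV :: 'n set"] i by simp
    then have eq: "map (lkp a) (take i ?L) = map (lkp b) (take i ?L)"
      using k(2) i(1) by (intro nth_equalityI) auto
    have "?L = take i ?L @ k # drop (Suc i) ?L"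
      using id_take_nth_drop[OF i(1)] i(2) by simp
    then have "?f a = map (lkp a) (take i ?L) @ lkp a k # map (lkp a) (drop (Suc i) ?L)"
      "?f b = map (lkp a) (take i ?L) @ lkp b k # map (lkp b) (drop (Suc i) ?L)"
      using eq by (metis list.simps(9) map_append)+
    then have "\<exists>xys x y xs' ys'. ?f a = xys @ x # xs' \<and> ?f b = xys @ y # ys' \<and> (x, y) \<in> less_than"
      using k(1) by (intro exI conjI) auto
    then show ?thesis unfolding lexn_conv by simp
  qed
  then have "{(a, b). a < b} \<subseteq> inv_image (lexn less_than (length ?L)) ?f"
    by auto
  then have "wf {(a, b). (a :: 'n \<Rightarrow>\<^sub>0 nat) < b}"
    by (rule wf_subset[rotated]) (intro wf_inv_image wf_lexn wf_less_than)
  then show ?thesis by (simp add: wfp_def)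
qed

section \<open>Leading terms and divisibility\<close>

definition leading :: "('n::linorder, 'k::zero) mpoly \<Rightarrow> ('n \<Rightarrow>\<^sub>0 nat) \<Rightarrow> 'k \<Rightarrow> bool" where
  "leading p m a \<longleftrightarrow> lkp p m = a \<and> a \<noteq> 0 \<and> (\<forall>m'\<in>supp p. m' \<le> m)"

lemma leading_exists: "p \<noteq> 0 \<Longrightarrow> \<exists>m a. leading p m a"
  unfolding leading_def
  by (metis Max_ge Max_in finite_keys in_keys_iff keys_eq_empty)

lemma leading_unique: "leading p m a \<Longrightarrow> leading p m' a' \<Longrightarrow> m = m' \<and> a = a'"
  unfolding leading_def by (metis antisym in_keys_iff)

lemma leading_nonzero: "leading p m a \<Longrightarrow> p \<noteq> 0"
  by (auto simp: leading_def)

text \<open>Addition of exponents is strictly monotone, so every product involving a non-leading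
  term lies strictly below \<open>m + n\<close> and cannot cancel the product of the leading
  terms.\<close>

lemma leading_mult:
  fixes p q :: "('n::linorder, 'k::field) mpoly"
  assumes "leading p m a" "leading q n b"
  shows "leading (p * q) (m + n) (a * b)"
proof -
  have ab: "a \<noteq> 0" "b \<noteq> 0" using assms by (auto simp: leading_def)
  define p' where "p' = p - sgl m a"
  define q' where "q' = q - sgl n b"
  have p': "u < m" if "u \<in> supp p'" for u
  proof -
    have "u \<noteq> m" "u \<in> supp p"
      using that assms(1) by (auto simp: p'_def leading_def in_keys_iff lookup_minus lookup_single when_def
          split: if_splits)
    then show ?thesis using assms(1) by (auto simp: leading_def order_less_le)
  qed
  have q': "u < n" if "u \<in> supp q'" for u
  proof -
    have "u \<noteq> n" "u \<in> supp q"
      using that assms(2) by (auto simp: q'_def leading_def in_keys_iff lookup_minus lookup_single when_def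
          split: if_splits)
    then show ?thesis using assms(2) by (auto simp: leading_def order_less_le)
  qed
  define r where "r = sgl m a * q' + p' * sgl n b + p' * q'"
  have pq: "p * q = sgl (m + n) (a * b) + r"
  proof -
    have *: "(A + X) * (B + Y) = A * B + (A * Y + X * B + X * Y)" for A B X Y :: "('n, 'k) mpoly"
      by (simp only: ring_distribs add_ac)
    have "p = sgl m a + p'" "q = sgl n b + q'" by (simp_all add: p'_def q'_def)
    then show ?thesis unfolding r_def mult_single[symmetric] by (simp only: *)
  qed
  have r: "u < m + n" if u: "u \<in> supp r" for u
  proof -
    have "supp r \<subseteq> supp (sgl m a * q') \<union> supp (p' * sgl n b) \<union> supp (p' * q')"
      unfolding r_def by (intro order.trans[OF keys_add] Un_mono order.refl)
    then consider "u \<in> supp (sgl m a * q')" | "u \<in> supp (p' * sgl n b)" | "u \<in> supp (p' * q')"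
      using u by blast
    then show ?thesis
    proof cases
      case 1
      then obtain v where "v \<in> supp q'" "u = m + v"
        using subsetD[OF keys_mult 1] ab by auto
      then show ?thesis using q' by (simp add: add_strict_left_mono)
    next
      case 2
      then obtain v where "v \<in> supp p'" "u = v + n"
        using subsetD[OF keys_mult 2] ab by auto
      then show ?thesis using p' by (simp add: add_strict_right_mono)
    next
      case 3
      then obtain v w where "v \<in> supp p'" "w \<in> supp q'" "u = v + w"
        using subsetD[OF keys_mult 3] by auto
      then show ?thesis using p' q' by (simp add: add_strict_mono)
    qed
  qed
  have "lkp r (m + n) = 0" using r[of "m + n"] by (auto simp: in_keys_iff)
  moreover have "u \<le> m + n" if "u \<in> supp (p * q)" for u
  proof -
    have "u \<in> supp (sgl (m + n) (a * b)) \<union> supp r"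
      using that unfolding pq by (rule subsetD[OF keys_add])
    then show ?thesis using r[of u] ab by (auto simp: less_imp_le)
  qed
  ultimately show ?thesis unfolding leading_def using ab by (simp add: pq lookup_add)
qed

lemma leading_1: "leading 1 0 (1::'k::field)"
  by (simp add: leading_def)

lemma leading_power:
  fixes p :: "('n::linorder, 'k::field) mpoly"
  assumes "leading p m a"
  shows "\<exists>m'. leading (p ^ N) m' (a ^ N) \<and> (\<forall>i. lkp m' i = N * lkp m i)"
proof (induction N)
  case 0
  show ?case using leading_1 by (intro exI[of _ 0]) simp
next
  case (Suc N)
  then obtain m' where "leading (p ^ N) m' (a ^ N)" "\<forall>i. lkp m' i = N * lkp m i" by blast
  then show ?case
    using leading_mult[OF assms] by (intro exI[of _ "m + m'"]) (simp add: lookup_add)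
qed

text \<open>
  Multivariate division by a single divisor: almost integrality of \<open>p / q\<close> forces the leading
  monomial of \<open>q\<close> to divide that of \<open>p\<close>, and is inherited by what remains after cancelling it.
\<close>

lemma dvd_if_almost_integral:
  fixes p q c :: "('n::{finite,linorder}, 'k::field) mpoly"
  assumes "c \<noteq> 0" "q \<noteq> 0" "\<And>N. q ^ N dvd c * p ^ N"
  shows "q dvd p"
proof -
  obtain k d where k: "leading c k d" using leading_exists[OF assms(1)] by blast
  obtain n b where n: "leading q n b" using leading_exists[OF assms(2)] by blast
  \<comment> \<open>Induction on the leading monomial of the dividend. Zero has none and is treated
    at the end.\<close>
  have "\<forall>p. (\<exists>a. leading p m a) \<longrightarrow> (\<forall>N. q ^ N dvd c * p ^ N) \<longrightarrow> q dvd p" for m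
  proof (induction m rule: wfp_induct_rule[OF wfp_monomial_less])
    case (1 m)
    show ?case
    proof (intro allI impI, elim exE)
      fix p a assume p: "leading p m a" and dv: "\<forall>N. q ^ N dvd c * p ^ N"
      have le: "lkp n i \<le> lkp m i" for i
      proof (rule ccontr)
        assume *: "\<not> lkp n i \<le> lkp m i"
        \<comment> \<open>If \<open>lkp n i\<close> exceeds \<open>lkp m i\<close>, comparing
          exponents at \<open>i\<close> gives \<open>lkp k i \<ge> N\<close>, which this choice of
          \<open>N\<close> rules out.\<close>
        define N where "N = Suc (lkp k i)"
        obtain r where r: "c * p ^ N = q ^ N * r" using dv by (auto simp: dvd_def)
        obtain m' where m': "leading (p ^ N) m' (a ^ N)" "\<forall>i. lkp m' i = N * lkp m i"
          using leading_power[OF p] by blast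
        obtain n' where n': "leading (q ^ N) n' (b ^ N)" "\<forall>i. lkp n' i = N * lkp n i"
          using leading_power[OF n] by blast
        have l: "leading (c * p ^ N) (k + m') (d * a ^ N)" by (rule leading_mult[OF k m'(1)])
        then have "r \<noteq> 0" using leading_nonzero r by fastforce
        then obtain s e where "leading r s e" using leading_exists by blast
        then have "k + m' = n' + s"
          using leading_mult[OF n'(1)] leading_unique l unfolding r by blast
        then have "lkp (k + m') i = lkp (n' + s) i" by simp
        then have "lkp k i + N * lkp m i = N * lkp n i + lkp s i"
          by (simp only: lookup_add m'(2) n'(2))
        moreover have "N * Suc (lkp m i) \<le> N * lkp n i" using * by (intro mult_le_mono) auto
        ultimately show False by (simp add: N_def)
      qed
      define s where "s = sgl (m - n) (a / b)"
      have mn: "m = m - n + n"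
        by (rule poly_mapping_eqI) (simp add: lookup_add lookup_minus le)
      have ab: "a \<noteq> 0" "b \<noteq> 0" using p n by (auto simp: leading_def)
      have "leading s (m - n) (a / b)" unfolding s_def leading_def using ab by simp
      from leading_mult[OF this n] have sq: "leading (s * q) m a" using mn ab by simp
      define p' where "p' = p - s * q"
      have lt: "u < m" if "u \<in> supp p'" for u
      proof -
        have "u \<in> supp p \<or> u \<in> supp (s * q)"
          using that unfolding p'_def in_keys_iff lookup_minus by (metis diff_zero)
        then have "u \<le> m" using p sq by (auto simp: leading_def)
        moreover have "u \<noteq> m"
          using that p sq unfolding p'_def in_keys_iff lookup_minus leading_def by auto
        ultimately show ?thesis by simp
      qed
      have "q dvd p'"
      proof (cases "p' = 0")
        case False
        then obtain m' a' where m': "leading p' m' a'" using leading_exists by blast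
        then have "m' < m" using lt by (auto simp: leading_def in_keys_iff)
        moreover have "q ^ N dvd c * p' ^ N" for N
        proof -
          \<comment> \<open>The hypothesis for exponent \<open>i\<close> gives \<open>q ^ i\<close>
            from \<open>c * p ^ i\<close>, and the other factor supplies \<open>q ^ (N - i)\<close>;
            thus the same \<open>c\<close> serves for \<open>p'\<close>.\<close>
          have "q ^ N dvd c * (of_nat (N choose i) * p ^ i * (- (s * q)) ^ (N - i))" if "i \<le> N" for i
          proof -
            have "q ^ i * q ^ (N - i) dvd (c * p ^ i) * (- (s * q)) ^ (N - i)"
              using dv by (intro mult_dvd_mono dvd_power_same) auto
            moreover have "q ^ i * q ^ (N - i) = q ^ N" using that by (simp flip: power_add)
            ultimately have "q ^ N dvd of_nat (N choose i) * ((c * p ^ i) * (- (s * q)) ^ (N - i))"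
              by (metis dvd_mult)
            then show ?thesis by (simp only: mult.assoc mult.left_commute)
          qed
          then have "q ^ N dvd c * (p + - (s * q)) ^ N"
            unfolding binomial_ring sum_distrib_left by (intro dvd_sum) auto
          then show ?thesis by (simp add: p'_def)
        qed
        ultimately show ?thesis using 1 m' by blast
      qed simp
      then have "q dvd p' + s * q" by (intro dvd_add) auto
      then show "q dvd p" by (simp add: p'_def)
    qed
  qed
  then show ?thesis
    using assms(3) leading_exists[of p] by (cases "p = 0") auto
qed

section \<open>Integral closedness of \<open>k[x]\<close> in \<open>k(x)\<close>\<close>

lemma of_mpoly_in_polys [simp]: "of_mpoly p \<in> polys"
  by (simp add: polys_def)

lemma polys_add: "a \<in> polys \<Longrightarrow> b \<in> polys \<Longrightarrow> a + b \<in> polys"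
  unfolding polys_def by (auto simp flip: of_mpoly.add)

lemma polys_mult: "a \<in> polys \<Longrightarrow> b \<in> polys \<Longrightarrow> a * b \<in> polys"
  unfolding polys_def by (auto simp flip: of_mpoly.mult)

lemma polys_minus: "a \<in> polys \<Longrightarrow> - a \<in> polys"
  unfolding polys_def by (auto simp flip: of_mpoly.neg)

lemma polys_sum: "(\<And>x. x \<in> A \<Longrightarrow> f x \<in> polys) \<Longrightarrow> sum f A \<in> polys"
  by (induction A rule: infinite_finite_induct)
    (auto simp: polys_add simp del: of_mpoly_in_polys intro: polys_add of_mpoly_in_polys[of 0, unfolded of_mpoly.zero])

lemma polys_power: "a \<in> polys \<Longrightarrow> a ^ n \<in> polys"
  unfolding polys_def by (auto simp flip: of_mpoly.power)

text \<open>With \<open>d\<close> the degree of the monic equation, every power of \<open>z\<close>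
  is a \<open>k[x]\<close>-combination of those below \<open>z ^ d\<close>. So the single
  denominator \<open>q ^ d\<close> serves for all powers, and \<open>p / q\<close> is almost
  integral.\<close>

lemma integral_over_polys:
  fixes z :: "('n::{finite,linorder}, 'k::field) ratfun"
  assumes "integral_over polys z"
  shows "z \<in> polys"
proof -
  obtain P where P: "lead_coeff P = 1" "\<And>i. coeff P i \<in> polys" "poly P z = 0"
    using assms by (auto simp: integral_over_def)
  obtain p q where pq: "q \<noteq> 0" "z = of_mpoly p / of_mpoly q" by (rule ratfun_cases)
  let ?d = "degree P"
  have d: "?d > 0" using P by (intro Nat.gr0I) (auto elim!: degree_eq_zeroE)
  have zd: "z ^ ?d = - (\<Sum>i<?d. coeff P i * z ^ i)"
    using P(1,3) by (simp add: poly_altdef lessThan_Suc_atMost[symmetric] eq_neg_iff_add_eq_0 add.commute)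
  have *: "of_mpoly q ^ ?d * z ^ N \<in> polys" for N
  proof (induction N rule: less_induct)
    case (less N)
    show ?case
    proof (cases "N < ?d")
      case True
      then have "of_mpoly q ^ ?d * z ^ N = of_mpoly (q ^ (?d - N) * p ^ N)"
        using pq by (simp add: of_mpoly.hom_simps power_divide power_diff)
      then show ?thesis by (simp only: of_mpoly_in_polys)
    next
      case False
      have "z ^ N = z ^ (N - ?d) * z ^ ?d" using False by (simp flip: power_add)
      then have "of_mpoly q ^ ?d * z ^ N =
          - (\<Sum>i<?d. coeff P i * (of_mpoly q ^ ?d * z ^ (N - ?d + i)))"
        unfolding zd by (simp add: sum_distrib_left sum_distrib_right power_add algebra_simps)
      moreover have "coeff P i * (of_mpoly q ^ ?d * z ^ (N - ?d + i)) \<in> polys" if "i < ?d" for i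
        using that False by (intro polys_mult P(2) less.IH) auto
      ultimately show ?thesis by (simp only:) (intro polys_minus polys_sum, auto)
    qed
  qed
  have "q ^ N dvd q ^ ?d * p ^ N" for N
  proof -
    obtain r where r: "of_mpoly q ^ ?d * z ^ N = of_mpoly r" using * by (auto simp: polys_def)
    then have "of_mpoly (q ^ ?d * p ^ N) = of_mpoly (r * q ^ N)"
      using pq by (simp add: of_mpoly.hom_simps power_divide field_simps)
    then show ?thesis by (simp del: of_mpoly.hom_simps)
  qed
  then have "q dvd p"
    using dvd_if_almost_integral[of "q ^ ?d" q p] pq(1) by (metis power_not_zero)
  then obtain r where "p = q * r" by (auto simp: dvd_def)
  then show ?thesis using pq by (simp add: of_mpoly.mult)
qed

section \<open>Transcendence degree\<close>

text \<open>Independence is stated for an indexed family because products with different exponents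
  are not known in advance to be distinct. A coincidence would be a relation with coefficients 1 and
  -1.\<close>

lemma (in vector_space) family_card_le:
  assumes "finite I" "finite T" "v ` I \<subseteq> span T"
    and "\<And>c i. (\<Sum>i\<in>I. c i *s v i) = 0 \<Longrightarrow> i \<in> I \<Longrightarrow> c i = 0"
  shows "card I \<le> card T"
proof -
  have inj: "inj_on v I"
  proof (rule inj_onI, rule ccontr)
    fix i j assume ij: "i \<in> I" "j \<in> I" "v i = v j" "i \<noteq> j"
    define c where "c = (\<lambda>l. (if l = i then 1 else 0) - (if l = j then 1 else (0::'a)))"
    have "(\<Sum>l\<in>I. c l *s v l) = (\<Sum>l\<in>I. if l = i then v i else 0) - (\<Sum>l\<in>I. if l = j then v j else 0)"
      unfolding sum_subtractf[symmetric] by (intro sum.cong) (auto simp: c_def scale_left_diff_distrib)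
    also have "\<dots> = 0" using ij assms(1) by simp
    finally have "c i = 0" using assms(4) ij(1) by blast
    then show False using ij(4) by (simp add: c_def)
  qed
  have "independent (v ` I)"
  proof (rule independent_if_scalars_zero)
    fix f x assume "(\<Sum>x\<in>v ` I. f x *s x) = 0" "x \<in> v ` I"
    then show "f x = 0"
      using assms(4)[of "\<lambda>i. f (v i)"] by (auto simp: sum.reindex[OF inj])
  qed (use assms(1) in simp)
  then have "card (v ` I) \<le> card T"
    using independent_span_bound[OF assms(2) _ assms(3)] by blast
  then show ?thesis by (simp add: card_image[OF inj])
qed

section \<open>Total degree and dimension counts\<close>

interpretation mpoly: vector_space "\<lambda>(c::'k::field) p. mconst c * (p :: ('n::linorder, 'k) mpoly)"
  by unfold_locales (simp_all add: mconst.hom_simps algebra_simps)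

definition tdeg :: "('n::finite \<Rightarrow>\<^sub>0 nat) \<Rightarrow> nat" where
  "tdeg m = (\<Sum>i\<in>UNIV. lkp m i)"

lemma tdeg_add [simp]: "tdeg (m + m') = tdeg m + tdeg m'"
  by (simp add: tdeg_def lookup_add sum.distrib)

lemma tdeg_0 [simp]: "tdeg 0 = 0"
  by (simp add: tdeg_def)

lemma lookup_le_tdeg: "lkp m i \<le> tdeg m"
  unfolding tdeg_def by (rule member_le_sum) auto

definition deg_le :: "('n::finite, 'k::zero) mpoly \<Rightarrow> nat \<Rightarrow> bool" where
  "deg_le p d \<longleftrightarrow> (\<forall>m\<in>supp p. tdeg m \<le> d)"

lemma deg_le_mono: "deg_le p d \<Longrightarrow> d \<le> e \<Longrightarrow> deg_le p e"
  by (auto simp: deg_le_def)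

lemma deg_le_add: "deg_le p d \<Longrightarrow> deg_le q d \<Longrightarrow> deg_le (p + q) d"
  unfolding deg_le_def using subsetD[OF keys_add[of p q]] by blast

lemma deg_le_mult:
  fixes p q :: "('n::finite, 'k::comm_ring_1) mpoly"
  assumes "deg_le p d" "deg_le q e"
  shows "deg_le (p * q) (d + e)"
  unfolding deg_le_def
proof
  fix m assume "m \<in> supp (p * q)"
  then obtain u v where "u \<in> supp p" "v \<in> supp q" "m = u + v"
    using subsetD[OF keys_mult] by blast
  then show "tdeg m \<le> d + e" using assms by (auto simp: deg_le_def intro: add_mono)
qed

lemma deg_le_1: "deg_le (1 :: ('n::finite, 'k::zero_neq_one) mpoly) d"
  by (simp add: deg_le_def)

lemma deg_le_mconst: "deg_le (mconst c :: ('n::finite, 'k::zero) mpoly) d"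
  by (auto simp: deg_le_def mconst_def)

lemma deg_le_power: "deg_le (p :: ('n::finite, 'k::comm_ring_1) mpoly) d \<Longrightarrow> deg_le (p ^ n) (n * d)"
  by (induction n) (auto simp: deg_le_1 intro: deg_le_mult)

lemma deg_le_prod:
  "(\<And>x. x \<in> A \<Longrightarrow> deg_le (f x :: ('n::finite, 'k::comm_ring_1) mpoly) d) \<Longrightarrow> deg_le (prod f A) (card A * d)"
  by (induction A rule: infinite_finite_induct) (auto simp: deg_le_1 intro: deg_le_mult)

lemma deg_le_exists: "\<exists>d. deg_le p d"
proof
  show "deg_le p (\<Sum>m\<in>supp p. tdeg m)"
    unfolding deg_le_def by (auto intro: member_le_sum)
qed

lemma deg_le_family:
  assumes "finite A"
  shows "\<exists>d. \<forall>x\<in>A. deg_le (f x) d"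
  using assms
proof induction
  case (insert x A)
  then obtain d e where "\<forall>x\<in>A. deg_le (f x) d" "deg_le (f x) e" using deg_le_exists by blast
  then have "\<forall>y\<in>insert x A. deg_le (f y) (max d e)" by (auto intro: deg_le_mono)
  then show ?case by blast
qed simp

lemma common_denominator:
  fixes S :: "('n::linorder, 'k::field) ratfun set"
  assumes "finite S"
  shows "\<exists>q. q \<noteq> 0 \<and> (\<forall>s\<in>S. of_mpoly q * s \<in> polys)"
  using assms
proof induction
  case empty
  show ?case by (intro exI[of _ 1]) simp
next
  case (insert z S)
  then obtain q where q: "q \<noteq> 0" "\<And>s. s \<in> S \<Longrightarrow> of_mpoly q * s \<in> polys" by blast
  obtain a b where ab: "b \<noteq> 0" "z = of_mpoly a / of_mpoly b" by (rule ratfun_cases)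
  have "of_mpoly (b * q) * s \<in> polys" if "s \<in> insert z S" for s
  proof (cases "s = z")
    case True
    then have "of_mpoly (b * q) * s = of_mpoly (q * a)" using ab by (simp add: of_mpoly.mult)
    then show ?thesis by (simp only: of_mpoly_in_polys)
  next
    case False
    then have "s \<in> S" using that by simp
    then have "of_mpoly b * (of_mpoly q * s) \<in> polys" by (rule polys_mult[OF of_mpoly_in_polys q(2)])
    then show ?thesis by (simp add: of_mpoly.mult mult.assoc)
  qed
  then show ?case using q(1) ab(1) by (intro exI[of _ "b * q"]) auto
qed

text \<open>The linear form of independence used for counting. Injectivity of \<open>E\<close> keeps
  coefficients of different indices from merging in one monomial.\<close>

lemma alg_independent_family:
  assumes S: "alg_independent S" and I: "finite I" "inj_on E I" "\<And>e. e \<in> I \<Longrightarrow> supp (E e) \<subseteq> S"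
    and zero: "(\<Sum>e\<in>I. rat_const (c e) * mono_eval id (E e)) = 0" and e: "e \<in> I"
  shows "c e = 0"
proof -
  define p where "p = (\<Sum>e\<in>I. sgl (E e) (c e))"
  have lkp: "lkp p m = (\<Sum>e\<in>I. if E e = m then c e else 0)" for m
    unfolding p_def lookup_sum by (intro sum.cong) (auto simp: lookup_single when_def)
  have "mpoly_eval rat_const id p = 0"
    unfolding p_def rhom.sum[OF rhom_mpoly_eval[OF rhom_rat_const]]
    using zero by (simp add: mpoly_eval_single[OF rhom_rat_const])
  moreover have "supp m \<subseteq> S" if "m \<in> supp p" for m
  proof -
    have "\<exists>e\<in>I. E e = m"
    proof (rule ccontr)
      assume "\<not> ?thesis"
      then have "lkp p m = 0" unfolding lkp by (intro sum.neutral) auto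
      then show False using that by (simp add: in_keys_iff)
    qed
    then show ?thesis using I(3) by blast
  qed
  ultimately have "p = 0" using S unfolding alg_independent_def by blast
  then have "0 = (\<Sum>e'\<in>I. if E e' = E e then c e' else 0)" using lkp[of "E e"] by simp
  also have "\<dots> = (\<Sum>e'\<in>I. if e' = e then c e' else 0)"
    using I(2) e by (intro sum.cong) (auto dest: inj_onD)
  also have "\<dots> = c e" using e I(1) by simp
  finally show ?thesis by simp
qed

lemma supp_sum_single: "finite S \<Longrightarrow> supp (\<Sum>s\<in>S. sgl s (e s)) \<subseteq> S"
  using keys_sum[of "\<lambda>s. sgl s (e s)" S] by (auto split: if_splits)

lemma lookup_sum_single:
  "finite S \<Longrightarrow> lkp (\<Sum>s\<in>S. sgl s (e s)) t = (if t \<in> S then e t else (0::nat))"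
  unfolding lookup_sum by (simp add: lookup_single when_def)

lemma mono_eval_sum: "finite S \<Longrightarrow> mono_eval x (\<Sum>s\<in>S. f s) = (\<Prod>s\<in>S. mono_eval x (f s))"
  by (induction S rule: finite_induct) (auto simp: mono_eval_add)

text \<open>The box of exponents bounded by \<open>d\<close> in each variable contains all those of
  total degree at most \<open>d\<close>, and its size \<open>(d + 1)^n\<close> is immediate; only
  the growth rate matters for the counts.\<close>

lemma deg_le_span:
  fixes p :: "('n::{finite,linorder}, 'k::field) mpoly"
  assumes "deg_le p d"
  shows "p \<in> mpoly.span ((\<lambda>e. sgl (\<Sum>i\<in>UNIV. sgl i (e i)) 1) ` (UNIV \<rightarrow>\<^sub>E {..d}))"
    (is "_ \<in> mpoly.span ?T")
proof -
  have "sgl m (lkp p m) \<in> mpoly.span ?T" if "m \<in> supp p" for m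
  proof -
    have "m = (\<Sum>i\<in>UNIV. sgl i (lkp m i))"
      by (rule poly_mapping_eqI) (simp add: lookup_sum_single)
    moreover have "lkp m \<in> UNIV \<rightarrow>\<^sub>E {..d}"
      using assms that lookup_le_tdeg[of m] unfolding deg_le_def by (auto intro: order.trans)
    ultimately have "sgl m 1 \<in> ?T" by (intro image_eqI[of _ _ "lkp m"]) auto
    from mpoly.span_scale[OF mpoly.span_base[OF this], of "lkp p m"] show ?thesis
      by (simp add: mconst_def mult_single)
  qed
  then have "(\<Sum>m\<in>supp p. sgl m (lkp p m)) \<in> mpoly.span ?T" by (rule mpoly.span_sum)
  then show ?thesis by (simp flip: mpoly_sum)
qed

text \<open>
  Compares the \<open>(m + 1)\<^sup>N\<close> monomials of multidegree at most \<open>m\<close> in \<open>N\<close> independent elements with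
  the \<open>O(m)\<^sup>n\<close> monomials that can occur in them once denominators are cleared.
\<close>

lemma card_alg_independent_le:
  fixes S :: "('n::{finite,linorder}, 'k::field) ratfun set"
  assumes "finite S" "alg_independent S"
  shows "card S \<le> card (UNIV :: 'n set)"
proof (rule ccontr)
  let ?N = "card S" and ?n = "card (UNIV :: 'n set)"
  assume "\<not> ?N \<le> ?n"
  then have N: "Suc ?n \<le> ?N" by simp
  obtain q where q: "q \<noteq> 0" "\<And>s. s \<in> S \<Longrightarrow> of_mpoly q * s \<in> polys"
    using common_denominator[OF assms(1)] by blast
  then have "\<forall>s\<in>S. \<exists>f. of_mpoly q * s = of_mpoly f" by (auto simp: polys_def)
  then obtain f where f: "\<And>s. s \<in> S \<Longrightarrow> of_mpoly q * s = of_mpoly (f s)" by metis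
  obtain d1 d2 where "\<forall>s\<in>S. deg_le (f s) d1" "deg_le q d2"
    using deg_le_family[OF assms(1)] deg_le_exists by blast
  then obtain d where d: "\<And>s. s \<in> S \<Longrightarrow> deg_le (f s) d" "deg_le q d"
    by (meson deg_le_mono max.cobounded1 max.cobounded2)
  \<comment> \<open>Chosen for the final estimate. With \<open>N = card S\<close> and
    \<open>n\<close> variables,
    \<open>(N m d + 1)^n \<le> (m + 1)^n (N d + 1)^n = (m + 1)^n m\<close>, which is less than
    \<open>(m + 1)^(n + 1)\<close>.\<close>
  define m where "m = (?N * d + 1) ^ ?n"
  define I where "I = (S \<rightarrow>\<^sub>E {..m})"
  \<comment> \<open>Each factor is padded with powers of \<open>q\<close>, so that all products
    share the factor \<open>q ^ (m * card S)\<close> and a relation among them is one among the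
    monomials in \<open>S\<close>.\<close>
  define v where "v = (\<lambda>e. \<Prod>s\<in>S. f s ^ e s * q ^ (m - e s))"
  define E where "E = (\<lambda>e. \<Sum>s\<in>S. sgl s (e s :: nat))"
  have fin: "finite I" unfolding I_def by (intro finite_PiE assms) auto
  have inj: "inj_on E I"
  proof (rule inj_onI)
    fix e e' assume *: "e \<in> I" "e' \<in> I" "E e = E e'"
    have "e s = e' s" if "s \<in> S" for s
      using that arg_cong[OF *(3), of "\<lambda>g. lkp g s"] by (simp add: E_def lookup_sum_single assms(1))
    then show "e = e'" using * by (auto simp: I_def intro: PiE_ext)
  qed
  have ofv: "of_mpoly (v e) = of_mpoly q ^ (m * ?N) * mono_eval id (E e)" if "e \<in> I" for e
  proof -
    have "of_mpoly (v e) = (\<Prod>s\<in>S. of_mpoly q ^ m * s ^ e s)"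
      unfolding v_def of_mpoly.prod
    proof (intro prod.cong refl)
      fix s assume s: "s \<in> S"
      then have "e s \<le> m" using that by (auto simp: I_def)
      then have "of_mpoly q ^ m = of_mpoly q ^ e s * of_mpoly q ^ (m - e s)" by (simp flip: power_add)
      then show "of_mpoly (f s ^ e s * q ^ (m - e s)) = of_mpoly q ^ m * s ^ e s"
        by (simp add: of_mpoly.hom_simps power_mult_distrib mult_ac flip: f[OF s])
    qed
    then show ?thesis
      by (simp add: E_def mono_eval_sum assms(1) prod.distrib power_mult)
  qed
  let ?T = "(\<lambda>e. sgl (\<Sum>i\<in>UNIV. sgl i (e i)) 1) ` (UNIV \<rightarrow>\<^sub>E {..?N * (m * d)}) :: ('n, 'k) mpoly set"
  have "card I \<le> card ?T"
  proof (rule mpoly.family_card_le[OF fin, of ?T v])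
    show "finite ?T" by (intro finite_imageI finite_PiE) auto
    show "v ` I \<subseteq> mpoly.span ?T"
    proof
      fix x assume "x \<in> v ` I"
      then obtain e where e: "e \<in> I" "x = v e" by blast
      have "deg_le (f s ^ e s * q ^ (m - e s)) (m * d)" if s: "s \<in> S" for s
      proof -
        have "e s \<le> m" using e s by (auto simp: I_def)
        then have "e s * d + (m - e s) * d = m * d" by (simp flip: add_mult_distrib)
        then show ?thesis using deg_le_mult[OF deg_le_power[OF d(1)[OF s]] deg_le_power[OF d(2)]]
          by metis
      qed
      then have "deg_le x (?N * (m * d))" unfolding e(2) v_def by (rule deg_le_prod)
      then show "x \<in> mpoly.span ?T" by (rule deg_le_span)
    qed
    fix c e assume *: "(\<Sum>e\<in>I. mconst (c e) * v e) = 0" "e \<in> I"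
    have "0 = of_mpoly (\<Sum>e\<in>I. mconst (c e) * v e)" using * by (simp add: of_mpoly.zero)
    also have "\<dots> = of_mpoly q ^ (m * ?N) * (\<Sum>e\<in>I. rat_const (c e) * mono_eval id (E e))"
      by (simp add: of_mpoly.sum of_mpoly.mult ofv sum_distrib_left rat_const_def mult_ac)
    finally have "(\<Sum>e\<in>I. rat_const (c e) * mono_eval id (E e)) = 0" using q(1) by simp
    from alg_independent_family[OF assms(2) fin inj _ this *(2)] show "c e = 0"
      using supp_sum_single[OF assms(1)] unfolding E_def by blast
  qed
  also have "card ?T \<le> card (UNIV \<rightarrow>\<^sub>E {..?N * (m * d)} :: ('n \<Rightarrow> nat) set)"
    by (intro card_image_le finite_PiE) auto
  also have "\<dots> = (?N * (m * d) + 1) ^ ?n" by (simp add: card_PiE)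
  also have "\<dots> \<le> ((m + 1) * (?N * d + 1)) ^ ?n"
    by (intro power_mono) (auto simp: algebra_simps)
  also have "\<dots> = (m + 1) ^ ?n * m" unfolding power_mult_distrib m_def ..
  finally have "(m + 1) ^ ?N \<le> (m + 1) ^ ?n * m" using assms(1) by (simp add: I_def card_PiE)
  moreover have "(m + 1) ^ Suc ?n \<le> (m + 1) ^ ?N" using N by (intro power_increasing) auto
  ultimately have "(m + 1) ^ Suc ?n \<le> (m + 1) ^ ?n * m" by (rule order.trans[rotated])
  then show False unfolding power_Suc2 by simp
qed

lemma alg_independent_empty: "alg_independent ({} :: ('n::linorder, 'k::field) ratfun set)"
  unfolding alg_independent_def
proof (intro allI impI, elim conjE)
  fix p :: "(('n, 'k) ratfun, 'k) mpoly"
  assume p: "\<forall>m\<in>supp p. supp m \<subseteq> {}" "mpoly_eval rat_const id p = 0"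
  then have "supp p \<subseteq> {0}" by auto
  then have "mpoly_eval rat_const id p = rat_const (lkp p 0)"
    by (subst mpoly_eval_superset[OF rhom_rat_const, of "{0}"]) auto
  then have "lkp p 0 = 0" using p(2) by simp
  then show "p = 0" using \<open>supp p \<subseteq> {0}\<close> by (metis in_keys_iff keys_eq_empty subset_singletonD singletonI)
qed

text \<open>The bound by the number of variables leaves finitely many cardinalities, and the empty
  set provides one, so the supremum is a maximum.\<close>

lemma trdeg_attained:
  fixes A :: "('n::{finite,linorder}, 'k::field) ratfun set"
  obtains S where "finite S" "S \<subseteq> A" "alg_independent S" "trdeg A = enat (card S)"
proof -
  define C where "C = {S. finite S \<and> S \<subseteq> A \<and> alg_independent S}"
  have "card ` C \<subseteq> {..card (UNIV :: 'n set)}" unfolding C_def using card_alg_independent_le by blast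
  then have fin: "finite (card ` C)" by (rule finite_subset) auto
  have "{} \<in> C" unfolding C_def by (simp add: alg_independent_empty)
  then have "Max (card ` C) \<in> card ` C" using fin by (intro Max_in) auto
  then obtain S where S: "S \<in> C" "card S = Max (card ` C)" by auto
  have "trdeg A = (SUP S\<in>C. enat (card S))" by (simp add: trdeg_def C_def)
  also have "\<dots> = enat (card S)"
  proof (rule antisym)
    show "(SUP S\<in>C. enat (card S)) \<le> enat (card S)"
      using fin by (intro SUP_least) (auto simp: S(2))
    show "enat (card S) \<le> (SUP S\<in>C. enat (card S))"
      using S(1) by (rule SUP_upper)
  qed
  finally show ?thesis using S(1) that unfolding C_def by blast
qed

lemma trdeg_ge: "finite S \<Longrightarrow> S \<subseteq> A \<Longrightarrow> alg_independent S \<Longrightarrow> enat (card S) \<le> trdeg A"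
  unfolding trdeg_def by (rule SUP_upper) auto

lemma rhom_const_poly: "rhom (\<lambda>a. [:a:])"
  by unfold_locales (simp_all add: one_pCons)

text \<open>By minimality a largest independent set \<open>S\<close> inside
  \<open>R = M \<inter> polys\<close> is also largest in \<open>M\<close>. So each \<open>z\<close>
  in \<open>M\<close> outside \<open>S\<close> satisfies an equation over \<open>k[S]\<close>; with
  \<open>b\<close> its leading coefficient, \<open>b * z\<close> is integral over \<open>R\<close>,
  and normality of \<open>k[x]\<close> puts it in \<open>R\<close>.\<close>

lemma quot_field_minimal:
  fixes M :: "('n::{finite,linorder}, 'k::field) ratfun set"
  assumes M: "intermediate_field M" and min: "minimal_field M"
  shows "quot_field (M \<inter> polys) = M"
proof -
  let ?R = "M \<inter> polys"
  have R: "rat_const a \<in> ?R" "x \<in> ?R \<Longrightarrow> y \<in> ?R \<Longrightarrow> x + y \<in> ?R \<and> x * y \<in> ?R" for a x y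
    using M by (auto simp: intermediate_field_def polys_add polys_mult rat_const_def)
  obtain S where S: "finite S" "S \<subseteq> ?R" "alg_independent S" "trdeg ?R = enat (card S)"
    by (rule trdeg_attained)
  have "z \<in> quot_field ?R" if z: "z \<in> M" for z
  proof (cases "z \<in> S")
    case True
    then show ?thesis unfolding quot_field_def using S(2) R(1)[of 1]
      by (intro CollectI exI[of _ z] exI[of _ 1]) (auto simp: rat_const.one)
  next
    case False
    have "\<not> alg_independent (insert z S)"
    proof
      assume "alg_independent (insert z S)"
      then have "enat (card (insert z S)) \<le> trdeg M" using S z by (intro trdeg_ge) auto
      moreover have "trdeg M = enat (card S)" using min S(4) unfolding minimal_field_def by simp
      ultimately show False using S(1) False by simp
    qed
    then obtain p where p: "\<And>m. m \<in> supp p \<Longrightarrow> supp m \<subseteq> insert z S" "mpoly_eval rat_const id p = 0" "p \<noteq> 0"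
      unfolding alg_independent_def by blast
    define c where "c = (\<lambda>a. [:rat_const a :: ('n, 'k) ratfun:])"
    have c: "rhom c" unfolding c_def by (rule rhom_comp[OF rhom_const_poly rhom_rat_const])
    \<comment> \<open>Reads the relation \<open>p\<close> as a polynomial in one indeterminate
      standing for \<open>z\<close>, with coefficients in \<open>k[S]\<close>.\<close>
    define X where "X = (\<lambda>v. if v = z then [:0, 1:] else [:v:])"
    define P where "P = mpoly_eval c X p"
    have ev: "rhom (\<lambda>P. poly P z)" by unfold_locales auto
    have "poly P z = mpoly_eval (\<lambda>a. poly (c a) z) (\<lambda>i. poly (X i) z) p"
      unfolding P_def mpoly_eval_altdef by (simp add: rhom.hom_simps[OF ev] mono_eval_def)
    also have "(\<lambda>a. poly (c a) z) = rat_const" by (simp add: c_def)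
    also have "(\<lambda>i. poly (X i) z) = id" by (auto simp: X_def)
    finally have Pz: "poly P z = 0" using p(2) by (simp only:)
    define rest where "rest = (\<lambda>m :: _ \<Rightarrow>\<^sub>0 nat. m - sgl z (lkp m z))"
    have m_eq: "m = rest m + sgl z (lkp m z)" for m
      by (rule poly_mapping_eqI) (auto simp: rest_def lookup_add lookup_minus lookup_single when_def)
    have rest_supp: "supp (rest m) \<subseteq> S" if "m \<in> supp p" for m
    proof
      fix v assume "v \<in> supp (rest m)"
      then have "v \<noteq> z" "v \<in> supp m"
        by (auto simp: rest_def in_keys_iff lookup_minus lookup_single when_def split: if_splits)
      then show "v \<in> S" using p(1)[OF that] by blast
    qed
    have mono_X: "mono_eval X m = monom (mono_eval id (rest m)) (lkp m z)" if "m \<in> supp p" for m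
    proof -
      have "mono_eval X (rest m) = (\<Prod>v\<in>supp (rest m). [:v ^ lkp (rest m) v:])"
        unfolding mono_eval_def using rest_supp[OF that] False
        by (intro prod.cong) (auto simp: X_def poly_const_pow)
      also have "\<dots> = [:mono_eval id (rest m):]"
        unfolding mono_eval_def by (simp add: rhom.prod[OF rhom_const_poly])
      finally show ?thesis
        by (subst m_eq[of m], unfold mono_eval_add) (simp add: X_def monom_altdef)
    qed
    have coeff: "coeff P j = (\<Sum>m | m \<in> supp p \<and> lkp m z = j. rat_const (lkp p m) * mono_eval id (rest m))"
      for j
    proof -
      have "coeff P j = (\<Sum>m\<in>supp p. if lkp m z = j then rat_const (lkp p m) * mono_eval id (rest m) else 0)"
        unfolding P_def mpoly_eval_altdef coeff_sum
        by (intro sum.cong) (auto simp: c_def mono_X)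
      then show ?thesis by (simp add: sum.inter_filter)
    qed
    have coeff_R: "coeff P j \<in> ?R" for j
    proof -
      have prod: "(\<And>x. x \<in> A \<Longrightarrow> g x \<in> ?R) \<Longrightarrow> prod g A \<in> ?R" for g :: "_ \<Rightarrow> ('n, 'k) ratfun" and A
        by (induction A rule: infinite_finite_induct) (use R R(1)[of 1] in \<open>auto simp: rat_const.one\<close>)
      have pow: "x \<in> ?R \<Longrightarrow> x ^ n \<in> ?R" for x n
        by (induction n) (use R R(1)[of 1] in \<open>auto simp: rat_const.one\<close>)
      have sum: "(\<And>x. x \<in> A \<Longrightarrow> g x \<in> ?R) \<Longrightarrow> sum g A \<in> ?R" for g :: "_ \<Rightarrow> ('n, 'k) ratfun" and A
        by (induction A rule: infinite_finite_induct) (use R R(1)[of 0] in \<open>auto simp: rat_const.zero\<close>)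
      have "mono_eval id (rest m) \<in> ?R" if "m \<in> supp p" for m
        unfolding mono_eval_def using rest_supp[OF that] S(2) by (intro prod pow) auto
      then show ?thesis unfolding coeff using R by (intro sum) blast
    qed
    \<comment> \<open>Monomials of \<open>p\<close> with equal exponent at \<open>z\<close> have
      distinct parts in \<open>S\<close>, so a vanishing coefficient of \<open>P\<close> would be a
      relation in \<open>S\<close>.\<close>
    have "P \<noteq> 0"
    proof
      assume P0: "P = 0"
      obtain m0 where m0: "m0 \<in> supp p" using p(3) by (metis all_not_in_conv keys_eq_empty)
      let ?I = "{m \<in> supp p. lkp m z = lkp m0 z}"
      have "inj_on rest ?I" by (rule inj_onI) (metis (mono_tags, lifting) m_eq mem_Collect_eq)
      moreover have "(\<Sum>m\<in>?I. rat_const (lkp p m) * mono_eval id (rest m)) = 0"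
        using coeff[of "lkp m0 z"] P0 by simp
      ultimately have "lkp p m0 = 0"
        using m0 rest_supp by (intro alg_independent_family[OF S(3), of ?I rest]) auto
      then show False using m0 by (simp add: in_keys_iff)
    qed
    define d where "d = degree P"
    define b where "b = lead_coeff P"
    have b: "b \<noteq> 0" "b \<in> ?R" using \<open>P \<noteq> 0\<close> coeff_R by (auto simp: b_def)
    have d: "d > 0"
      using \<open>P \<noteq> 0\<close> Pz unfolding d_def by (intro Nat.gr0I) (auto elim!: degree_eq_zeroE)
    \<comment> \<open>The monic equation for \<open>b * z\<close>, obtained from
      \<open>P(z) = 0\<close> by multiplying with \<open>b ^ (d - 1)\<close>.\<close>
    define Q where "Q = (\<Sum>i<d. monom (coeff P i * b ^ (d - 1 - i)) i) + monom 1 d"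
    have coeff_Q: "coeff Q i = (if i < d then coeff P i * b ^ (d - 1 - i) else if i = d then 1 else 0)" for i
      unfolding Q_def by (simp add: coeff_sum)
    have "degree Q = d"
      by (rule antisym) (auto intro!: degree_le le_degree simp: coeff_Q)
    have "integral_over polys (b * z)"
      unfolding integral_over_def
    proof (intro exI conjI allI)
      show "lead_coeff Q = 1" by (simp add: coeff_Q \<open>degree Q = d\<close>)
      fix i
      show "coeff Q i \<in> polys"
        using coeff_R b of_mpoly_in_polys[of 0] of_mpoly_in_polys[of 1]
        by (auto simp: coeff_Q of_mpoly.hom_simps intro: polys_mult polys_power)
    next
      have "poly Q (b * z) = (\<Sum>i<d. coeff P i * b ^ (d - 1 - i) * (b * z) ^ i) + (b * z) ^ d"
        by (simp add: Q_def poly_sum poly_monom)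
      also have "(\<Sum>i<d. coeff P i * b ^ (d - 1 - i) * (b * z) ^ i) = (\<Sum>i<d. b ^ (d - 1) * (coeff P i * z ^ i))"
      proof (intro sum.cong refl)
        fix i assume "i \<in> {..<d}"
        then have "b ^ (d - 1) = b ^ (d - 1 - i) * b ^ i" by (simp flip: power_add)
        then show "coeff P i * b ^ (d - 1 - i) * (b * z) ^ i = b ^ (d - 1) * (coeff P i * z ^ i)"
          by (simp add: power_mult_distrib)
      qed
      also have "(b * z) ^ d = b ^ (d - 1) * (coeff P d * z ^ d)"
        using d by (cases d) (simp_all add: power_mult_distrib b_def d_def)
      also have "(\<Sum>i<d. b ^ (d - 1) * (coeff P i * z ^ i)) + b ^ (d - 1) * (coeff P d * z ^ d) = b ^ (d - 1) * poly P z"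
        unfolding poly_altdef d_def[symmetric] sum_distrib_left lessThan_Suc_atMost[symmetric]
        by simp
      finally show "poly Q (b * z) = 0" using Pz by simp
    qed
    then have "b * z \<in> ?R" using integral_over_polys z b M by (auto simp: intermediate_field_def)
    then show ?thesis unfolding quot_field_def using b
      by (intro CollectI exI[of _ "b * z"] exI[of _ b]) auto
  qed
  moreover have "quot_field ?R \<subseteq> M"
    using M unfolding quot_field_def intermediate_field_def by (auto simp: divide_inverse)
  ultimately show ?thesis by blast
qed

section \<open>Leading forms\<close>

text \<open>Independence of a pair, spelled out over a box of exponents: the form that matches the
  products \<open>f ^ i * g ^ j\<close> to be counted and that is easily carried along an
  automorphism.\<close>

definition mono_independent :: "('n::linorder, 'k::field) ratfun \<Rightarrow> ('n, 'k) ratfun \<Rightarrow> bool" where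
  "mono_independent f g \<longleftrightarrow>
     (\<forall>N c. (\<Sum>(i, j)\<in>{..N} \<times> {..N}. rat_const (c i j) * f ^ i * g ^ j) = 0 \<longrightarrow> (\<forall>i\<le>N. \<forall>j\<le>N. c i j = 0))"

lemma mono_independent_exists:
  fixes M :: "('n::{finite,linorder}, 'k::field) ratfun set"
  assumes "trdeg M \<ge> 2" "minimal_field M"
  obtains f g where "f \<in> M \<inter> polys" "g \<in> M \<inter> polys" "mono_independent f g"
proof -
  obtain S where S: "finite S" "S \<subseteq> M \<inter> polys" "alg_independent S" "trdeg (M \<inter> polys) = enat (card S)"
    by (rule trdeg_attained)
  have "enat 2 \<le> enat (card S)" using assms S(4) unfolding minimal_field_def by (simp add: numeral_eq_enat)
  then obtain f g where fg: "f \<in> S" "g \<in> S" "f \<noteq> g"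
    by (metis card_le_Suc0_iff_eq S(1) enat_ord_simps(1) not_less_eq_eq numeral_2_eq_2)
  have "mono_independent f g"
    unfolding mono_independent_def
  proof (intro allI impI)
    fix N c i j
    assume sum: "(\<Sum>(i, j)\<in>{..N} \<times> {..N}. rat_const (c i j) * f ^ i * g ^ j) = 0"
      and ij: "i \<le> N" "j \<le> (N::nat)"
    let ?I = "{..N} \<times> {..N}" and ?E = "\<lambda>(i, j). sgl f i + sgl g j :: _ \<Rightarrow>\<^sub>0 nat"
    have "inj_on ?E ?I"
    proof (rule inj_onI, clarify)
      fix i j i' j' assume *: "sgl f i + sgl g j = sgl f i' + sgl g (j' :: nat)"
      show "i = i' \<and> j = j'"
        using arg_cong[OF *, of "\<lambda>m. lkp m f"] arg_cong[OF *, of "\<lambda>m. lkp m g"] fg(3)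
        by (simp add: lookup_add lookup_single)
    qed
    moreover have "supp (?E e) \<subseteq> S" for e
    proof (cases e)
      case (Pair i j)
      have "supp (sgl f i + sgl g j) \<subseteq> {f} \<union> {g}"
        by (rule order.trans[OF keys_add]) auto
      then show ?thesis using fg(1,2) Pair by auto
    qed
    moreover have "(\<Sum>e\<in>?I. rat_const (case_prod c e) * mono_eval id (?E e)) = 0"
      using sum by (simp add: case_prod_beta mono_eval_add mult.assoc)
    ultimately show "c i j = 0"
      using alg_independent_family[OF S(3), of ?I ?E "case_prod c" "(i, j)"] ij by simp
  qed
  then show ?thesis using that fg S(2) by blast
qed

lemma lookup_mconst_mult [simp]: "lkp (mconst a * p) m = a * lkp (p :: ('n, 'k::field) mpoly) m"
proof (induction p rule: poly_mapping_induct)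
  case (single k b)
  then show ?case by (simp add: mconst_def mult_single lookup_single when_def)
qed (simp_all add: ring_distribs lookup_add)

text \<open>
  If any two elements of degree at most \<open>D\<close> had proportional leading forms, the elements of degree
  at most \<open>D\<close> would span a space of dimension at most \<open>D + 1\<close>, too small for the \<open>f\<^sup>i g\<^sup>j\<close>.
\<close>

lemma independent_leading_forms:
  fixes M :: "('n::{finite,linorder}, 'k::field) ratfun set"
  assumes M: "intermediate_field M"
    and fg: "f \<in> M \<inter> polys" "g \<in> M \<inter> polys" "mono_independent f g"
  obtains p q :: "('n, 'k) mpoly" and D where
    "of_mpoly p \<in> M" "of_mpoly q \<in> M" "deg_le p D" "deg_le q D"
    "\<And>\<alpha> \<beta>. \<alpha> \<noteq> 0 \<or> \<beta> \<noteq> 0 \<Longrightarrow> \<exists>m. tdeg m = D \<and> \<alpha> * lkp p m + \<beta> * lkp q m \<noteq> 0"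
proof (rule ccontr)
  assume none: "\<not> thesis"
  note found = that
  have contra: "\<exists>\<alpha> \<beta>. (\<alpha> \<noteq> 0 \<or> \<beta> \<noteq> 0) \<and> (\<forall>m. tdeg m = D \<longrightarrow> \<alpha> * lkp p m + \<beta> * lkp q m = 0)"
    if "of_mpoly p \<in> M" "of_mpoly q \<in> M" "deg_le p D" "deg_le q D" for p q :: "('n, 'k) mpoly" and D
  proof (rule ccontr)
    assume *: "\<not> ?thesis"
    have thesis
      by (rule found[of p q D]) (use that * in blast)+
    then show False using none by contradiction
  qed
  have R: "of_mpoly (mconst a) \<in> M" "of_mpoly p \<in> M \<Longrightarrow> of_mpoly q \<in> M \<Longrightarrow> of_mpoly (p + q) \<in> M"
    "of_mpoly p \<in> M \<Longrightarrow> of_mpoly q \<in> M \<Longrightarrow> of_mpoly (p * q) \<in> M"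
    for a and p q :: "('n, 'k) mpoly"
    using M unfolding intermediate_field_def rat_const_def by (auto simp: of_mpoly.hom_simps)
  have R_power: "of_mpoly p \<in> M \<Longrightarrow> of_mpoly (p ^ n) \<in> M" for p :: "('n, 'k) mpoly" and n
    by (induction n) (use R(3) R(1)[of 1] in \<open>auto simp: mconst.one\<close>)
  \<comment> \<open>Each degree contributes at most one dimension: once some \<open>r\<close> has
    exact degree \<open>D\<close>, every \<open>p\<close> of degree at most \<open>D\<close> is a
    multiple of \<open>r\<close> plus an element of degree below \<open>D\<close>.\<close>
  have claim: "\<exists>T. finite T \<and> card T \<le> D \<and>
    {p. of_mpoly p \<in> M \<and> (\<forall>m\<in>supp p. tdeg m < D)} \<subseteq> mpoly.span T" for D
  proof (induction D)
    case 0
    show ?case by (intro exI[of _ "{}"]) auto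
  next
    case (Suc D)
    then obtain T where T: "finite T" "card T \<le> D"
      "{p. of_mpoly p \<in> M \<and> (\<forall>m\<in>supp p. tdeg m < D)} \<subseteq> mpoly.span T" by blast
    show ?case
    proof (cases "\<exists>r m. of_mpoly r \<in> M \<and> deg_le r D \<and> tdeg m = D \<and> lkp r m \<noteq> 0")
      case False
      have "{p. of_mpoly p \<in> M \<and> (\<forall>m\<in>supp p. tdeg m < Suc D)} \<subseteq>
          {p. of_mpoly p \<in> M \<and> (\<forall>m\<in>supp p. tdeg m < D)}"
      proof safe
        fix p m assume p: "of_mpoly p \<in> M" "\<forall>m\<in>supp p. tdeg m < Suc D" "m \<in> supp p"
        then have "deg_le p D" by (auto simp: deg_le_def less_Suc_eq_le)
        then have "tdeg m \<noteq> D" using False p by (auto simp: in_keys_iff)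
        then show "tdeg m < D" using p by (auto simp: less_Suc_eq)
      qed
      then show ?thesis using T by (intro exI[of _ T]) auto
    next
      case True
      then obtain r m where r: "of_mpoly r \<in> M" "deg_le r D" "tdeg m = D" "lkp r m \<noteq> 0" by blast
      have "p \<in> mpoly.span (insert r T)" if p: "of_mpoly p \<in> M" "\<forall>m\<in>supp p. tdeg m < Suc D" for p
      proof -
        have dp: "deg_le p D" using p(2) by (auto simp: deg_le_def less_Suc_eq_le)
        obtain \<alpha> \<beta> where ab: "\<alpha> \<noteq> 0 \<or> \<beta> \<noteq> 0"
          "\<And>m. tdeg m = D \<Longrightarrow> \<alpha> * lkp p m + \<beta> * lkp r m = 0"
          using contra[OF p(1) r(1) dp r(2)] by blast
        have "\<alpha> \<noteq> 0" using ab(1) ab(2)[OF r(3)] r(4) by auto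
        define q where "q = p + mconst (\<beta> / \<alpha>) * r"
        have "of_mpoly q \<in> M" unfolding q_def by (intro R p r)
        moreover have "tdeg m < D" if "m \<in> supp q" for m
        proof -
          have "deg_le q (0 + D)" unfolding q_def
            using deg_le_mult[OF deg_le_mconst[of _ 0] r(2)] dp by (intro deg_le_add) auto
          then have "tdeg m \<le> D" using that by (auto simp: deg_le_def)
          moreover have "lkp q m = lkp p m + \<beta> / \<alpha> * lkp r m"
            unfolding q_def lookup_add lookup_mconst_mult ..
          then have "lkp q m = 0" if "tdeg m = D"
            using ab(2)[OF that] \<open>\<alpha> \<noteq> 0\<close> by (simp add: field_simps)
          ultimately show ?thesis using that by (auto simp: in_keys_iff order_less_le)
        qed
        ultimately have "q \<in> mpoly.span (insert r T)"
          using T(3) mpoly.span_mono[of T "insert r T"] by blast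
        then have "q - mconst (\<beta> / \<alpha>) * r \<in> mpoly.span (insert r T)"
          by (intro mpoly.span_diff mpoly.span_scale[OF mpoly.span_base]) auto
        then show ?thesis by (simp add: q_def)
      qed
      then show ?thesis using T
        by (intro exI[of _ "insert r T"]) (auto simp: card_insert_if)
    qed
  qed
  obtain F G where FG: "f = of_mpoly F" "g = of_mpoly G" using fg by (auto simp: polys_def)
  obtain d1 d2 where "deg_le F d1" "deg_le G d2" using deg_le_exists by blast
  then obtain d where d: "deg_le F d" "deg_le G d" "d \<ge> 1"
    using deg_le_mono[of F d1 "d1 + d2 + 1"] deg_le_mono[of G d2 "d1 + d2 + 1"] by auto
  \<comment> \<open>Makes \<open>2 * N * d = N^2\<close>, so that \<open>(N + 1)^2\<close>
    independent products exceed the available dimension \<open>N^2 + 1\<close>.\<close>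
  define N where "N = 2 * d"
  obtain T :: "('n, 'k) mpoly set" where T: "finite T" "card T \<le> Suc (2 * N * d)"
    "{p. of_mpoly p \<in> M \<and> (\<forall>m\<in>supp p. tdeg m < Suc (2 * N * d))} \<subseteq> mpoly.span T"
    using claim by blast
  define v where "v = (\<lambda>(i, j). F ^ i * G ^ j)"
  have "card ({..N} \<times> {..N}) \<le> card T"
  proof (rule mpoly.family_card_le[of _ T v])
    show "v ` ({..N} \<times> {..N}) \<subseteq> mpoly.span T"
    proof
      fix x assume "x \<in> v ` ({..N} \<times> {..N})"
      then obtain i j where ij: "i \<le> N" "j \<le> N" "x = F ^ i * G ^ j" by (auto simp: v_def)
      have "deg_le x (i * d + j * d)" unfolding ij by (intro deg_le_mult deg_le_power d)
      moreover have "i * d + j * d \<le> 2 * N * d"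
        using add_mono[OF mult_le_mono1[OF ij(1), of d] mult_le_mono1[OF ij(2), of d]]
        by (simp add: mult_2 add_mult_distrib)
      ultimately have "deg_le x (2 * N * d)" by (rule deg_le_mono)
      moreover have "of_mpoly x \<in> M" unfolding ij using fg FG by (intro R R_power) auto
      ultimately show "x \<in> mpoly.span T" using T(3) by (auto simp: deg_le_def less_Suc_eq_le)
    qed
    fix c e assume *: "(\<Sum>e\<in>{..N} \<times> {..N}. mconst (c e) * v e) = 0" "e \<in> {..N} \<times> {..N}"
    have "0 = of_mpoly (\<Sum>e\<in>{..N} \<times> {..N}. mconst (c e) * v e)" using * by (simp add: of_mpoly.zero)
    also have "\<dots> = (\<Sum>(i, j)\<in>{..N} \<times> {..N}. rat_const (c (i, j)) * f ^ i * g ^ j)"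
      by (simp add: of_mpoly.hom_simps v_def FG rat_const_def case_prod_beta mult.assoc)
    finally have "(\<Sum>(i, j)\<in>{..N} \<times> {..N}. rat_const (c (i, j)) * f ^ i * g ^ j) = 0" by (rule sym)
    from fg(3)[unfolded mono_independent_def, THEN spec, THEN spec, THEN mp, OF this]
    show "c e = 0" using *(2) by auto
  qed (use T in auto)
  then have "(N + 1) * (N + 1) \<le> Suc (2 * N * d)" using T(2) by simp
  then show False using d(3) by (simp add: N_def algebra_simps)
qed

text \<open>Each new weight exceeds all weighted sums formed so far, so a non-zero new entry cannot
  be cancelled. The weight at \<open>j\<close> starts the induction and can be prescribed; it is 1
  because that coordinate of the curve has to be \<open>\<rho> t\<close>.\<close>

lemma separating_weights:
  fixes V :: "('n \<Rightarrow> int) set"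
  assumes "finite J" "finite V" "j \<notin> J"
  shows "\<exists>b :: 'n \<Rightarrow> nat. b j = 1 \<and>
    (\<forall>v\<in>V. (\<exists>i\<in>insert j J. v i \<noteq> 0) \<longrightarrow> (\<Sum>i\<in>insert j J. int (b i) * v i) \<noteq> 0)"
  using assms(1,3)
proof (induction J)
  case empty
  show ?case by (intro exI[of _ "\<lambda>_. 1"]) simp
next
  case (insert l J)
  then obtain b :: "'n \<Rightarrow> nat" where b: "b j = 1"
    "\<And>v. v \<in> V \<Longrightarrow> \<exists>i\<in>insert j J. v i \<noteq> 0 \<Longrightarrow> (\<Sum>i\<in>insert j J. int (b i) * v i) \<noteq> 0"
    by auto
  define B where "B = (\<Sum>v\<in>V. nat \<bar>\<Sum>i\<in>insert j J. int (b i) * v i\<bar>)"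
  define b' where "b' = b(l := Suc B)"
  have l: "l \<noteq> j" "l \<notin> insert j J" using insert by auto
  have sum: "(\<Sum>i\<in>insert j (insert l J). int (b' i) * v i) =
      int (Suc B) * v l + (\<Sum>i\<in>insert j J. int (b i) * v i)" for v
  proof -
    have "(\<Sum>i\<in>insert j (insert l J). int (b' i) * v i) = (\<Sum>i\<in>insert l (insert j J). int (b' i) * v i)"
      by (simp add: insert_commute)
    also have "\<dots> = int (b' l) * v l + (\<Sum>i\<in>insert j J. int (b' i) * v i)"
      using l insert(1) by (intro sum.insert) auto
    also have "(\<Sum>i\<in>insert j J. int (b' i) * v i) = (\<Sum>i\<in>insert j J. int (b i) * v i)"
      using l by (intro sum.cong) (auto simp: b'_def)
    finally show ?thesis by (simp add: b'_def)
  qed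
  have "(\<Sum>i\<in>insert j (insert l J). int (b' i) * v i) \<noteq> 0"
    if v: "v \<in> V" "\<exists>i\<in>insert j (insert l J). v i \<noteq> 0" for v
  proof (cases "v l = 0")
    case True
    then show ?thesis using b(2)[OF v(1)] v(2) by (simp add: sum)
  next
    case False
    have "nat \<bar>\<Sum>i\<in>insert j J. int (b i) * v i\<bar> \<le> B"
      unfolding B_def using v(1) assms(2) by (intro member_le_sum) auto
    then have *: "\<bar>\<Sum>i\<in>insert j J. int (b i) * v i\<bar> \<le> int B" by linarith
    have "int (Suc B) * 1 \<le> int (Suc B) * \<bar>v l\<bar>" using False by (intro mult_left_mono) auto
    then have "int B < \<bar>int (Suc B) * v l\<bar>" unfolding abs_mult abs_of_nat
      by (rule order.strict_trans2[rotated]) simp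
    then show ?thesis using * unfolding sum by linarith
  qed
  then show ?case using b(1) l(1) by (intro exI[of _ b']) (auto simp: b'_def)
qed

section \<open>Degrees along a curve\<close>

definition wt :: "('n::finite \<Rightarrow> nat) \<Rightarrow> ('n \<Rightarrow>\<^sub>0 nat) \<Rightarrow> nat" where
  "wt b m = (\<Sum>i\<in>UNIV. b i * lkp m i)"

definition curve :: "'k::field poly \<Rightarrow> ('n \<Rightarrow> nat) \<Rightarrow> ('n, 'k) mpoly \<Rightarrow> 'k poly" where
  "curve \<rho> b = mpoly_eval (\<lambda>a. [:a:]) (\<lambda>i. \<rho> * monom 1 (b i))"

text \<open>For \<open>p\<close> of degree at most \<open>D\<close>, the form of degree
  \<open>D\<close> in \<open>p\<close> evaluated at the point with coordinates
  \<open>t ^ b i\<close>; on the curve it is multiplied by \<open>\<rho> ^ D\<close>.\<close>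

definition leading_form :: "('n::finite \<Rightarrow> nat) \<Rightarrow> nat \<Rightarrow> ('n, 'k::field) mpoly \<Rightarrow> 'k poly" where
  "leading_form b D p = (\<Sum>m | m \<in> supp p \<and> tdeg m = D. monom (lkp p m) (wt b m))"

lemma rhom_curve: "rhom (curve \<rho> b)"
  unfolding curve_def by (rule rhom_mpoly_eval[OF rhom_const_poly])

lemma curve_mconst: "curve \<rho> b (mconst a) = [:a:]"
  unfolding curve_def by (rule mpoly_eval_mconst[OF rhom_const_poly])

lemma mono_eval_curve:
  fixes m :: "'n::finite \<Rightarrow>\<^sub>0 nat"
  shows "mono_eval (\<lambda>i. \<rho> * monom (1::'k::field) (b i)) m = \<rho> ^ tdeg m * monom 1 (wt b m)"
proof -
  have *: "(\<Prod>i\<in>A. monom (1::'k) (e i)) = monom 1 (sum e A)" if "finite A" for A and e :: "'n \<Rightarrow> nat"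
    using that by (induction A) (simp_all add: mult_monom one_pCons monom_0)
  have "mono_eval (\<lambda>i. \<rho> * monom (1::'k) (b i)) m = (\<Prod>i\<in>UNIV. (\<rho> * monom 1 (b i)) ^ lkp m i)"
    by (rule mono_eval_superset) auto
  also have "\<dots> = (\<Prod>i\<in>UNIV. \<rho> ^ lkp m i) * (\<Prod>i\<in>UNIV. monom 1 (b i * lkp m i))"
    by (simp add: power_mult_distrib prod.distrib monom_power)
  finally show ?thesis by (simp add: * tdeg_def wt_def power_sum)
qed

lemma smult_mult_monom: "smult c (f * monom 1 n) = f * monom (c :: 'k::field) n"
  by (metis mult.right_neutral mult_smult_right smult_monom)

lemma curve_split:
  fixes p :: "('n::{finite,linorder}, 'k::field) mpoly"
  assumes "deg_le p D"
  shows "curve \<rho> b p = \<rho> ^ D * leading_form b D p +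
    (\<Sum>m | m \<in> supp p \<and> tdeg m < D. \<rho> ^ tdeg m * monom (lkp p m) (wt b m))"
proof -
  have "supp p = {m. m \<in> supp p \<and> tdeg m = D} \<union> {m. m \<in> supp p \<and> tdeg m < D}"
    using assms by (auto simp: deg_le_def order_le_less)
  then have "curve \<rho> b p = (\<Sum>m\<in>{m. m \<in> supp p \<and> tdeg m = D} \<union> {m. m \<in> supp p \<and> tdeg m < D}.
      \<rho> ^ tdeg m * monom (lkp p m) (wt b m))"
    unfolding curve_def mpoly_eval_altdef
    by (intro sum.cong) (auto simp: mono_eval_curve smult_mult_monom)
  also have "\<dots> = (\<Sum>m | m \<in> supp p \<and> tdeg m = D. \<rho> ^ tdeg m * monom (lkp p m) (wt b m)) +
      (\<Sum>m | m \<in> supp p \<and> tdeg m < D. \<rho> ^ tdeg m * monom (lkp p m) (wt b m))"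
    by (intro sum.union_disjoint) auto
  also have "(\<Sum>m | m \<in> supp p \<and> tdeg m = D. \<rho> ^ tdeg m * monom (lkp p m) (wt b m)) =
      \<rho> ^ D * leading_form b D p"
    by (simp add: leading_form_def sum_distrib_left)
  finally show ?thesis .
qed

text \<open>The coefficient just below the leading one, and 0 for constants. Reading it from the
  reversed polynomial gives a product rule, since reversal is multiplicative.\<close>

definition second_coeff :: "'k::field poly \<Rightarrow> 'k" where
  "second_coeff f = coeff (reflect_poly f) 1"

lemma second_coeff_mult:
  "second_coeff (f * g) = second_coeff f * lead_coeff g + lead_coeff f * second_coeff g"
  unfolding second_coeff_def reflect_poly_mult coeff_mult by simp

lemma second_coeff_power:
  "second_coeff (f ^ n) = of_nat n * lead_coeff f ^ (n - 1) * second_coeff f"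
proof (induction n)
  case 0
  show ?case by (simp add: second_coeff_def)
next
  case (Suc n)
  then show ?case
    by (cases n) (simp_all add: second_coeff_mult lead_coeff_mult lead_coeff_power algebra_simps second_coeff_def[of 1])
qed

lemma degree_lower_terms:
  fixes f g :: "'k::field poly"
  assumes "g = 0 \<or> degree g + 1 < degree f"
  shows "degree (f + g) = degree f" "lead_coeff (f + g) = lead_coeff f"
    "second_coeff (f + g) = second_coeff f"
proof -
  have "degree (f + g) = degree f \<and> lead_coeff (f + g) = lead_coeff f \<and> second_coeff (f + g) = second_coeff f"
  proof (cases "g = 0")
    case False
    then have dg: "degree g + 1 < degree f" using assms by simp
    then have "degree (f + g) = degree f" by (intro degree_add_eq_left) simp
    then show ?thesis using dg by (simp add: second_coeff_def coeff_reflect_poly coeff_eq_0)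
  qed simp
  then show "degree (f + g) = degree f" "lead_coeff (f + g) = lead_coeff f"
    "second_coeff (f + g) = second_coeff f" by auto
qed

text \<open>
  Two polynomials whose degrees differ become comparable after raising to powers; the second
  coefficients decide whether the leading cancellation lowers the degree by exactly one.
\<close>

lemma degree_drop_one:
  fixes P Q :: "'k::field poly"
  assumes "degree P = A" "degree Q = B" "A > 0" "B > 0"
    and "of_nat B * lead_coeff Q * second_coeff P \<noteq> of_nat A * lead_coeff P * second_coeff Q"
  shows "degree (smult (lead_coeff Q ^ A) (P ^ B) - smult (lead_coeff P ^ B) (Q ^ A)) = A * B - 1"
    (is "degree ?Z = _")
proof (rule antisym)
  have PQ: "P \<noteq> 0" "Q \<noteq> 0" using assms(1-4) by auto
  have deg: "degree (P ^ B) = A * B" "degree (Q ^ A) = A * B"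
    using PQ assms(1,2) by (simp_all add: degree_power_eq mult.commute)
  have lc: "coeff (P ^ B) (A * B) = lead_coeff P ^ B" "coeff (Q ^ A) (A * B) = lead_coeff Q ^ A"
    using deg lead_coeff_power[of P B] lead_coeff_power[of Q A] by simp_all
  have AB: "0 < A * B" using assms by simp
  have "coeff ?Z i = 0" if "i > A * B - 1" for i
  proof (cases "i = A * B")
    case True
    then show ?thesis using lc by (simp add: mult.commute)
  next
    case False
    then show ?thesis using that deg by (simp add: coeff_eq_0)
  qed
  then show "degree ?Z \<le> A * B - 1" by (intro degree_le) auto
  have sc: "coeff (P ^ B) (A * B - 1) = second_coeff (P ^ B)" "coeff (Q ^ A) (A * B - 1) = second_coeff (Q ^ A)"
    using AB deg unfolding second_coeff_def coeff_reflect_poly by auto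
  let ?p = "lead_coeff P" and ?q = "lead_coeff Q"
  have pow: "?p ^ B = ?p ^ (B - 1) * ?p" "?q ^ A = ?q ^ (A - 1) * ?q"
    using assms(3,4) by (simp_all flip: power_Suc2)
  have "coeff ?Z (A * B - 1) = ?q ^ A * (of_nat B * ?p ^ (B - 1) * second_coeff P) -
      ?p ^ B * (of_nat A * ?q ^ (A - 1) * second_coeff Q)"
    unfolding coeff_diff coeff_smult sc second_coeff_power ..
  also have "\<dots> = ?p ^ (B - 1) * ?q ^ (A - 1) *
      (of_nat B * ?q * second_coeff P - of_nat A * ?p * second_coeff Q)"
    unfolding pow by (simp add: algebra_simps)
  also have "\<dots> \<noteq> 0" using PQ assms(5) by simp
  finally show "A * B - 1 \<le> degree ?Z" by (rule le_degree)
qed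

text \<open>Independence leaves \<open>v + c u\<close> non-zero after the leading terms cancel.
  Distinct degrees are what makes the comparison of second coefficients depend on the parameter
  \<open>\<eta>\<close> of the curve.\<close>

lemma linear_combination_degrees_differ:
  fixes u v :: "'k::field poly"
  assumes "\<And>\<alpha> \<beta>. \<alpha> \<noteq> 0 \<or> \<beta> \<noteq> 0 \<Longrightarrow> smult \<alpha> u + smult \<beta> v \<noteq> 0"
  shows "\<exists>c. degree (v + smult c u) \<noteq> degree u"
proof (cases "degree v = degree u")
  case True
  define c where "c = - lead_coeff v / lead_coeff u"
  have u: "u \<noteq> 0" using assms[of 1 0] by auto
  have nz: "v + smult c u \<noteq> 0" using assms[of c 1] by (simp add: add.commute)
  have "coeff (v + smult c u) (degree u) = 0" using True u by (simp add: c_def)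
  moreover have "lead_coeff (v + smult c u) \<noteq> 0" using nz leading_coeff_0_iff by blast
  ultimately have "degree (v + smult c u) \<noteq> degree u" by metis
  then show ?thesis by blast
next
  case False
  then show ?thesis by (intro exI[of _ 0]) simp
qed

lemma coeff_leading_form:
  assumes "inj_on (wt b) {m \<in> supp p. tdeg m = D}"
  shows "m \<in> supp p \<Longrightarrow> tdeg m = D \<Longrightarrow> coeff (leading_form b D p) (wt b m) = lkp p m"
proof -
  assume m: "m \<in> supp p" "tdeg m = D"
  have "coeff (leading_form b D p) (wt b m) =
      (\<Sum>m'\<in>{m \<in> supp p. tdeg m = D}. if wt b m' = wt b m then lkp p m' else 0)"
    by (simp add: leading_form_def coeff_sum)
  also have "\<dots> = (\<Sum>m'\<in>{m \<in> supp p. tdeg m = D}. if m' = m then lkp p m' else 0)"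
    using assms m by (intro sum.cong) (auto dest: inj_onD)
  finally show ?thesis using m by simp
qed

lemma leading_form_superset:
  assumes "finite A" "{m \<in> supp p. tdeg m = D} \<subseteq> A" "\<And>m. m \<in> A \<Longrightarrow> tdeg m = D"
  shows "leading_form b D p = (\<Sum>m\<in>A. monom (lkp p m) (wt b m))"
  unfolding leading_form_def using assms
  by (intro sum.mono_neutral_left) (auto simp: in_keys_iff)

lemma leading_form_add: "leading_form b D (p + q) = leading_form b D p + leading_form b D q"
proof -
  let ?A = "{m \<in> supp p \<union> supp q. tdeg m = D}"
  have "leading_form b D (p + q) = (\<Sum>m\<in>?A. monom (lkp (p + q) m) (wt b m))"
    using subsetD[OF keys_add[of p q]] by (intro leading_form_superset) auto
  also have "\<dots> = (\<Sum>m\<in>?A. monom (lkp p m) (wt b m)) + (\<Sum>m\<in>?A. monom (lkp q m) (wt b m))"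
    by (simp add: lookup_add sum.distrib flip: add_monom)
  also have "\<dots> = leading_form b D p + leading_form b D q"
    by (subst (1 2) leading_form_superset[of ?A]) auto
  finally show ?thesis .
qed

lemma smult_sum_right: "smult c (sum f A) = (\<Sum>x\<in>A. smult (c::'k::field) (f x))"
  by (induction A rule: infinite_finite_induct) (simp_all add: smult_add_right)

lemma leading_form_mconst_mult: "leading_form b D (mconst c * p) = smult c (leading_form b D p)"
proof -
  have "leading_form b D (mconst c * p) = (\<Sum>m | m \<in> supp p \<and> tdeg m = D. monom (lkp (mconst c * p) m) (wt b m))"
    by (intro leading_form_superset) (auto simp: in_keys_iff)
  then show ?thesis by (simp add: leading_form_def smult_sum_right smult_monom)
qed

text \<open>
  On \<open>\<gamma>\<^sub>i = \<rho> t\<^bsup>b\<^sub>i\<^esup>\<close> with \<open>\<rho> = t\<^sup>a + \<eta> t\<^bsup>a-1\<^esup>\<close> and \<open>a\<close> large, the leading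
  forms dominate. The parameter \<open>\<eta>\<close> shifts the ratio of the second to the leading coefficient.
\<close>

lemma curve_consecutive_degrees:
  fixes M :: "('n::{finite,linorder}, 'k::field_char_0) ratfun set" and i1 i2 :: 'n
  assumes M: "intermediate_field M" and ne: "i1 \<noteq> i2"
    and fg: "f \<in> M \<inter> polys" "g \<in> M \<inter> polys" "mono_independent f g"
  obtains \<rho> :: "'k poly" and b p q E where
    "[:0, 0, 1:] dvd \<rho>" "b i1 = 0" "b i2 = 1" "of_mpoly p \<in> M" "of_mpoly q \<in> M"
    "E \<ge> 2" "degree (curve \<rho> b p) = E" "degree (curve \<rho> b q) = E - 1"
proof -
  obtain p q0 :: "('n, 'k) mpoly" and D where
    pq0: "of_mpoly p \<in> M" "of_mpoly q0 \<in> M" "deg_le p D" "deg_le q0 D"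
    "\<And>\<alpha> \<beta>. \<alpha> \<noteq> 0 \<or> \<beta> \<noteq> 0 \<Longrightarrow> \<exists>m. tdeg m = D \<and> \<alpha> * lkp p m + \<beta> * lkp q0 m \<noteq> 0"
    by (rule independent_leading_forms[OF M fg]) blast
  define A where "A = {m \<in> supp p \<union> supp q0. tdeg m = D}"
  have finA: "finite A" unfolding A_def by auto
  \<comment> \<open>Exponents in \<open>A\<close> have total degree \<open>D\<close>, so the entry
    at \<open>i1\<close> is determined by the others. It can receive weight 0 while the remaining
    weights separate \<open>A\<close>.\<close>
  define V where "V = (\<lambda>(m, m') i. int (lkp m i) - int (lkp m' i)) ` (A \<times> A)"
  have "finite V" unfolding V_def using finA by auto
  then obtain b0 where b0: "b0 i2 = 1"
    "\<And>v. v \<in> V \<Longrightarrow> \<exists>i\<in>insert i2 (UNIV - {i1, i2}). v i \<noteq> 0 \<Longrightarrow>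
      (\<Sum>i\<in>insert i2 (UNIV - {i1, i2}). int (b0 i) * v i) \<noteq> 0"
    using separating_weights[of "UNIV - {i1, i2}" V i2] by auto
  have ins: "insert i2 (UNIV - {i1, i2}) = UNIV - {i1}" using ne by auto
  define b where "b = b0(i1 := 0)"
  have b: "b i1 = 0" "b i2 = 1" using b0(1) ne by (auto simp: b_def)
  have inj: "inj_on (wt b) A"
  proof (rule inj_onI, rule ccontr)
    fix m m' assume m: "m \<in> A" "m' \<in> A" "wt b m = wt b m'" "m \<noteq> m'"
    define v where "v = (\<lambda>i. int (lkp m i) - int (lkp m' i))"
    have "v \<in> V" unfolding V_def v_def using m by force
    have "(\<Sum>i\<in>UNIV. v i) = 0"
      using m by (simp add: v_def sum_subtractf A_def tdeg_def flip: of_nat_sum)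
    then have v1: "v i1 + (\<Sum>i\<in>UNIV - {i1}. v i) = 0" by (simp add: sum.remove[of UNIV i1])
    have "\<exists>i\<in>UNIV - {i1}. v i \<noteq> 0"
    proof (rule ccontr)
      assume *: "\<not> ?thesis"
      then have "v i1 = 0" using v1 by simp
      then have "v i = 0" for i using * by (cases "i = i1") auto
      then have "m = m'" by (intro poly_mapping_eqI) (simp add: v_def)
      then show False using m by simp
    qed
    then have "(\<Sum>i\<in>UNIV - {i1}. int (b0 i) * v i) \<noteq> 0"
      using b0(2)[OF \<open>v \<in> V\<close>] unfolding ins by blast
    also have "(\<Sum>i\<in>UNIV - {i1}. int (b0 i) * v i) = (\<Sum>i\<in>UNIV. int (b i) * v i)"
      by (simp add: sum.remove[of UNIV i1] b_def)
    also have "\<dots> = int (wt b m) - int (wt b m')"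
      by (simp add: v_def wt_def algebra_simps sum_subtractf)
    finally show False using m by simp
  qed
  define u where "u = leading_form b D p"
  define v where "v = leading_form b D q0"
  have indep: "smult \<alpha> u + smult \<beta> v \<noteq> 0" if ab: "\<alpha> \<noteq> 0 \<or> \<beta> \<noteq> 0" for \<alpha> \<beta>
  proof -
    obtain m where m: "tdeg m = D" "\<alpha> * lkp p m + \<beta> * lkp q0 m \<noteq> 0" using pq0(5)[OF ab] by blast
    define r where "r = mconst \<alpha> * p + mconst \<beta> * q0"
    have r: "lkp r m = \<alpha> * lkp p m + \<beta> * lkp q0 m" for m
      by (simp only: r_def lookup_add lookup_mconst_mult)
    then have "supp r \<subseteq> supp p \<union> supp q0" by (auto simp: in_keys_iff)
    then have "inj_on (wt b) {m \<in> supp r. tdeg m = D}"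
      using inj by (elim inj_on_subset) (auto simp: A_def)
    from coeff_leading_form[OF this, of m] m r have "leading_form b D r \<noteq> 0"
      by (auto simp: in_keys_iff)
    then show ?thesis by (simp add: r_def leading_form_add leading_form_mconst_mult u_def v_def)
  qed
  obtain c where c: "degree (v + smult c u) \<noteq> degree u"
    using linear_combination_degrees_differ[OF indep] by blast
  define q where "q = q0 + mconst c * p"
  define w where "w = leading_form b D q"
  have w: "w = v + smult c u" by (simp add: w_def q_def leading_form_add leading_form_mconst_mult u_def v_def)
  have nz: "u \<noteq> 0" "w \<noteq> 0" using indep[of 1 0] indep[of c 1] by (auto simp: w add.commute)
  have dw: "degree w \<noteq> degree u" using c by (simp add: w)
  have qM: "of_mpoly q \<in> M"
    using M pq0(1,2) unfolding q_def intermediate_field_def of_mpoly.hom_simps rat_const_def[symmetric]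
    by blast
  have dq: "deg_le q D"
    unfolding q_def using deg_le_mult[OF deg_le_mconst[of c 0] pq0(3)] pq0(4) by (intro deg_le_add) auto
  have D: "D > 0"
  proof (rule ccontr)
    assume "\<not> D > 0"
    then have 0: "m = 0" if "tdeg m = D" for m :: "'n \<Rightarrow>\<^sub>0 nat"
      using that by (intro poly_mapping_eqI) (simp add: tdeg_def)
    have "degree (leading_form b D r) \<le> 0" for r :: "('n, 'k) mpoly"
      unfolding leading_form_def
    proof (rule degree_sum_le)
      fix m assume "m \<in> {m \<in> supp r. tdeg m = D}"
      then have "m = 0" using 0 by blast
      then show "degree (monom (lkp r m) (wt b m)) \<le> 0"
        using degree_monom_le[of "lkp r m" "wt b m"] by (simp add: wt_def)
    qed simp
    then show False using dw unfolding w_def u_def by simp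
  qed
  define W where "W = (\<Sum>m\<in>supp p \<union> supp q. wt b m)"
  have W: "wt b m \<le> W" if "m \<in> supp p \<union> supp q" for m
    unfolding W_def using that by (intro member_le_sum) auto
  \<comment> \<open>Lower forms contribute degree at most \<open>a (D - 1) + W\<close>, the leading
    form at least \<open>a D\<close>. The gap of at least 3 protects the top two coefficients, and
    \<open>a \<ge> 3\<close> makes \<open>\<rho>\<close> divisible by \<open>t^2\<close>.\<close>
  define a where "a = W + 3"
  define \<rho> where "\<rho> = (\<lambda>\<eta> :: 'k. monom 1 a + monom \<eta> (a - 1))"
  have a: "a > 0" by (simp add: a_def)
  have rho_coeff: "coeff (\<rho> \<eta>) i = (if i = a then 1 else if i = a - 1 then \<eta> else 0)" for \<eta> i
    using a by (auto simp: \<rho>_def)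
  have rho: "degree (\<rho> \<eta>) = a" for \<eta>
    by (rule antisym) (auto intro!: degree_le le_degree simp: rho_coeff)
  then have rho_lc: "lead_coeff (\<rho> \<eta>) = 1" for \<eta> by (simp add: rho_coeff)
  have rho_sc: "second_coeff (\<rho> \<eta>) = \<eta>" for \<eta>
    using a by (simp add: second_coeff_def coeff_reflect_poly rho rho_coeff)
  have rho0: "\<rho> \<eta> \<noteq> 0" for \<eta> using rho_lc[of \<eta>] by auto
  have main: "degree (curve (\<rho> \<eta>) b r) = a * D + degree l \<and> lead_coeff (curve (\<rho> \<eta>) b r) = lead_coeff l \<and>
      second_coeff (curve (\<rho> \<eta>) b r) = of_nat D * \<eta> * lead_coeff l + second_coeff l"
    if r: "r = p \<or> r = q" and l: "l = leading_form b D r" for r l \<eta>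
  proof -
    have dr: "deg_le r D" and l0: "l \<noteq> 0" using r dq pq0(3) nz l unfolding u_def w_def by auto
    define R where "R = (\<Sum>m | m \<in> supp r \<and> tdeg m < D. \<rho> \<eta> ^ tdeg m * monom (lkp r m) (wt b m))"
    have split: "curve (\<rho> \<eta>) b r = \<rho> \<eta> ^ D * l + R"
      unfolding R_def l by (rule curve_split[OF dr])
    have deg: "degree (\<rho> \<eta> ^ D * l) = a * D + degree l"
      using rho0 l0 by (simp add: degree_mult_eq degree_power_eq rho mult.commute)
    have "degree R \<le> a * (D - 1) + W"
      unfolding R_def
    proof (rule degree_sum_le)
      fix m assume m: "m \<in> {m \<in> supp r. tdeg m < D}"
      have "degree (\<rho> \<eta> ^ tdeg m * monom (lkp r m) (wt b m)) \<le> tdeg m * a + wt b m"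
        using rho0 by (intro order.trans[OF degree_mult_le] add_mono degree_monom_le)
          (simp add: degree_power_eq rho)
      also have "\<dots> \<le> (D - 1) * a + W"
        using m r by (intro add_mono mult_le_mono W) auto
      finally show "degree (\<rho> \<eta> ^ tdeg m * monom (lkp r m) (wt b m)) \<le> a * (D - 1) + W"
        by (simp add: mult.commute)
    qed simp
    moreover have "a * (D - 1) + a = a * D" using D by (cases D) auto
    ultimately have "degree R + 1 < degree (\<rho> \<eta> ^ D * l)" unfolding deg by (simp add: a_def)
    then have "R = 0 \<or> degree R + 1 < degree (\<rho> \<eta> ^ D * l)" by simp
    note low = degree_lower_terms[OF this]
    have lc: "lead_coeff (\<rho> \<eta> ^ D * l) = lead_coeff l"
      unfolding lead_coeff_mult lead_coeff_power rho_lc by simp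
    have sc: "second_coeff (\<rho> \<eta> ^ D * l) = of_nat D * \<eta> * lead_coeff l + second_coeff l"
      unfolding second_coeff_mult second_coeff_power lead_coeff_power rho_lc rho_sc by simp
    show ?thesis
      using low(1) trans[OF low(2) lc] trans[OF low(3) sc] unfolding deg split by (intro conjI)
  qed
  define A' where "A' = a * D + degree u"
  define B' where "B' = a * D + degree w"
  have AB: "A' > 2" "B' > 2" "A' \<noteq> B'"
  proof -
    have "a * 1 \<le> a * D" using D by (intro mult_le_mono) auto
    moreover have "a > 2" by (simp add: a_def)
    ultimately show "A' > 2" "B' > 2" unfolding A'_def B'_def by linarith+
    show "A' \<noteq> B'" using dw by (simp add: A'_def B'_def)
  qed
  define bad where "bad = (\<lambda>\<eta>. of_nat B' * lead_coeff w * (of_nat D * \<eta> * lead_coeff u + second_coeff u) =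
      of_nat A' * lead_coeff u * (of_nat D * \<eta> * lead_coeff w + second_coeff w))"
  \<comment> \<open>\<open>bad\<close> is an affine equation in \<open>\<eta>\<close> whose linear
    coefficient is \<open>D (B' - A')\<close> times both leading coefficients, non-zero in
    characteristic 0. So at most one value is bad.\<close>
  have "\<not> (bad 0 \<and> bad 1)"
  proof
    assume "bad 0 \<and> bad 1"
    then have e: "of_nat B' * lead_coeff w * second_coeff u = of_nat A' * lead_coeff u * second_coeff w"
      "of_nat B' * lead_coeff w * (of_nat D * lead_coeff u + second_coeff u) =
        of_nat A' * lead_coeff u * (of_nat D * lead_coeff w + second_coeff w)"
      unfolding bad_def by simp_all
    have "of_nat B' * (of_nat D * lead_coeff u * lead_coeff w) = of_nat A' * (of_nat D * lead_coeff u * lead_coeff w)"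
      using e by (simp add: algebra_simps)
    then show False using D nz AB(3) by simp
  qed
  then obtain \<eta> where "\<not> bad \<eta>" by blast
  define P where "P = curve (\<rho> \<eta>) b p"
  define Q where "Q = curve (\<rho> \<eta>) b q"
  have PQ: "degree P = A'" "lead_coeff P = lead_coeff u"
    "second_coeff P = of_nat D * \<eta> * lead_coeff u + second_coeff u"
    "degree Q = B'" "lead_coeff Q = lead_coeff w"
    "second_coeff Q = of_nat D * \<eta> * lead_coeff w + second_coeff w"
    using main[of p u \<eta>] main[of q w \<eta>] unfolding P_def Q_def A'_def B'_def u_def w_def by auto
  \<comment> \<open>Both powers have degree \<open>A' * B'\<close> and the combination loses exactly
    one degree, so \<open>p ^ B'\<close> and \<open>z\<close> give the consecutive pair.\<close>
  define Z where "Z = smult (lead_coeff Q ^ A') (P ^ B') - smult (lead_coeff P ^ B') (Q ^ A')"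
  have degZ: "degree Z = A' * B' - 1"
    unfolding Z_def using PQ AB \<open>\<not> bad \<eta>\<close> by (intro degree_drop_one) (auto simp: bad_def)
  define z where "z = mconst (lead_coeff Q ^ A') * p ^ B' - mconst (lead_coeff P ^ B') * q ^ A'"
  have Z: "Z = curve (\<rho> \<eta>) b z"
    by (simp add: Z_def z_def P_def Q_def rhom.hom_simps[OF rhom_curve] curve_mconst)
  have Mpow: "of_mpoly r \<in> M \<Longrightarrow> of_mpoly (r ^ n) \<in> M" for r n
    by (induction n) (use M in \<open>auto simp: intermediate_field_def of_mpoly.hom_simps rat_const_def simp flip: rat_const.one\<close>)
  have "of_mpoly (p ^ B') \<in> M" "of_mpoly (q ^ A') \<in> M" using Mpow pq0(1) qM by auto
  moreover have "of_mpoly (mconst x) \<in> M" for x using M by (auto simp: intermediate_field_def rat_const_def)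
  ultimately have "of_mpoly z \<in> M"
    using M unfolding z_def intermediate_field_def diff_conv_add_uminus of_mpoly.add of_mpoly.neg of_mpoly.mult
    by blast
  have "P \<noteq> 0" using PQ(1) AB by auto
  then have "degree (curve (\<rho> \<eta>) b (p ^ B')) = A' * B'"
    using PQ(1) by (simp add: rhom.power[OF rhom_curve] degree_power_eq P_def[symmetric] mult.commute)
  moreover have "[:0, 0, 1:] dvd \<rho> \<eta>"
  proof -
    have "\<rho> \<eta> = monom 1 2 * (monom 1 (a - 2) + monom \<eta> (a - 3))"
      by (simp add: \<rho>_def a_def ring_distribs mult_monom numeral_3_eq_3)
    moreover have "monom 1 2 = [:0, 0, 1 :: 'k:]" by (simp add: monom_altdef numeral_2_eq_2)
    ultimately show ?thesis by (metis dvd_triv_left)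
  qed
  moreover have "2 * 1 \<le> A' * B'" using AB by (intro mult_le_mono) auto
  ultimately show ?thesis
    using that[of "\<rho> \<eta>" b "p ^ B'" z "A' * B'"] b \<open>of_mpoly (p ^ B') \<in> M\<close> \<open>of_mpoly z \<in> M\<close> degZ Z by simp
qed

section \<open>Non-normality of the restriction to the curve\<close>

interpretation upoly: vector_space "smult :: 'k::field \<Rightarrow> 'k poly \<Rightarrow> 'k poly"
  by unfold_locales (simp_all add: smult_add_left smult_add_right)

text \<open>
  The degrees \<open>E\<close> and \<open>E - 1\<close> generate all large degrees, so \<open>S\<close> has finite codimension in \<open>k[t]\<close>
  and some non-zero element of \<open>S\<close> stays in \<open>S\<close> after multiplication by \<open>t\<close>.
\<close>

lemma consecutive_degrees_conductor:
  fixes S :: "'k::field poly set"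
  assumes S: "\<And>a. [:a:] \<in> S" "\<And>f g. f \<in> S \<Longrightarrow> g \<in> S \<Longrightarrow> f + g \<in> S" "\<And>f g. f \<in> S \<Longrightarrow> g \<in> S \<Longrightarrow> f * g \<in> S"
    and UV: "U \<in> S" "V \<in> S" "degree U = E" "degree V = E - 1" "E \<ge> 2"
  shows "\<exists>s\<in>S. s \<noteq> 0 \<and> [:0, 1:] * s \<in> S"
proof -
  have S_power: "f \<in> S \<Longrightarrow> f ^ n \<in> S" for f n
    by (induction n) (use S(1)[of 1] S(3) in \<open>auto simp: one_pCons\<close>)
  have S_smult: "f \<in> S \<Longrightarrow> smult c f \<in> S" for f c
    using S(3)[OF S(1)[of c]] by fastforce
  have S_sum: "(\<And>x. x \<in> A \<Longrightarrow> h x \<in> S) \<Longrightarrow> sum h A \<in> S" for h :: "nat \<Rightarrow> _" and A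
    by (induction A rule: infinite_finite_induct) (use S(1)[of 0] S(2) in auto)
  have nz: "U \<noteq> 0" "V \<noteq> 0" using UV by auto
  \<comment> \<open>From this degree on, writing it as \<open>q (E - 1) + r\<close> with
    \<open>r < E - 1\<close> gives \<open>r \<le> q\<close>, so it equals
    \<open>r E + (q - r) (E - 1)\<close>, the degree of \<open>U ^ r * V ^ (q - r)\<close>.\<close>
  define N where "N = E * E"
  have reduce: "\<exists>s\<in>S. f - s = 0 \<or> degree (f - s) < N" for f
  proof (induction "degree f" arbitrary: f rule: less_induct)
    case less
    show ?case
    proof (cases "degree f < N \<or> f = 0")
      case True
      then show ?thesis using S(1)[of 0] by (intro bexI[of _ 0]) auto
    next
      case False
      define q r where "q = degree f div (E - 1)" and "r = degree f mod (E - 1)"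
      have qr: "degree f = q * (E - 1) + r" "r < E - 1" unfolding q_def r_def div_mult_mod_eq using UV(5) by auto
      have "r \<le> q"
      proof (rule ccontr)
        assume "\<not> r \<le> q"
        then have "q * (E - 1) \<le> (E - 1) * (E - 1)" using qr by (intro mult_le_mono) auto
        then have "degree f < (E - 1) * (E - 1) + (E - 1)" using qr by linarith
        also have "\<dots> = (E - 1) * E" using UV(5) by (cases E) auto
        also have "\<dots> \<le> N" unfolding N_def by (intro mult_le_mono) auto
        finally show False using False by simp
      qed
      define g where "g = U ^ r * V ^ (q - r)"
      have gS: "g \<in> S" unfolding g_def by (intro S S_power UV)
      have g0: "g \<noteq> 0" using nz by (simp add: g_def)
      have "degree g = r * E + (q - r) * (E - 1)"
        using nz by (simp add: g_def degree_mult_eq degree_power_eq UV)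
      also have "r * E = r * (E - 1) + r" using UV(5) by (cases E) auto
      also have "r * (E - 1) + r + (q - r) * (E - 1) = (r + (q - r)) * (E - 1) + r"
        by (simp only: add_mult_distrib)
      also have "\<dots> = degree f" using \<open>r \<le> q\<close> qr by simp
      finally have dg: "degree g = degree f" .
      define c where "c = lead_coeff f / lead_coeff g"
      define f' where "f' = f - smult c g"
      have "coeff g (degree f) \<noteq> 0" using g0 leading_coeff_0_iff[of g] unfolding dg by blast
      then have "coeff f' (degree f) = 0" using dg by (simp add: f'_def c_def)
      moreover have "degree f' \<le> degree f" unfolding f'_def using dg by (intro degree_diff_le) auto
      moreover have "degree f > 0"
      proof -
        have "0 < N" using UV(5) by (simp add: N_def)
        then show ?thesis using False by linarith
      qed
      ultimately have "f' = 0 \<or> degree f' < degree f"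
        by (metis leading_coeff_0_iff order_le_less)
      then have "\<exists>s\<in>S. f' - s = 0 \<or> degree (f' - s) < N"
        using less S(1)[of 0] by (cases "f' = 0") (auto intro!: bexI[of _ 0])
      then obtain s where s: "s \<in> S" "f' - s = 0 \<or> degree (f' - s) < N" by blast
      have "f - (smult c g + s) = f' - s" by (simp add: f'_def)
      then show ?thesis using s S(2)[OF S_smult[OF gS] s(1)] by metis
    qed
  qed
  then have "\<forall>i. \<exists>s\<in>S. [:0, 1:] * U ^ i - s = 0 \<or> degree ([:0, 1:] * U ^ i - s) < N" by blast
  then obtain s where s: "\<And>i. s i \<in> S"
    "\<And>i. [:0, 1:] * U ^ i - s i = 0 \<or> degree ([:0, 1:] * U ^ i - s i) < N" by metis
  \<comment> \<open>For \<open>i \<le> N\<close> these are \<open>N + 1\<close> remainders in the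
    \<open>N\<close>-dimensional space of polynomials of degree below \<open>N\<close>. A linear
    relation among them gives a combination of powers of \<open>U\<close> that \<open>t\<close>
    multiplies into \<open>S\<close>.\<close>
  define r where "r = (\<lambda>i. [:0, 1:] * U ^ i - s i)"
  let ?T = "monom (1::'k) ` {..<N}"
  have "r ` {..N} \<subseteq> upoly.span ?T"
  proof
    fix x assume "x \<in> r ` {..N}"
    then obtain i where "x = [:0, 1:] * U ^ i - s i" unfolding r_def by blast
    then have x: "x = 0 \<or> degree x < N" using s(2)[of i] by (simp only:)
    have "smult (coeff x i) (monom 1 i) \<in> upoly.span ?T" if "i \<in> {..degree x}" for i
    proof (cases "x = 0")
      case True
      then show ?thesis by (simp add: upoly.span_zero)
    next
      case False
      then have "i \<in> {..<N}" using x that by auto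
      then show ?thesis by (intro upoly.span_scale upoly.span_base) auto
    qed
    then have "(\<Sum>i\<le>degree x. smult (coeff x i) (monom 1 i)) \<in> upoly.span ?T" by (rule upoly.span_sum)
    also have "(\<Sum>i\<le>degree x. smult (coeff x i) (monom 1 i)) = x"
      using poly_as_sum_of_monoms[of x] by (simp add: smult_monom)
    finally show "x \<in> upoly.span ?T" .
  qed
  moreover have "card ?T \<le> N" using card_image_le[of "{..<N}" "monom (1::'k)"] by simp
  ultimately have "\<not> (\<forall>c. \<forall>i\<in>{..N}. (\<Sum>i\<in>{..N}. smult (c i) (r i)) = 0 \<longrightarrow> c i = 0)"
    using upoly.family_card_le[of "{..N}" ?T r] by (auto simp: atMost_iff)
  then obtain c i0 where c: "i0 \<le> N" "(\<Sum>i\<in>{..N}. smult (c i) (r i)) = 0" "c i0 \<noteq> 0" by auto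
  \<comment> \<open>The required element is \<open>C(U)\<close>, non-zero because \<open>U\<close>
    is not constant.\<close>
  define C where "C = (\<Sum>i\<le>N. monom (c i) i)"
  have "coeff C i0 = c i0" using c(1) by (simp add: C_def coeff_sum)
  then have "C \<noteq> 0" using c(3) by auto
  have pc: "rhom (\<lambda>f. pcompose f U)" by unfold_locales (simp_all add: pcompose_add pcompose_mult pcompose_1)
  have "pcompose C U = (\<Sum>i\<le>N. smult (c i) (U ^ i))"
    unfolding C_def pcompose_sum by (intro sum.cong) (simp_all add: monom_altdef pcompose_smult rhom.power[OF pc] pcompose_pCons)
  moreover have "pcompose C U \<noteq> 0" using \<open>C \<noteq> 0\<close> UV by (subst pcompose_eq_0_iff) auto
  ultimately have nz: "(\<Sum>i\<le>N. smult (c i) (U ^ i)) \<noteq> 0" by simp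
  have "[:0, 1:] * (\<Sum>i\<le>N. smult (c i) (U ^ i)) - (\<Sum>i\<le>N. smult (c i) (s i)) =
      (\<Sum>i\<le>N. smult (c i) (r i))"
    unfolding r_def sum_distrib_left sum_subtractf[symmetric]
    by (intro sum.cong) (simp_all add: smult_diff_right)
  then have "[:0, 1:] * (\<Sum>i\<le>N. smult (c i) (U ^ i)) = (\<Sum>i\<le>N. smult (c i) (s i))" using c(2) by simp
  moreover have "(\<Sum>i\<le>N. smult (c i) (s i)) \<in> S" "(\<Sum>i\<le>N. smult (c i) (U ^ i)) \<in> S"
    by (intro S_sum S_smult S_power s UV)+
  ultimately show ?thesis using nz by auto
qed

section \<open>The copy of \<open>k[t]\<close> in the first variable\<close>

lemma rhom_map_poly:
  assumes "rhom h"
  shows "rhom (map_poly h)"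
proof
  have 0: "h 0 = 0" by (rule rhom.zero[OF assms])
  show "map_poly h (a + b) = map_poly h a + map_poly h b" for a b
    by (rule poly_eqI) (simp add: coeff_map_poly 0 rhom.add[OF assms])
  show "map_poly h (a * b) = map_poly h a * map_poly h b" for a b
    by (rule poly_eqI) (simp add: coeff_map_poly 0 coeff_mult rhom.sum[OF assms] rhom.mult[OF assms])
  show "map_poly h 1 = 1" by (simp add: rhom.one[OF assms])
qed

lemma rhom_poly: "rhom (\<lambda>p. poly p x)"
  by unfold_locales auto

lemma rhom_poly_map: "rhom h \<Longrightarrow> rhom (\<lambda>p. poly (map_poly h p) x)"
  using rhom_comp[OF rhom_poly rhom_map_poly] .

lemma poly_map_poly_hom:
  assumes "rhom h"
  shows "h (poly p x) = poly (map_poly h p) (h x)"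
  by (induction p) (simp_all add: map_poly_pCons rhom.hom_simps[OF assms])

definition first_poly :: "'k::field poly \<Rightarrow> ('n::{finite,linorder}, 'k) mpoly" where
  "first_poly f = poly (map_poly mconst f) (mvar first_var)"

lemma rhom_first_poly: "rhom first_poly"
  unfolding first_poly_def by (rule rhom_poly_map[OF rhom_mconst])

lemma mvar_power: "(mvar i :: ('n, 'k::comm_ring_1) mpoly) ^ n = sgl (sgl i n) 1"
  by (induction n) (simp_all add: mvar_def mult_single single_add[symmetric])

lemma lookup_first_poly: "lkp (first_poly f :: ('n::{finite,linorder}, 'k::field) mpoly) (sgl first_var i) = coeff f i"
proof -
  have "lkp (first_poly f :: ('n, 'k) mpoly) (sgl first_var i) = (\<Sum>j\<le>degree f. if j = i then coeff f j else 0)"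
    unfolding first_poly_def poly_altdef lookup_sum
    by (intro sum.mono_neutral_cong_left)
      (auto simp: coeff_map_poly mvar_power lookup_single when_def inj_single[THEN injD]
        degree_map_poly coeff_eq_0 dest: injD[OF inj_single] arg_cong[where f = "\<lambda>m. lkp m first_var"])
  also have "\<dots> = coeff f i" by (simp add: coeff_eq_0)
  finally show ?thesis .
qed

lemma first_poly_inj: "first_poly f = (first_poly g :: ('n::{finite,linorder}, 'k::field) mpoly) \<Longrightarrow> f = g"
  by (rule poly_eqI) (metis lookup_first_poly)

lemma first_poly_X: "first_poly [:0, 1:] = mvar first_var"
  by (simp add: first_poly_def map_poly_pCons mconst.one mconst.zero)

lemma first_poly_const: "first_poly [:a:] = mconst a"
  by (simp add: first_poly_def map_poly_pCons mconst.zero)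

lemma of_mpoly_first_poly:
  "of_mpoly (first_poly f) = poly (map_poly rat_const f) (of_mpoly (mvar first_var))"
  unfolding first_poly_def poly_map_poly_hom[OF rhom_of_mpoly] rat_const_def
  by (subst map_poly_map_poly) (simp_all add: of_mpoly.zero o_def)

lemma curve_image_not_normal:
  fixes A :: "('n::{finite,linorder}, 'k::field) mpoly set"
  assumes A: "\<And>a. mconst a \<in> A" "\<And>p q. p \<in> A \<Longrightarrow> q \<in> A \<Longrightarrow> p + q \<in> A \<and> p * q \<in> A"
    and rho: "[:0, 0, 1:] dvd \<rho>"
    and pq: "p \<in> A" "q \<in> A" "E \<ge> 2" "degree (curve \<rho> b p) = E" "degree (curve \<rho> b q) = E - 1"
  shows "\<not> normal_domain ((\<lambda>r. of_mpoly (first_poly (curve \<rho> b r)) :: ('n, 'k) ratfun) ` A)"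
proof
  define S where "S = curve \<rho> b ` A"
  define \<iota> :: "'k poly \<Rightarrow> ('n, 'k) ratfun" where "\<iota> = (\<lambda>f. of_mpoly (first_poly f))"
  have \<iota>: "rhom \<iota>" unfolding \<iota>_def by (rule rhom_comp[OF rhom_of_mpoly rhom_first_poly])
  define t where "t = \<iota> [:0, 1:]"
  assume "normal_domain ((\<lambda>r. of_mpoly (first_poly (curve \<rho> b r)) :: ('n, 'k) ratfun) ` A)"
  then have normal: "normal_domain (\<iota> ` S)" by (simp add: S_def \<iota>_def image_image)
  have S: "[:a:] \<in> S" "f \<in> S \<Longrightarrow> g \<in> S \<Longrightarrow> f + g \<in> S" "f \<in> S \<Longrightarrow> g \<in> S \<Longrightarrow> f * g \<in> S" for a f g
    unfolding S_def using A
    by (auto simp: rhom.add[OF rhom_curve, symmetric] rhom.mult[OF rhom_curve, symmetric]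
      curve_mconst[of \<rho> b a, symmetric])
  obtain s where s: "s \<in> S" "s \<noteq> 0" "[:0, 1:] * s \<in> S"
    using consecutive_degrees_conductor[OF S, of "curve \<rho> b p" "curve \<rho> b q" E] pq
    unfolding S_def by blast
  have "\<iota> s \<noteq> 0" using s(2) first_poly_inj[of s 0] by (auto simp: \<iota>_def rhom.zero[OF rhom_first_poly])
  moreover from this have "t = \<iota> ([:0, 1:] * s) / \<iota> s" unfolding rhom.mult[OF \<iota>] t_def by simp
  ultimately have "t \<in> quot_field (\<iota> ` S)" unfolding quot_field_def using s by blast
  moreover have "integral_over (\<iota> ` S) t"
  proof -
    define u where "u = lead_coeff (curve \<rho> b p)"
    have "curve \<rho> b p \<noteq> 0" using pq by auto
    then have u: "u \<noteq> 0" by (simp add: u_def)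
    define f where "f = [:1 / u:] * curve \<rho> b p"
    have f: "f \<in> S" "degree f = E" "lead_coeff f = 1"
    proof -
      show "f \<in> S" unfolding f_def using pq by (intro S) (simp add: S_def)
    qed (use pq u in \<open>simp_all add: f_def u_def\<close>)
    \<comment> \<open>The equation \<open>f(T) - f(t) = 0\<close>: it is monic with root
      \<open>t\<close>, and apart from the constant term its coefficients lie in
      \<open>k\<close>.\<close>
    define Q where "Q = map_poly rat_const f - [:\<iota> f:]"
    have cQ: "coeff Q i = rat_const (coeff f i) - (if i = 0 then \<iota> f else 0)" for i
      by (simp add: Q_def coeff_map_poly rat_const.zero coeff_pCons split: nat.split)
    have QE: "coeff Q E = 1" using f pq(3) by (auto simp: cQ rat_const.one)
    have "degree Q = E"
    proof (rule antisym)
      show "degree Q \<le> E" using f(2) pq(3) by (intro degree_le) (auto simp: cQ coeff_eq_0 rat_const.zero)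
      show "E \<le> degree Q" by (rule le_degree) (simp add: QE)
    qed
    show ?thesis
      unfolding integral_over_def
    proof (intro exI conjI allI)
      show "lead_coeff Q = 1" by (simp add: \<open>degree Q = E\<close> QE)
      show "poly Q t = 0"
        unfolding Q_def t_def \<iota>_def first_poly_X of_mpoly_first_poly[of f] by simp
      fix i
      have *: "rat_const a = \<iota> [:a:]" for a by (simp add: \<iota>_def first_poly_const rat_const_def)
      have "coeff Q i = \<iota> ([:coeff f i:] + [:- (if i = 0 then 1 else 0):] * f)"
        by (simp add: cQ * rhom.hom_simps[OF \<iota>] flip: one_pCons)
      then show "coeff Q i \<in> \<iota> ` S" using S f by blast
    qed
  qed
  ultimately have "t \<in> \<iota> ` S" using normal unfolding normal_domain_def by blast
  then obtain f where f: "f \<in> S" "t = \<iota> f" by blast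
  then have "[:0, 1:] = f" unfolding t_def \<iota>_def of_mpoly_inj by (intro first_poly_inj)
  obtain r where r: "f = curve \<rho> b r" using f by (auto simp: S_def)
  obtain h where h: "\<rho> = [:0, 0, 1:] * h" using rho by (auto simp: dvd_def)
  \<comment> \<open>Polynomials without a linear term form a subring of \<open>k[t]\<close> that
    contains the constants and every coordinate \<open>\<rho> t^(b i)\<close>.\<close>
  have "curve \<rho> b r \<in> {f. coeff f 1 = 0}"
    unfolding curve_def by (rule mpoly_eval_in[OF rhom_const_poly]) (auto simp: h coeff_mult mult.assoc)
  then have "coeff [:0, 1 :: 'k:] 1 = 0" unfolding \<open>[:0, 1:] = f\<close> r by simp
  then show False by simp
qed

section \<open>Maximal subfields\<close>

text \<open>Subrings and subfields are plain sets in one ambient field, so that inclusion and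
  properness are set relations, as Zorn's lemma needs.\<close>

definition subring_of :: "'a::field set \<Rightarrow> bool" where
  "subring_of F \<longleftrightarrow> 1 \<in> F \<and> (\<forall>a\<in>F. \<forall>b\<in>F. a + b \<in> F \<and> a * b \<in> F) \<and> (\<forall>a\<in>F. - a \<in> F)"

definition subfield_of :: "'a::field set \<Rightarrow> bool" where
  "subfield_of F \<longleftrightarrow> subring_of F \<and> (\<forall>a\<in>F. inverse a \<in> F)"

definition coeffs_in :: "'a::field set \<Rightarrow> 'a poly \<Rightarrow> bool" where
  "coeffs_in F P \<longleftrightarrow> (\<forall>i. coeff P i \<in> F)"

context
  fixes F :: "'a::field set"
  assumes F: "subring_of F"
begin

lemma subring_1: "1 \<in> F" and subring_add: "a \<in> F \<Longrightarrow> b \<in> F \<Longrightarrow> a + b \<in> F"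
  and subring_mult: "a \<in> F \<Longrightarrow> b \<in> F \<Longrightarrow> a * b \<in> F" and subring_neg: "a \<in> F \<Longrightarrow> - a \<in> F"
  using F by (auto simp: subring_of_def)

lemma subring_0: "0 \<in> F"
  using subring_add[OF subring_1 subring_neg[OF subring_1]] by simp

lemma subring_sum: "(\<And>x. x \<in> A \<Longrightarrow> f x \<in> F) \<Longrightarrow> sum f A \<in> F"
  by (induction A rule: infinite_finite_induct) (auto intro: subring_0 subring_add)

lemma subring_power: "a \<in> F \<Longrightarrow> a ^ n \<in> F"
  by (induction n) (auto intro: subring_1 subring_mult)

lemma coeffs_in_const: "a \<in> F \<Longrightarrow> coeffs_in F [:a:]"
  by (auto simp: coeffs_in_def coeff_pCons subring_0 split: nat.split)

lemma coeffs_in_1: "coeffs_in F 1"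
  by (simp add: one_pCons coeffs_in_const subring_1)

lemma coeffs_in_pCons: "a \<in> F \<Longrightarrow> coeffs_in F P \<Longrightarrow> coeffs_in F (pCons a P)"
  by (auto simp: coeffs_in_def coeff_pCons split: nat.split)

lemma coeffs_in_add: "coeffs_in F P \<Longrightarrow> coeffs_in F Q \<Longrightarrow> coeffs_in F (P + Q)"
  by (auto simp: coeffs_in_def subring_add)

lemma coeffs_in_neg: "coeffs_in F P \<Longrightarrow> coeffs_in F (- P)"
  by (auto simp: coeffs_in_def subring_neg)

lemma coeffs_in_diff: "coeffs_in F P \<Longrightarrow> coeffs_in F Q \<Longrightarrow> coeffs_in F (P - Q)"
  using coeffs_in_add[of P "- Q"] coeffs_in_neg by simp

lemma coeffs_in_mult: "coeffs_in F P \<Longrightarrow> coeffs_in F Q \<Longrightarrow> coeffs_in F (P * Q)"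
  by (auto simp: coeffs_in_def coeff_mult intro: subring_sum subring_mult)

lemma coeffs_in_smult: "a \<in> F \<Longrightarrow> coeffs_in F P \<Longrightarrow> coeffs_in F (smult a P)"
  by (auto simp: coeffs_in_def intro: subring_mult)

lemma coeffs_in_monom: "a \<in> F \<Longrightarrow> coeffs_in F (monom a n)"
  by (auto simp: coeffs_in_def subring_0)

lemma coeffs_in_power: "coeffs_in F P \<Longrightarrow> coeffs_in F (P ^ n)"
  by (induction n) (auto intro: coeffs_in_1 coeffs_in_mult)

lemma coeffs_in_pcompose:
  assumes "coeffs_in F P" "coeffs_in F Q"
  shows "coeffs_in F (pcompose P Q)"
  using assms(1)
proof (induction P)
  case 0
  then show ?case by simp
next
  case (pCons a P)
  have "a \<in> F" "coeffs_in F P"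
    using pCons(3) unfolding coeffs_in_def by (metis coeff_pCons_0, metis coeff_pCons_Suc)
  then show ?case unfolding pcompose_pCons
    by (intro coeffs_in_add coeffs_in_const coeffs_in_mult assms pCons.IH)
qed

text \<open>A monic divisor needs no inverses, so division stays inside a mere subring. It is
  applied both over \<open>F\<close> and over local rings of hyperplanes.\<close>

lemma divide_monic:
  assumes "coeffs_in F P" "lead_coeff P = 1" "coeffs_in F A"
  shows "\<exists>Q R. coeffs_in F Q \<and> coeffs_in F R \<and> A = Q * P + R \<and> (R = 0 \<or> degree R < degree P)"
  using assms(3)
proof (induction "degree A" arbitrary: A rule: less_induct)
  case less
  show ?case
  proof (cases "A = 0 \<or> degree A < degree P")
    case True
    then show ?thesis using less(2) coeffs_in_const[OF subring_0] by (intro exI[of _ 0] exI[of _ A]) auto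
  next
    case False
    define T where "T = monom (lead_coeff A) (degree A - degree P)"
    have T: "coeffs_in F T" unfolding T_def using less(2) by (intro coeffs_in_monom) (simp add: coeffs_in_def)
    define A' where "A' = A - T * P"
    have A': "coeffs_in F A'" unfolding A'_def by (intro coeffs_in_diff coeffs_in_mult less T assms)
    have P0: "P \<noteq> 0" using assms(2) by auto
    have "T \<noteq> 0" "degree T = degree A - degree P" "lead_coeff T = lead_coeff A"
      using False by (simp_all add: T_def degree_monom_eq)
    then have dT: "degree (T * P) = degree A" and "lead_coeff (T * P) = lead_coeff A"
      using False P0 assms(2) unfolding lead_coeff_mult by (simp_all add: degree_mult_eq)
    then have "coeff (T * P) (degree A) = lead_coeff A" by simp
    then have le: "degree A' \<le> degree A" and z: "coeff A' (degree A) = 0"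
      unfolding A'_def using dT by (auto intro: degree_diff_le)
    show ?thesis
    proof (cases "degree A' < degree A")
      case True
      then obtain Q R where "coeffs_in F Q" "coeffs_in F R" "A' = Q * P + R" "R = 0 \<or> degree R < degree P"
        using less(1) A' by blast
      then show ?thesis using T
        by (intro exI[of _ "Q + T"] exI[of _ R]) (auto simp: A'_def algebra_simps intro: coeffs_in_add)
    next
      case False
      then have "A' = 0" using le z by (metis leading_coeff_0_iff le_neq_implies_less)
      then show ?thesis using T coeffs_in_const[OF subring_0]
        by (intro exI[of _ T] exI[of _ 0]) (auto simp: A'_def)
    qed
  qed
qed

end

lemma subfield_subring: "subfield_of F \<Longrightarrow> subring_of F"
  by (simp add: subfield_of_def)

lemma subfield_inverse: "subfield_of F \<Longrightarrow> a \<in> F \<Longrightarrow> inverse a \<in> F"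
  by (simp add: subfield_of_def)

section \<open>Simple extensions and maximal proper subfields\<close>

definition simple_ext :: "'a::field set \<Rightarrow> 'a \<Rightarrow> 'a set" where
  "simple_ext F \<beta> = {poly A \<beta> / poly B \<beta> | A B. coeffs_in F A \<and> coeffs_in F B \<and> poly B \<beta> \<noteq> 0}"

lemma simple_extI: "coeffs_in F A \<Longrightarrow> coeffs_in F B \<Longrightarrow> poly B \<beta> \<noteq> 0 \<Longrightarrow> z = poly A \<beta> / poly B \<beta> \<Longrightarrow> z \<in> simple_ext F \<beta>"
  unfolding simple_ext_def by blast

lemma simple_ext:
  assumes "subfield_of F"
  shows "subfield_of (simple_ext F \<beta>)" "F \<subseteq> simple_ext F \<beta>" "\<beta> \<in> simple_ext F \<beta>"
proof -
  note R = subfield_subring[OF assms]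
  note c = coeffs_in_add[OF R] coeffs_in_mult[OF R] coeffs_in_neg[OF R] coeffs_in_1[OF R]
    coeffs_in_const[OF R] coeffs_in_pCons[OF R]
  show sub: "F \<subseteq> simple_ext F \<beta>"
  proof
    fix a assume "a \<in> F"
    then show "a \<in> simple_ext F \<beta>" by (intro simple_extI[of _ "[:a:]" 1] c) auto
  qed
  show "\<beta> \<in> simple_ext F \<beta>"
    by (rule simple_extI[of _ "[:0, 1:]" 1]) (auto intro!: c subring_0[OF R] subring_1[OF R])
  have "a + b \<in> simple_ext F \<beta> \<and> a * b \<in> simple_ext F \<beta>" if ab: "a \<in> simple_ext F \<beta>" "b \<in> simple_ext F \<beta>" for a b
  proof -
    obtain A B C D where *: "coeffs_in F A" "coeffs_in F B" "poly B \<beta> \<noteq> 0" "a = poly A \<beta> / poly B \<beta>"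
      "coeffs_in F C" "coeffs_in F D" "poly D \<beta> \<noteq> 0" "b = poly C \<beta> / poly D \<beta>"
      using ab unfolding simple_ext_def by blast
    show ?thesis
    proof
      show "a + b \<in> simple_ext F \<beta>"
        by (rule simple_extI[of _ "A * D + C * B" "B * D"]) (use * in \<open>auto intro: c simp: add_frac_eq\<close>)
      show "a * b \<in> simple_ext F \<beta>"
        by (rule simple_extI[of _ "A * C" "B * D"]) (use * in \<open>auto intro: c\<close>)
    qed
  qed
  moreover have "- a \<in> simple_ext F \<beta> \<and> inverse a \<in> simple_ext F \<beta>" if a: "a \<in> simple_ext F \<beta>" for a
  proof -
    obtain A B where *: "coeffs_in F A" "coeffs_in F B" "poly B \<beta> \<noteq> 0" "a = poly A \<beta> / poly B \<beta>"
      using a unfolding simple_ext_def by blast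
    have "- a \<in> simple_ext F \<beta>"
      by (rule simple_extI[of _ "- A" B]) (use * in \<open>auto intro: c\<close>)
    moreover have "inverse a \<in> simple_ext F \<beta>"
    proof (cases "poly A \<beta> = 0")
      case True
      then show ?thesis using * sub subring_0[OF R] by auto
    next
      case False
      then show ?thesis by (intro simple_extI[of _ B A]) (use * in auto)
    qed
    ultimately show ?thesis by blast
  qed
  ultimately show "subfield_of (simple_ext F \<beta>)"
    unfolding subfield_of_def subring_of_def using sub subring_1[OF R] by blast
qed

definition maximal_subfield :: "'a::field set \<Rightarrow> bool" where
  "maximal_subfield F \<longleftrightarrow> subfield_of F \<and> F \<noteq> UNIV \<and>
     (\<forall>F'. subfield_of F' \<longrightarrow> F \<subseteq> F' \<longrightarrow> F' = F \<or> F' = UNIV)"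

text \<open>\<open>X\<close> is finite and generates the whole field over \<open>M\<close>, so a
  chain whose union were everything would have a member containing \<open>X\<close>. Hence unions of
  chains stay proper.\<close>

lemma maximal_subfield_exists:
  fixes M X :: "'a::field set"
  assumes M: "subfield_of M" "M \<noteq> UNIV" and X: "finite X"
    "\<And>F. subfield_of F \<Longrightarrow> M \<subseteq> F \<Longrightarrow> X \<subseteq> F \<Longrightarrow> F = UNIV"
  obtains F where "maximal_subfield F" "M \<subseteq> F"
proof -
  define \<A> where "\<A> = {F. subfield_of F \<and> M \<subseteq> F \<and> F \<noteq> UNIV}"
  have "\<exists>F\<in>\<A>. \<forall>F'\<in>\<A>. F \<subseteq> F' \<longrightarrow> F' = F"
  proof (rule subset_Zorn_nonempty)
    show "\<A> \<noteq> {}" unfolding \<A>_def using M by blast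
    fix \<C> assume C: "\<C> \<noteq> {}" "subset.chain \<A> \<C>"
    have sub: "subfield_of F" "M \<subseteq> F" "F \<noteq> UNIV" if "F \<in> \<C>" for F
      using C(2) that unfolding subset.chain_def \<A>_def by auto
    have ring: "subring_of F" if "F \<in> \<C>" for F by (rule subfield_subring[OF sub(1)[OF that]])
    have pair: "\<exists>F\<in>\<C>. a \<in> F \<and> b \<in> F" if "a \<in> \<Union>\<C>" "b \<in> \<Union>\<C>" for a b
      using finite_subset_Union_chain[of "{a, b}" \<C> \<A>] that C by auto
    have "a + b \<in> \<Union>\<C> \<and> a * b \<in> \<Union>\<C>" if "a \<in> \<Union>\<C>" "b \<in> \<Union>\<C>" for a b
      using pair[OF that] subring_add[OF ring] subring_mult[OF ring] by blast
    moreover have "- a \<in> \<Union>\<C> \<and> inverse a \<in> \<Union>\<C>" if "a \<in> \<Union>\<C>" for a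
      using that subring_neg[OF ring] subfield_inverse[OF sub(1)] by blast
    moreover have "1 \<in> \<Union>\<C>" using C(1) subring_1[OF ring] by blast
    ultimately have "subfield_of (\<Union>\<C>)" unfolding subfield_of_def subring_of_def by blast
    moreover have "M \<subseteq> \<Union>\<C>" using C(1) sub(2) by blast
    moreover have "\<Union>\<C> \<noteq> UNIV"
    proof
      assume "\<Union>\<C> = UNIV"
      then obtain F where "F \<in> \<C>" "X \<subseteq> F"
        using finite_subset_Union_chain[OF X(1), of \<C> \<A>] C by auto
      then show False using X(2)[of F] sub by blast
    qed
    ultimately show "\<Union>\<C> \<in> \<A>" unfolding \<A>_def by blast
  qed
  then obtain F where F: "F \<in> \<A>" "\<And>F'. F' \<in> \<A> \<Longrightarrow> F \<subseteq> F' \<Longrightarrow> F' = F" by blast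
  have "F' = F \<or> F' = UNIV" if "subfield_of F'" "F \<subseteq> F'" for F'
    using F(1) F(2)[of F'] that by (auto simp: \<A>_def)
  then have "maximal_subfield F" "M \<subseteq> F"
    using F(1) unfolding maximal_subfield_def \<A>_def by auto
  then show ?thesis by (rule that)
qed

text \<open>If \<open>\<alpha>\<close> were transcendental over \<open>F\<close>, then \<open>F(\<alpha>\<^sup>2)\<close> would lie strictly between \<open>F\<close> and \<open>F(\<alpha>)\<close>.\<close>

lemma maximal_subfield_algebraic:
  assumes F: "maximal_subfield F"
  shows "\<exists>P. coeffs_in F P \<and> P \<noteq> 0 \<and> poly P \<alpha> = 0"
proof -
  have sf: "subfield_of F" using F by (simp add: maximal_subfield_def)
  note R = subfield_subring[OF sf]
  note c = coeffs_in_diff[OF R] coeffs_in_mult[OF R] coeffs_in_pCons[OF R] coeffs_in_const[OF R]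
    coeffs_in_pcompose[OF R] subring_0[OF R] subring_1[OF R] subring_neg[OF R]
  consider "simple_ext F (\<alpha> ^ 2) = F" | "simple_ext F (\<alpha> ^ 2) = UNIV"
    using F simple_ext[OF sf] unfolding maximal_subfield_def by blast
  then show ?thesis
  proof cases
    case 1
    then have "\<alpha> ^ 2 \<in> F" using simple_ext(3)[OF sf] by blast
    then show ?thesis
      by (intro exI[of _ "[:- (\<alpha> ^ 2), 0, 1:]"]) (auto intro!: c simp: power2_eq_square)
  next
    case 2
    then have "\<alpha> \<in> simple_ext F (\<alpha> ^ 2)" by simp
    then obtain A B where AB: "coeffs_in F A" "coeffs_in F B" "poly B (\<alpha> ^ 2) \<noteq> 0"
      "\<alpha> = poly A (\<alpha> ^ 2) / poly B (\<alpha> ^ 2)"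
      unfolding simple_ext_def by blast
    let ?s = "[:0, 0, 1:] :: 'a poly"
    define P where "P = pcompose A ?s - [:0, 1:] * pcompose B ?s"
    have "coeffs_in F P" unfolding P_def by (intro c AB)
    moreover have "poly P \<alpha> = 0"
    proof -
      have "poly A (\<alpha> ^ 2) = \<alpha> * poly B (\<alpha> ^ 2)" using AB(3,4) by (simp add: field_simps)
      then show ?thesis by (simp add: P_def poly_pcompose power2_eq_square)
    qed
    moreover have "P \<noteq> 0"
    proof
      assume "P = 0"
      then have eq: "pcompose A ?s = [:0, 1:] * pcompose B ?s" by (simp add: P_def)
      have "pcompose B ?s \<noteq> 0" using AB(3) by (auto simp: pcompose_eq_0_iff)
      then have "degree ([:0, 1:] * pcompose B ?s) = 1 + degree B * 2"
        by (subst degree_mult_eq) (auto simp: degree_pcompose)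
      moreover have "degree (pcompose A ?s) = degree A * 2" by (simp add: degree_pcompose)
      ultimately have "degree A * 2 = 1 + degree B * 2" using eq by simp
      then show False by presburger
    qed
    ultimately show ?thesis by blast
  qed
qed

section \<open>Minimal polynomials over a subfield\<close>

definition min_poly_of :: "'a::field set \<Rightarrow> 'a \<Rightarrow> 'a poly \<Rightarrow> bool" where
  "min_poly_of F \<alpha> P \<longleftrightarrow> coeffs_in F P \<and> lead_coeff P = 1 \<and> poly P \<alpha> = 0 \<and>
     (\<forall>A. coeffs_in F A \<longrightarrow> poly A \<alpha> = 0 \<longrightarrow> A \<noteq> 0 \<longrightarrow> degree P \<le> degree A)"

lemma min_poly_exists:
  assumes F: "subfield_of F" and A: "coeffs_in F A" "A \<noteq> 0" "poly A \<alpha> = 0"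
  shows "\<exists>P. min_poly_of F \<alpha> P"
proof -
  define Z where "Z = (\<lambda>A. coeffs_in F A \<and> A \<noteq> 0 \<and> poly A \<alpha> = 0)"
  define B where "B = arg_min degree Z"
  have "Z A" using A by (simp add: Z_def)
  then have B: "Z B" "\<And>C. Z C \<Longrightarrow> degree B \<le> degree C"
    unfolding B_def using arg_min_nat_lemma[of Z A degree] by auto
  let ?P = "smult (inverse (lead_coeff B)) B"
  have "lead_coeff B \<noteq> 0" "lead_coeff B \<in> F" using B(1) by (auto simp: Z_def coeffs_in_def)
  then have "min_poly_of F \<alpha> ?P"
    using B unfolding min_poly_of_def Z_def
    by (auto intro!: coeffs_in_smult[OF subfield_subring[OF F]] subfield_inverse[OF F])
  then show ?thesis by blast
qed

lemma min_poly_dvd: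
  assumes F: "subfield_of F" and P: "min_poly_of F \<alpha> P" and A: "coeffs_in F A" "poly A \<alpha> = 0"
  shows "P dvd A"
proof -
  obtain Q R where QR: "coeffs_in F Q" "coeffs_in F R" "A = Q * P + R" "R = 0 \<or> degree R < degree P"
    using divide_monic[OF subfield_subring[OF F] _ _ A(1)] P unfolding min_poly_of_def by blast
  have "poly R \<alpha> = 0" using A(2) P unfolding QR(3) min_poly_of_def by simp
  then have "R = 0" using QR P unfolding min_poly_of_def by fastforce
  then show ?thesis using QR by simp
qed

text \<open>As \<open>\<alpha>\<close> is algebraic, polynomial expressions in it already form a
  field, which exceeds \<open>F\<close> and so is everything. Expressions without denominators can
  later be evaluated at a conjugate.\<close>

lemma maximal_subfield_generates:
  assumes F: "maximal_subfield F" and \<alpha>: "\<alpha> \<notin> F"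
  shows "\<exists>A. coeffs_in F A \<and> poly A \<alpha> = y"
proof -
  have sf: "subfield_of F" using F by (simp add: maximal_subfield_def)
  note R = subfield_subring[OF sf]
  note c = coeffs_in_add[OF R] coeffs_in_neg[OF R] coeffs_in_mult[OF R] coeffs_in_smult[OF R] coeffs_in_1[OF R] coeffs_in_const[OF R]
    coeffs_in_pCons[OF R] subring_0[OF R] subring_1[OF R] subfield_inverse[OF sf] subring_neg[OF R]
  obtain P where P: "min_poly_of F \<alpha> P"
    using maximal_subfield_algebraic[OF F, of \<alpha>] min_poly_exists[OF sf] by blast
  \<comment> \<open>Division of \<open>P\<close> by the monic multiple \<open>H'\<close> of
    \<open>H\<close> gives \<open>Q(\<alpha>) H'(\<alpha>) = - r(\<alpha>)\<close> with
    \<open>r\<close> of smaller degree, and minimality of \<open>P\<close> excludes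
    \<open>r = 0\<close>.\<close>
  have inv: "\<exists>C. coeffs_in F C \<and> poly C \<alpha> * poly H \<alpha> = 1"
    if "coeffs_in F H" "H \<noteq> 0" "degree H < degree P" for H
    using that
  proof (induction "degree H" arbitrary: H rule: less_induct)
    case less
    have lc: "lead_coeff H \<in> F" "lead_coeff H \<noteq> 0" using less.prems by (auto simp: coeffs_in_def)
    show ?case
    proof (cases "degree H = 0")
      case True
      then obtain a where a: "H = [:a:]" by (rule degree_eq_zeroE)
      then show ?thesis using lc
        by (intro exI[of _ "[:inverse a:]"]) (auto intro!: c)
    next
      case False
      define H' where "H' = smult (inverse (lead_coeff H)) H"
      have H': "coeffs_in F H'" "lead_coeff H' = 1" "degree H' = degree H"
        using lc less.prems by (auto simp: H'_def intro!: c)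
      obtain Q r where Q: "coeffs_in F Q" "coeffs_in F r" "P = Q * H' + r" "r = 0 \<or> degree r < degree H'"
        using divide_monic[OF R H'(1,2)] P unfolding min_poly_of_def by blast
      have nz: "poly B \<alpha> \<noteq> 0" if "coeffs_in F B" "B \<noteq> 0" "degree B < degree P" for B
        using P that unfolding min_poly_of_def by fastforce
      have P0: "P \<noteq> 0" "poly P \<alpha> = 0" using P by (auto simp: min_poly_of_def)
      have "r \<noteq> 0"
      proof
        assume "r = 0"
        then have PQ: "P = Q * H'" using Q by simp
        then have "Q \<noteq> 0" "H' \<noteq> 0" using P0 by auto
        then have "degree P = degree Q + degree H'" using PQ by (simp add: degree_mult_eq)
        then have "poly Q \<alpha> \<noteq> 0" "poly H' \<alpha> \<noteq> 0"
          using nz[of Q] nz[of H'] Q H' \<open>Q \<noteq> 0\<close> \<open>H' \<noteq> 0\<close> False less.prems by auto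
        then show False using P0 PQ by simp
      qed
      then obtain C where C: "coeffs_in F C" "poly C \<alpha> * poly r \<alpha> = 1"
        using less.hyps[of r] Q H' less.prems by auto
      have "poly Q \<alpha> * (inverse (lead_coeff H) * poly H \<alpha>) = - poly r \<alpha>"
        using P0(2) unfolding Q(3) H'_def by (simp add: eq_neg_iff_add_eq_0 algebra_simps)
      then have "poly (- smult (inverse (lead_coeff H)) (C * Q)) \<alpha> * poly H \<alpha> = poly C \<alpha> * poly r \<alpha>"
        unfolding poly_minus poly_smult poly_mult by (metis (no_types) minus_mult_left minus_mult_right mult.assoc mult.left_commute minus_minus)
      then show ?thesis using C Q lc
        by (intro exI[of _ "- smult (inverse (lead_coeff H)) (C * Q)"]) (auto intro!: c)
    qed
  qed
  define L where "L = {poly A \<alpha> | A. coeffs_in F A}"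
  have LI: "coeffs_in F A \<Longrightarrow> poly A \<alpha> \<in> L" for A by (auto simp: L_def)
  have "subfield_of L"
    unfolding subfield_of_def subring_of_def
  proof (intro conjI ballI)
    show "1 \<in> L" using LI[OF coeffs_in_1[OF R]] by simp
    fix a assume "a \<in> L"
    then obtain A where A: "coeffs_in F A" "a = poly A \<alpha>" by (auto simp: L_def)
    show "- a \<in> L" using LI[of "- A"] A c by auto
    show "inverse a \<in> L"
    proof (cases "a = 0")
      case True
      then show ?thesis using LI[OF coeffs_in_const[OF R subring_0[OF R]]] by simp
    next
      case False
      obtain Q r where Q: "coeffs_in F Q" "coeffs_in F r" "A = Q * P + r" "r = 0 \<or> degree r < degree P"
        using divide_monic[OF R _ _ A(1)] P unfolding min_poly_of_def by blast
      have ar: "a = poly r \<alpha>" using A(2) P unfolding Q(3) by (simp add: min_poly_of_def)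
      then obtain C where C: "coeffs_in F C" "poly C \<alpha> * a = 1" using inv[of r] Q False by fastforce
      then have "inverse a = poly C \<alpha>" using False by (simp add: field_simps)
      then show ?thesis using LI C by simp
    qed
    fix b assume "b \<in> L"
    then obtain B where B: "coeffs_in F B" "b = poly B \<alpha>" by (auto simp: L_def)
    show "a + b \<in> L" "a * b \<in> L" using LI[of "A + B"] LI[of "A * B"] A B c by auto
  qed
  moreover have "F \<subseteq> L"
  proof
    fix a assume "a \<in> F"
    then show "a \<in> L" using LI[of "[:a:]"] c by simp
  qed
  moreover have "\<alpha> \<in> L" using LI[of "[:0, 1:]"] c by simp
  ultimately have "L = F \<or> L = UNIV" "L \<noteq> F" using F \<alpha> unfolding maximal_subfield_def by auto
  then have "y \<in> L" by simp
  then show ?thesis by (auto simp: L_def)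
qed

text \<open>A double root at \<open>\<alpha>\<close> would make the derivative a non-zero
  annihilator over \<open>F\<close> of smaller degree. So the roots of \<open>G\<close> are
  conjugates different from \<open>\<alpha>\<close>, and \<open>\<alpha> \<notin> F\<close> ensures
  that \<open>G\<close> is not constant.\<close>

lemma min_poly_split:
  fixes \<alpha> :: "'a::field"
  assumes char0: "\<And>n. n > 0 \<Longrightarrow> of_nat n \<noteq> (0::'a)"
    and F: "subfield_of F" and P: "min_poly_of F \<alpha> P" and \<alpha>: "\<alpha> \<notin> F"
  obtains G where "P = [:- \<alpha>, 1:] * G" "lead_coeff G = 1" "degree G \<ge> 1" "poly G \<alpha> \<noteq> 0"
proof -
  note R = subfield_subring[OF F]
  have P': "coeffs_in F P" "lead_coeff P = 1" "poly P \<alpha> = 0" using P by (auto simp: min_poly_of_def)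
  have deg: "degree P \<ge> 2"
  proof (rule ccontr)
    assume "\<not> degree P \<ge> 2"
    then consider "degree P = 0" | "degree P = 1" by linarith
    then show False
    proof cases
      case 1
      then show False using P' by (auto elim!: degree_eq_zeroE)
    next
      case 2
      then have "coeff P 0 + \<alpha> = 0" using P' by (simp add: poly_altdef)
      then have "\<alpha> = - coeff P 0" by (metis add.commute eq_neg_iff_add_eq_0)
      then show False using P'(1) \<alpha> subring_neg[OF R] by (auto simp: coeffs_in_def)
    qed
  qed
  obtain G where G: "P = [:- \<alpha>, 1:] * G" using P'(3) by (auto simp: poly_eq_0_iff_dvd dvd_def)
  have G0: "G \<noteq> 0" using G P'(2) by auto
  have lG: "lead_coeff G = 1" using P'(2) unfolding G lead_coeff_mult by simp
  have dG: "degree P = 1 + degree G" unfolding G using G0 by (subst degree_mult_eq) auto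
  have "poly G \<alpha> \<noteq> 0"
  proof
    assume "poly G \<alpha> = 0"
    then have "poly (pderiv P) \<alpha> = 0" unfolding G pderiv_mult by (simp add: pderiv_pCons)
    moreover have of_nat: "of_nat n \<in> F" for n
      by (induction n) (auto intro: subring_0[OF R] subring_add[OF R] subring_1[OF R])
    then have "coeffs_in F (pderiv P)"
      using P'(1) by (auto simp: coeffs_in_def coeff_pderiv intro!: subring_mult[OF R] subring_add[OF R] subring_1[OF R])
    moreover have "coeff (pderiv P) (degree P - 1) \<noteq> 0"
      using deg P'(2) char0[of "degree P"] by (simp add: coeff_pderiv)
    then have "pderiv P \<noteq> 0" by auto
    moreover have "degree (pderiv P) < degree P"
    proof -
      have "degree (pderiv P) \<le> degree P - 1"
        by (rule degree_le) (auto simp: coeff_pderiv intro: coeff_eq_0)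
      then show ?thesis using deg by linarith
    qed
    ultimately show False using P unfolding min_poly_of_def by fastforce
  qed
  then show ?thesis using that G lG dG deg by auto
qed

section \<open>Poles along general hyperplanes\<close>

lemma dvd_diff_mult:
  fixes G :: "'a::comm_ring_1"
  assumes "G dvd a - b" "G dvd c - d"
  shows "G dvd a * c - b * d"
proof -
  have "a * c - b * d = (a - b) * c + b * (c - d)" by (simp add: algebra_simps)
  then show ?thesis using assms by (auto intro: dvd_add)
qed

lemma dvd_diff_power:
  fixes G :: "'a::comm_ring_1"
  shows "G dvd a - b \<Longrightarrow> G dvd a ^ n - b ^ n"
  by (induction n) (auto intro: dvd_diff_mult)

text \<open>Modulo a monic \<open>G\<close>, remainders of polynomials over \<open>A\<close> stay over \<open>A\<close>; a constant is its own remainder.\<close>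

lemma quotient_in_subring:
  fixes A :: "'a::field set"
  assumes A: "subring_of A" and G: "coeffs_in A G" "lead_coeff G = 1" "degree G \<ge> 1"
    and co: "coeffs_in A f" "coeffs_in A Q" and u: "inverse u \<in> A" "u \<noteq> 0"
    and dv: "G dvd f - smult h \<Gamma>" "G dvd \<Gamma> * Q - [:u:]"
  shows "h \<in> A"
proof -
  obtain Q' R where R: "coeffs_in A R" "f * Q = Q' * G + R" "R = 0 \<or> degree R < degree G"
    using divide_monic[OF A G(1,2) coeffs_in_mult[OF A co]] by blast
  have "G dvd (f - smult h \<Gamma>) * Q + smult h (\<Gamma> * Q - [:u:])"
    using dv by (intro dvd_add dvd_mult2 dvd_smult)
  also have "(f - smult h \<Gamma>) * Q + smult h (\<Gamma> * Q - [:u:]) = Q' * G + (R - [:h * u:])"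
    using R(2) by (simp add: algebra_simps smult_diff_right)
  finally have d: "G dvd R - [:h * u:]" by (metis dvd_add_right_iff dvd_triv_right)
  have "R - [:h * u:] = 0"
  proof (rule ccontr)
    assume nz: "R - [:h * u:] \<noteq> 0"
    then have "degree G \<le> degree (R - [:h * u:])" using d by (rule dvd_imp_degree_le[rotated])
    moreover have "degree (R - [:h * u:]) < degree G"
      using R(3) G(3) by (intro degree_diff_less) auto
    ultimately show False by simp
  qed
  then have "coeff R 0 = h * u" by (metis coeff_pCons_0 eq_iff_diff_eq_0)
  then have "h * u \<in> A" using R(1) unfolding coeffs_in_def by metis
  then have "h * u * inverse u \<in> A" by (rule subring_mult[OF A _ u(1)])
  then show ?thesis using u(2) by (simp add: mult.assoc)
qed

section \<open>Specialization and local rings of the hyperplanes \<open>x_i = c\<close>\<close>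

definition specialize :: "'n \<Rightarrow> 'k \<Rightarrow> ('n::linorder, 'k::field) mpoly \<Rightarrow> ('n, 'k) mpoly" where
  "specialize i c = mpoly_eval mconst (mvar(i := mconst c))"

text \<open>Separates the variable \<open>x_i\<close> from the others. The coefficient type remains
  the full polynomial ring, so evaluation at \<open>mvar i\<close> gives \<open>p\<close>
  back.\<close>

definition in_var :: "'n \<Rightarrow> ('n::linorder, 'k::field) mpoly \<Rightarrow> ('n, 'k) mpoly poly" where
  "in_var i = mpoly_eval (\<lambda>a. [:mconst a:]) (\<lambda>j. if j = i then [:0, 1:] else [:mvar j:])"

lemma rhom_specialize: "rhom (specialize i c)"
  unfolding specialize_def by (rule rhom_mpoly_eval[OF rhom_mconst])

lemma specialize_mconst [simp]: "specialize i c (mconst a) = mconst a"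
  unfolding specialize_def by (rule mpoly_eval_mconst[OF rhom_mconst])

lemma specialize_mvar [simp]: "specialize i c (mvar j) = (if j = i then mconst c else mvar j)"
  unfolding specialize_def by (simp add: mpoly_eval_mvar[OF rhom_mconst])

lemma poly_in_var:
  fixes p :: "('n::linorder, 'k::field) mpoly"
  shows "poly (in_var i p) (mvar i) = p" "poly (in_var i p) (mconst c) = specialize i c p"
proof -
  have c: "rhom (\<lambda>a. [:mconst a :: ('n, 'k) mpoly:])" by (rule rhom_comp[OF rhom_const_poly rhom_mconst])
  have "poly (in_var i p) x = mpoly_eval mconst (mvar(i := x)) p" for x
    unfolding in_var_def rhom_map_mpoly_eval[OF rhom_poly c]
    by (rule arg_cong2[where f = "\<lambda>c y. mpoly_eval c y p"]) auto
  then show "poly (in_var i p) (mvar i) = p" "poly (in_var i p) (mconst c) = specialize i c p"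
    by (simp_all add: specialize_def mpoly_eval_id)
qed

lemma specialize_0_dvd:
  assumes "specialize i (- c) p = 0"
  shows "mvar i + mconst c dvd p"
proof -
  have "[:mconst c, 1:] dvd in_var i p"
    using assms by (simp add: poly_in_var(2)[symmetric] poly_eq_0_iff_dvd mconst.neg)
  then obtain q where "in_var i p = [:mconst c, 1:] * q" by (auto simp: dvd_def)
  then have "poly (in_var i p) (mvar i) = (mconst c + mvar i) * poly q (mvar i)" by (simp add: distrib_right)
  then show ?thesis unfolding poly_in_var by (simp add: add.commute)
qed

lemma mvar_add_mconst_nonzero: "mvar i + mconst c \<noteq> (0 :: ('n, 'k::field) mpoly)"
proof
  assume "mvar i + mconst c = (0 :: ('n, 'k) mpoly)"
  then have "lkp (mvar i + mconst c :: ('n, 'k) mpoly) (sgl i 1) = 0" by simp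
  moreover have "(0 :: 'n \<Rightarrow>\<^sub>0 nat) \<noteq> sgl i 1" by (metis lookup_single_eq lookup_zero zero_neq_one)
  ultimately show False by (simp add: lookup_add mvar_def mconst_def lookup_single)
qed

text \<open>Each genericity condition on a translate excludes only finitely many constants, so
  finitely many conditions can be met together over an infinite \<open>k\<close>.\<close>

lemma finite_poly_mconst_roots:
  fixes N :: "('n::linorder, 'k::field) mpoly poly"
  assumes "N \<noteq> 0"
  shows "finite {c. poly N (mconst (- c)) = 0}"
proof -
  have "finite ((\<lambda>c. mconst (- c)) -` {x. poly N x = 0})"
    using poly_roots_finite[OF assms] by (rule finite_vimageI) (auto intro: injI)
  then show ?thesis by (simp add: vimage_def)
qed

lemma finite_specialize_eq_0:
  assumes "p \<noteq> 0"
  shows "finite {c. specialize i (- c) p = 0}"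
proof -
  have "in_var i p \<noteq> 0" using poly_in_var(1)[of i p] assms by auto
  from finite_poly_mconst_roots[OF this] show ?thesis by (simp add: poly_in_var)
qed

text \<open>The localization of \<open>k[x]\<close> at the prime generated by
  \<open>x_i - c\<close>: denominators must not vanish identically on that hyperplane.\<close>

definition local_ring :: "'n \<Rightarrow> 'k \<Rightarrow> ('n::linorder, 'k::field) ratfun set" where
  "local_ring i c = {of_mpoly p / of_mpoly q | p q. specialize i c q \<noteq> 0}"

lemma local_ringI: "specialize i c q \<noteq> 0 \<Longrightarrow> of_mpoly q * z = of_mpoly p \<Longrightarrow> z \<in> local_ring i c"
proof -
  assume *: "specialize i c q \<noteq> 0" "of_mpoly q * z = of_mpoly p"
  have "q \<noteq> 0" using * rhom.zero[OF rhom_specialize] by auto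
  then have "z = of_mpoly p / of_mpoly q" using * by (simp add: field_simps)
  then show ?thesis unfolding local_ring_def using * by blast
qed

lemma local_ringE:
  assumes "z \<in> local_ring i c"
  obtains p q where "specialize i c q \<noteq> 0" "q \<noteq> 0" "of_mpoly q * z = of_mpoly p"
proof -
  obtain p q where pq: "specialize i c q \<noteq> 0" "z = of_mpoly p / of_mpoly q"
    using assms unfolding local_ring_def by blast
  moreover have "q \<noteq> 0" using pq rhom.zero[OF rhom_specialize] by auto
  ultimately show ?thesis using that by simp
qed

lemma local_ring_of_mpoly: "of_mpoly p \<in> local_ring i c"
  by (rule local_ringI[of _ _ 1]) (simp_all add: rhom.one[OF rhom_specialize] of_mpoly.one)

lemma subring_local_ring: "subring_of (local_ring i c)"
  unfolding subring_of_def
proof (intro conjI ballI)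
  show "1 \<in> local_ring i c" using local_ring_of_mpoly[of 1] by (simp add: of_mpoly.one)
  fix a assume "a \<in> local_ring i c"
  then obtain p q where pq: "specialize i c q \<noteq> 0" "q \<noteq> 0" "of_mpoly q * a = of_mpoly p" by (rule local_ringE)
  show "- a \<in> local_ring i c"
    by (rule local_ringI[OF pq(1), of _ "- p"]) (use pq in \<open>simp add: of_mpoly.neg\<close>)
  fix b assume "b \<in> local_ring i c"
  then obtain r s where rs: "specialize i c s \<noteq> 0" "s \<noteq> 0" "of_mpoly s * b = of_mpoly r" by (rule local_ringE)
  have qs: "specialize i c (q * s) \<noteq> 0" using pq rs by (simp add: rhom.mult[OF rhom_specialize])
  show "a + b \<in> local_ring i c"
    by (rule local_ringI[OF qs, of _ "p * s + r * q"])
      (simp add: of_mpoly.hom_simps flip: pq(3) rs(3), simp add: algebra_simps)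
  show "a * b \<in> local_ring i c"
    by (rule local_ringI[OF qs, of _ "p * r"])
      (simp add: of_mpoly.hom_simps flip: pq(3) rs(3))
qed

lemma map_poly_of_mpoly_surj:
  fixes f :: "('n::linorder, 'k::field) ratfun poly"
  assumes "coeffs_in polys f"
  shows "\<exists>N. map_poly of_mpoly N = f"
proof -
  define g :: "('n, 'k) ratfun \<Rightarrow> ('n, 'k) mpoly" where "g = (\<lambda>z. SOME p. of_mpoly p = z)"
  have g: "of_mpoly (g z) = z" if "z \<in> polys" for z
    using that unfolding polys_def g_def by (auto intro: someI)
  have "g 0 = 0" using g[of 0] of_mpoly_in_polys[of 0] by (simp add: of_mpoly.zero)
  then have "map_poly of_mpoly (map_poly g f) = f"
    using assms g by (intro poly_eqI) (simp add: coeff_map_poly of_mpoly.zero coeffs_in_def)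
  then show ?thesis by blast
qed

text \<open>
  \<open>F\<close> is maximal, \<open>\<theta> = x\<^sub>i\<close> and \<open>x\<^sub>l = A\<^sub>l(\<theta>)\<close> with \<open>A\<^sub>l\<close> over \<open>F\<close>. The root \<open>T\<close> of \<open>G\<close>, where
  \<open>(T - \<theta>) G\<close> is the minimal polynomial of \<open>\<theta>\<close>, gives a second point \<open>x\<^sub>l' = A\<^sub>l(T)\<close> at which
  elements of \<open>F\<close> take the same values. If \<open>h \<in> F\<close> has poles only along \<open>x\<^sub>i + c\<^sub>i = 0\<close> and
  \<open>x\<^sub>j + c\<^sub>j = 0\<close>, it can be evaluated at \<open>x'\<close>, where these forms are units for general \<open>c\<^sub>i, c\<^sub>j\<close>.
\<close>

lemma general_translates_no_poles:
  fixes F :: "('n::{finite,linorder}, 'k::field_char_0) ratfun set" and i j :: 'n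
  assumes F: "maximal_subfield F" "range rat_const \<subseteq> F"
    and ij: "of_mpoly (mvar i) \<notin> F" "of_mpoly (mvar j) \<notin> F"
  obtains ci cj where
    "\<And>h f s t. h \<in> F \<Longrightarrow>
       h * of_mpoly ((mvar i + mconst ci) ^ s * (mvar j + mconst cj) ^ t) = of_mpoly f \<Longrightarrow> h \<in> polys"
proof -
  let ?x = "\<lambda>l. of_mpoly (mvar l) :: ('n, 'k) ratfun"
  have sf: "subfield_of F" using F by (simp add: maximal_subfield_def)
  note R = subfield_subring[OF sf]
  have char0: "of_nat n \<noteq> (0 :: ('n, 'k) ratfun)" if "n > 0" for n
    using that unfolding rat_const.of_nat[symmetric] rat_const_eq_0 by simp
  have "\<exists>A. \<forall>l. coeffs_in F (A l) \<and> poly (A l) (?x i) = ?x l"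
    using maximal_subfield_generates[OF F(1) ij(1)] by (intro choice) blast
  then obtain A where A: "\<And>l. coeffs_in F (A l)" "\<And>l. poly (A l) (?x i) = ?x l" by blast
  have minp: "\<exists>P. min_poly_of F y P" for y
    using maximal_subfield_algebraic[OF F(1), of y] min_poly_exists[OF sf] by blast
  obtain P where P: "min_poly_of F (?x i) P" using minp by blast
  obtain G where G: "P = [:- ?x i, 1:] * G" "lead_coeff G = 1" "degree G \<ge> 1" "poly G (?x i) \<noteq> 0"
    by (rule min_poly_split[OF char0 sf P ij(1)])
  have G_dvd: "G dvd B" if "coeffs_in F B" "poly B (?x i) = 0" for B
    using min_poly_dvd[OF sf P that] unfolding G(1) by (rule dvd_mult_right)
  \<comment> \<open>At the second point \<open>x_l\<close> becomes a root of \<open>H\<close>, so it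
    differs from the original \<open>x_l\<close>. Indeed \<open>Pl = (T - x_l) * H\<close> vanishes
    there, and \<open>A_l - x_l\<close> is invertible modulo \<open>G\<close> because
    \<open>x_i\<close> is a polynomial in \<open>x_l\<close> over \<open>F\<close>.\<close>
  have key: "\<exists>H. lead_coeff H = 1 \<and> poly H (?x l) \<noteq> 0 \<and> G dvd pcompose H (A l)" if l: "?x l \<notin> F" for l
  proof -
    obtain Pl where Pl: "min_poly_of F (?x l) Pl" using minp by blast
    obtain H where H: "Pl = [:- ?x l, 1:] * H" "lead_coeff H = 1" "degree H \<ge> 1" "poly H (?x l) \<noteq> 0"
      by (rule min_poly_split[OF char0 sf Pl l])
    have cPl: "coeffs_in F Pl" "poly Pl (?x l) = 0" using Pl by (auto simp: min_poly_of_def)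
    have "G dvd pcompose Pl (A l)"
      by (rule G_dvd) (simp_all add: coeffs_in_pcompose[OF R] cPl A poly_pcompose)
    also have "pcompose Pl (A l) = (A l - [:?x l:]) * pcompose H (A l)"
      unfolding H(1) pcompose_mult by (simp add: pcompose_pCons)
    finally have d1: "G dvd (A l - [:?x l:]) * pcompose H (A l)" .
    obtain B where B: "coeffs_in F B" "poly B (?x l) = ?x i"
      using maximal_subfield_generates[OF F(1) l] by blast
    have "G dvd [:0, 1:] - pcompose B (A l)"
      by (rule G_dvd) (auto simp: poly_pcompose A B intro!: coeffs_in_diff[OF R] coeffs_in_pcompose[OF R]
          coeffs_in_pCons[OF R] coeffs_in_const[OF R] subring_0[OF R] subring_1[OF R])
    then obtain U where U: "[:0, 1:] - pcompose B (A l) = G * U" by (auto simp: dvd_def)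
    have "poly (B - [:?x i:]) (?x l) = 0" by (simp add: B)
    then obtain C where C: "B - [:?x i:] = [:- ?x l, 1:] * C" unfolding poly_eq_0_iff_dvd by (elim dvdE)
    have BC: "pcompose B (A l) - [:?x i:] = (A l - [:?x l:]) * pcompose C (A l)"
      using arg_cong[OF C, of "\<lambda>f. pcompose f (A l)"] unfolding pcompose_mult pcompose_diff
      by (simp add: pcompose_pCons)
    have "[:- ?x i, 1:] = ([:0, 1:] - pcompose B (A l)) + (pcompose B (A l) - [:?x i:])" by simp
    then have lin: "[:- ?x i, 1:] = G * U + (A l - [:?x l:]) * pcompose C (A l)"
      unfolding U BC .
    \<comment> \<open>\<open>G - G(x_i)\<close> is a multiple of \<open>T - x_i\<close>. With
      \<open>lin\<close>, the non-zero constant \<open>G(x_i)\<close> is a combination of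
      \<open>G\<close> and \<open>A_l - x_l\<close>, so the latter is a unit modulo
      \<open>G\<close>.\<close>
    have "poly (G - [:poly G (?x i):]) (?x i) = 0" by simp
    then obtain Q where Q: "G - [:poly G (?x i):] = [:- ?x i, 1:] * Q" unfolding poly_eq_0_iff_dvd by (elim dvdE)
    let ?Y = "pcompose H (A l)"
    have "smult (poly G (?x i)) ?Y = G * ?Y - (G - [:poly G (?x i):]) * ?Y"
      by (simp add: algebra_simps)
    also have "\<dots> = G * ?Y - (G * (U * Q * ?Y) + (A l - [:?x l:]) * ?Y * (pcompose C (A l) * Q))"
      unfolding Q lin by (simp add: algebra_simps)
    also have "G dvd \<dots>" using d1 by (intro dvd_diff dvd_add dvd_mult2[OF d1]) auto
    finally have "G dvd ?Y" using G(4) by (simp add: dvd_smult_iff)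
    then show ?thesis using H by blast
  qed
  obtain H1 where H1: "lead_coeff H1 = 1" "poly H1 (?x i) \<noteq> 0" "G dvd pcompose H1 (A i)"
    using key[OF ij(1)] by blast
  obtain H2 where H2: "lead_coeff H2 = 1" "poly H2 (?x j) \<noteq> 0" "G dvd pcompose H2 (A j)"
    using key[OF ij(2)] by blast
  \<comment> \<open>On a hyperplane where their common denominator \<open>D\<close> does not vanish
    identically, all polynomials describing the second point have coefficients in the local
    ring.\<close>
  define Z where "Z = (\<Union>l. set (coeffs (A l))) \<union> set (coeffs G) \<union> set (coeffs H1) \<union> set (coeffs H2)"
  have "finite Z" unfolding Z_def by simp
  then obtain D where D: "D \<noteq> 0" "\<And>z. z \<in> Z \<Longrightarrow> of_mpoly D * z \<in> polys"
    using common_denominator[of Z] by blast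
  have Dcoeff: "of_mpoly D * coeff B n \<in> polys" if "set (coeffs B) \<subseteq> Z" for B n
  proof (cases "coeff B n = 0")
    case True
    then show ?thesis using of_mpoly_in_polys[of 0] by (simp add: of_mpoly.zero)
  next
    case False
    then have "coeff B n \<in> set (coeffs B)" by (metis coeff_in_coeffs coeff_0 le_degree)
    then show ?thesis using that D(2) by blast
  qed
  have Z: "set (coeffs (A l)) \<subseteq> Z" "set (coeffs G) \<subseteq> Z" "set (coeffs H1) \<subseteq> Z" "set (coeffs H2) \<subseteq> Z" for l
    unfolding Z_def by auto
  have "\<exists>N. map_poly of_mpoly N = smult (of_mpoly D) B" if "set (coeffs B) \<subseteq> Z" for B
    using Dcoeff[OF that] by (intro map_poly_of_mpoly_surj) (simp add: coeffs_in_def)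
  then obtain N1 N2 where N: "map_poly of_mpoly N1 = smult (of_mpoly D) H1" "map_poly of_mpoly N2 = smult (of_mpoly D) H2"
    using Z by metis
  have polyN: "of_mpoly (poly N1 y) = of_mpoly D * poly H1 (of_mpoly y)"
    "of_mpoly (poly N2 y) = of_mpoly D * poly H2 (of_mpoly y)" for y
    by (simp_all add: poly_map_poly_hom[OF rhom_of_mpoly] N)
  have g: "poly N1 (mvar i) \<noteq> 0" "poly N2 (mvar j) \<noteq> 0"
    using polyN(1)[of "mvar i"] polyN(2)[of "mvar j"] D(1) H1(2) H2(2)
    by (auto simp: of_mpoly.zero)
  have inf: "infinite (UNIV :: 'k set)" by (rule infinite_UNIV_char_0)
  \<comment> \<open>On \<open>x_i + ci = 0\<close> the polynomial \<open>D * H1(x_i)\<close>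
    restricts to the same function as \<open>D * H1(- ci)\<close>, and \<open>H1(- ci)\<close> has
    to be a unit there.\<close>
  have "finite ({c. specialize i (- c) D = 0} \<union> {c. specialize i (- c) (poly N1 (mvar i)) = 0})"
    using finite_specialize_eq_0 D(1) g(1) by blast
  then obtain ci where ci: "specialize i (- ci) D \<noteq> 0" "specialize i (- ci) (poly N1 (mvar i)) \<noteq> 0"
    using ex_new_if_finite[OF inf] by blast
  have hom_N: "specialize l c (poly N y) = poly (map_poly (specialize l c) N) (specialize l c y)" for l c N y
    by (rule poly_map_poly_hom[OF rhom_specialize])
  have u1i: "specialize i (- ci) (poly N1 (mconst (- ci))) \<noteq> 0"
    using ci(2) by (simp add: hom_N)
  then have N1ci: "poly N1 (mconst (- ci)) \<noteq> 0" using rhom.zero[OF rhom_specialize] by metis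
  \<comment> \<open>\<open>H2\<close> is monic, so \<open>N2\<close> has \<open>D\<close> among its
    coefficients and stays non-zero on \<open>x_i + ci = 0\<close>. Hence \<open>cj\<close>, chosen
    after \<open>ci\<close>, can also keep \<open>N2(- cj)\<close> from vanishing on that first
    hyperplane.\<close>
  have "coeff N2 (degree H2) = D"
    using arg_cong[OF N(2), of "\<lambda>f. coeff f (degree H2)"] H2(1) by (simp add: coeff_map_poly of_mpoly.zero)
  then have "coeff (map_poly (specialize i (- ci)) N2) (degree H2) \<noteq> 0"
    using ci(1) by (simp add: coeff_map_poly rhom.zero[OF rhom_specialize])
  then have "map_poly (specialize i (- ci)) N2 \<noteq> 0" by auto
  then have "finite ({c. specialize j (- c) D = 0} \<union> {c. specialize j (- c) (poly N2 (mvar j)) = 0} \<union>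
      {c. specialize j (- c) (poly N1 (mconst (- ci))) = 0} \<union> {c. poly (map_poly (specialize i (- ci)) N2) (mconst (- c)) = 0})"
    (is "finite ?bad")
    by (intro finite_UnI finite_specialize_eq_0 finite_poly_mconst_roots D g N1ci)
  from ex_new_if_finite[OF inf this] obtain cj where "cj \<notin> ?bad" by (rule exE)
  then have cj: "specialize j (- cj) D \<noteq> 0" "specialize j (- cj) (poly N2 (mvar j)) \<noteq> 0"
    "specialize j (- cj) (poly N1 (mconst (- ci))) \<noteq> 0" "poly (map_poly (specialize i (- ci)) N2) (mconst (- cj)) \<noteq> 0"
    by simp_all
  have u2i: "specialize i (- ci) (poly N2 (mconst (- cj))) \<noteq> 0" using cj(4) by (simp add: hom_N)
  have u2j: "specialize j (- cj) (poly N2 (mconst (- cj))) \<noteq> 0" using cj(2) by (simp add: hom_N)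
  have loc: "h \<in> local_ring l c"
    if h: "h \<in> F" "h * of_mpoly ((mvar i + mconst ci) ^ s * (mvar j + mconst cj) ^ t) = of_mpoly f"
      and l: "specialize l c D \<noteq> 0" "specialize l c (poly N1 (mconst (- ci))) \<noteq> 0" "specialize l c (poly N2 (mconst (- cj))) \<noteq> 0"
    for h s t f l c
  proof -
    let ?O = "local_ring l c"
    note O = subring_local_ring[of l c]
    have cO: "coeffs_in ?O B" if "set (coeffs B) \<subseteq> Z" for B
      unfolding coeffs_in_def
    proof
      fix n
      have "of_mpoly D * coeff B n \<in> polys" by (rule Dcoeff[OF that])
      then obtain p where "of_mpoly D * coeff B n = of_mpoly p" by (auto simp: polys_def)
      then show "coeff B n \<in> ?O" by (rule local_ringI[OF l(1)])
    qed
    \<comment> \<open>\<open>ev p\<close> is \<open>p(A(T))\<close>: its value at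
      \<open>T = x_i\<close> is \<open>p\<close>, and its class modulo \<open>G\<close> is the value
      of \<open>p\<close> at the second point.\<close>
    define ev where "ev = mpoly_eval (\<lambda>a. [:rat_const a :: ('n, 'k) ratfun:]) A"
    have cr: "rhom (\<lambda>a. [:rat_const a :: ('n, 'k) ratfun:])" by (rule rhom_comp[OF rhom_const_poly rhom_rat_const])
    have ev: "rhom ev" unfolding ev_def by (rule rhom_mpoly_eval[OF cr])
    have ev_val: "poly (ev p) (?x i) = of_mpoly p" for p
    proof -
      have "poly (ev p) (?x i) = mpoly_eval (\<lambda>a. poly [:rat_const a:] (?x i)) (\<lambda>l. poly (A l) (?x i)) p"
        unfolding ev_def by (rule rhom_map_mpoly_eval[OF rhom_poly cr])
      also have "\<dots> = mpoly_eval (\<lambda>a. of_mpoly (mconst a)) (\<lambda>l. of_mpoly (mvar l)) p"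
        by (simp add: A rat_const_def)
      also have "\<dots> = of_mpoly p"
        unfolding rhom_map_mpoly_eval[OF rhom_of_mpoly rhom_mconst, symmetric] mpoly_eval_id ..
      finally show ?thesis .
    qed
    have ev_in: "coeffs_in B (ev p)" if B: "subring_of B" "range rat_const \<subseteq> B" "\<And>l. coeffs_in B (A l)" for B p
    proof -
      have "ev p \<in> Collect (coeffs_in B)"
        unfolding ev_def
        by (rule mpoly_eval_in[OF cr])
          (use B in \<open>auto intro: coeffs_in_const coeffs_in_add coeffs_in_mult\<close>)
      then show ?thesis by simp
    qed
    have kO: "range rat_const \<subseteq> ?O" using local_ring_of_mpoly by (auto simp: rat_const_def)
    define g where "g = (mvar i + mconst ci) ^ s * (mvar j + mconst cj) ^ t"
    \<comment> \<open>Since \<open>h\<close> lies in \<open>F\<close>, this polynomial is over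
      \<open>F\<close> and vanishes at \<open>x_i\<close>; the equation \<open>h * g = f\<close>
      persists at the second point with the same \<open>h\<close>.\<close>
    have "G dvd ev f - smult h (ev g)"
    proof (rule G_dvd)
      show "coeffs_in F (ev f - smult h (ev g))"
        using h(1) A(1) by (intro coeffs_in_diff[OF R] coeffs_in_smult[OF R] ev_in[OF R F(2)])
      show "poly (ev f - smult h (ev g)) (?x i) = 0" using h(2) by (simp add: ev_val g_def)
    qed
    \<comment> \<open>Division of \<open>H\<close> by \<open>T + a\<close> leaves the remainder
      \<open>H(- a)\<close>. As \<open>H\<close> vanishes at the second point,
      \<open>x_m + a\<close> times a quotient equals \<open>- H(- a)\<close> there, so the form is a
      unit once \<open>H(- a)\<close> is.\<close>
    have unit: "\<exists>Q. coeffs_in ?O Q \<and> G dvd ev (mvar m + mconst a) * Q - [:- poly H (rat_const (- a)):]"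
      if H: "set (coeffs H) \<subseteq> Z" "G dvd pcompose H (A m)" for H m a
    proof -
      have "coeffs_in ?O [:rat_const a, 1:]" using kO
        by (intro coeffs_in_pCons[OF O] coeffs_in_const[OF O] subring_1[OF O]) auto
      then obtain Q r where Q: "coeffs_in ?O Q" "H = Q * [:rat_const a, 1:] + r" "r = 0 \<or> degree r < 1"
        using divide_monic[OF O _ _ cO[OF H(1)], of "[:rat_const a, 1:]"] by auto
      obtain b where b: "r = [:b:]" using Q(3) by (metis degree_eq_zeroE less_one pCons_0_0)
      have bH: "[:b:] = - [:- poly H (rat_const (- a)):]" unfolding Q(2) b by (simp add: rat_const.neg)
      have ev_lin: "ev (mvar m + mconst a) = A m + [:rat_const a:]"
        by (simp add: rhom.add[OF ev]) (simp add: ev_def mpoly_eval_mvar[OF cr] mpoly_eval_mconst[OF cr])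
      have "pcompose H (A m) = pcompose Q (A m) * pcompose [:rat_const a, 1:] (A m) + [:b:]"
        using arg_cong[OF Q(2), of "\<lambda>f. pcompose f (A m)"]
        unfolding b pcompose_add pcompose_mult pcompose_const .
      also have "pcompose [:rat_const a, 1:] (A m) = ev (mvar m + mconst a)"
        unfolding ev_lin by (simp add: pcompose_pCons add.commute)
      finally have "pcompose H (A m) = ev (mvar m + mconst a) * pcompose Q (A m) - [:- poly H (rat_const (- a)):]"
        unfolding bH by (simp add: mult.commute)
      moreover have "coeffs_in ?O (pcompose Q (A m))" by (intro coeffs_in_pcompose[OF O] Q cO Z)
      ultimately show ?thesis using H(2) by metis
    qed
    obtain Q1 where Q1: "coeffs_in ?O Q1" "G dvd ev (mvar i + mconst ci) * Q1 - [:- poly H1 (rat_const (- ci)):]"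
      using unit[OF Z(3) H1(3)] by blast
    obtain Q2 where Q2: "coeffs_in ?O Q2" "G dvd ev (mvar j + mconst cj) * Q2 - [:- poly H2 (rat_const (- cj)):]"
      using unit[OF Z(4) H2(3)] by blast
    define u1 where "u1 = - poly H1 (rat_const (- ci))"
    define u2 where "u2 = - poly H2 (rat_const (- cj))"
    have inv: "inverse (- y) \<in> ?O \<and> - y \<noteq> 0" if "of_mpoly w = of_mpoly D * y" "specialize l c w \<noteq> 0" for y w
    proof -
      have "w \<noteq> 0" using that(2) rhom.zero[OF rhom_specialize] by auto
      then have "y \<noteq> 0" using that(1) by auto
      moreover have "inverse (- y) \<in> ?O"
        by (rule local_ringI[OF that(2), of _ "- D"]) (use that(1) \<open>y \<noteq> 0\<close> in \<open>simp add: of_mpoly.neg field_simps\<close>)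
      ultimately show ?thesis by simp
    qed
    have u: "inverse u1 \<in> ?O \<and> u1 \<noteq> 0" "inverse u2 \<in> ?O \<and> u2 \<noteq> 0"
      unfolding u1_def u2_def
      using inv[OF polyN(1)[of "mconst (- ci)"] l(2)] inv[OF polyN(2)[of "mconst (- cj)"] l(3)]
      by (simp_all add: rat_const_def)
    have "G dvd (ev (mvar i + mconst ci) * Q1) ^ s * (ev (mvar j + mconst cj) * Q2) ^ t - [:u1:] ^ s * [:u2:] ^ t"
      using Q1(2) Q2(2) unfolding u1_def u2_def by (intro dvd_diff_mult dvd_diff_power)
    also have "(ev (mvar i + mconst ci) * Q1) ^ s * (ev (mvar j + mconst cj) * Q2) ^ t = ev g * (Q1 ^ s * Q2 ^ t)"
      by (simp add: g_def rhom.mult[OF ev] rhom.power[OF ev] power_mult_distrib mult_ac)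
    also have "[:u1:] ^ s * [:u2:] ^ t = [:u1 ^ s * u2 ^ t:]" by (simp add: poly_const_pow)
    finally have dv: "G dvd ev g * (Q1 ^ s * Q2 ^ t) - [:u1 ^ s * u2 ^ t:]" .
    show "h \<in> ?O"
    proof (rule quotient_in_subring[OF O cO[OF Z(2)] G(2,3) _ _ _ _ \<open>G dvd ev f - smult h (ev g)\<close> dv])
      show "coeffs_in ?O (ev f)" by (intro ev_in O kO cO Z)
      show "coeffs_in ?O (Q1 ^ s * Q2 ^ t)" by (intro coeffs_in_mult[OF O] coeffs_in_power[OF O] Q1 Q2)
      show "inverse (u1 ^ s * u2 ^ t) \<in> ?O"
        using u subring_mult[OF O] subring_power[OF O] by (simp add: power_inverse[symmetric])
      show "u1 ^ s * u2 ^ t \<noteq> 0" using u by simp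
    qed
  qed
  have "h \<in> polys"
    if h: "h \<in> F" "h * of_mpoly ((mvar i + mconst ci) ^ s * (mvar j + mconst cj) ^ t) = of_mpoly f" for h s t f
    using h(2)
  proof (induction "s + t" arbitrary: s t f rule: less_induct)
    case less
    \<comment> \<open>Regularity of \<open>h\<close> along \<open>x_l + c = 0\<close> forces
      \<open>f\<close> to vanish there, so one linear factor cancels.\<close>
    have cancel: "\<exists>f'. f = (mvar l + mconst c) * f'"
      if l: "h \<in> local_ring l (- c)" "(mvar i + mconst ci) ^ s * (mvar j + mconst cj) ^ t = (mvar l + mconst c) * g" for l c g
    proof -
      obtain p q where pq: "specialize l (- c) q \<noteq> 0" "of_mpoly q * h = of_mpoly p" using l(1) by (rule local_ringE)
      have "of_mpoly (q * f) = of_mpoly q * h * of_mpoly ((mvar l + mconst c) * g)"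
        unfolding l(2)[symmetric] mult.assoc less.prems by (rule of_mpoly.mult)
      also have "\<dots> = of_mpoly (p * ((mvar l + mconst c) * g))" unfolding pq(2) of_mpoly.mult ..
      finally have "q * f = p * ((mvar l + mconst c) * g)" by (simp only: of_mpoly_inj)
      then have "specialize l (- c) (q * f) = specialize l (- c) (p * ((mvar l + mconst c) * g))" by simp
      moreover have "specialize l (- c) (mvar l + mconst c) = 0"
        by (simp add: rhom.add[OF rhom_specialize] mconst.neg)
      ultimately have "specialize l (- c) q * specialize l (- c) f = 0" unfolding rhom.mult[OF rhom_specialize] by simp
      then show ?thesis using pq(1) specialize_0_dvd by (auto simp: dvd_def)
    qed
    show ?case
    proof (cases "s = 0 \<and> t = 0")
      case True
      then have "h = of_mpoly f" using less.prems by (simp add: of_mpoly.one)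
      then show ?thesis by simp
    next
      case False
      show ?thesis
      proof (cases s)
        case (Suc s')
        obtain f' where f': "f = (mvar i + mconst ci) * f'"
          using cancel[OF loc[OF h(1) less.prems ci(1) u1i u2i], of "(mvar i + mconst ci) ^ s' * (mvar j + mconst cj) ^ t"] Suc
          by (auto simp: mult_ac)
        have nz: "mvar i + mconst ci \<noteq> (0 :: ('n, 'k) mpoly)" by (rule mvar_add_mconst_nonzero)
        have "h * of_mpoly ((mvar i + mconst ci) ^ s' * (mvar j + mconst cj) ^ t) = of_mpoly f'"
          using less.prems nz unfolding f' Suc by (simp add: of_mpoly.mult del: of_mpoly.add)
        then show ?thesis using less.hyps[of s' t f'] Suc by simp
      next
        case 0
        then obtain t' where t': "t = Suc t'" using False by (cases t) auto
        obtain f' where f': "f = (mvar j + mconst cj) * f'"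
          using cancel[OF loc[OF h(1) less.prems cj(1,3) u2j], of "(mvar i + mconst ci) ^ s * (mvar j + mconst cj) ^ t'"] t'
          by (auto simp: mult_ac)
        have nz: "mvar j + mconst cj \<noteq> (0 :: ('n, 'k) mpoly)" by (rule mvar_add_mconst_nonzero)
        have "h * of_mpoly ((mvar i + mconst ci) ^ s * (mvar j + mconst cj) ^ t') = of_mpoly f'"
          using less.prems nz unfolding f' t' by (simp add: of_mpoly.mult)
        then show ?thesis using less.hyps[of s t' f'] t' by simp
      qed
    qed
  qed
  then show ?thesis by (rule that)
qed

section \<open>Automorphisms of the rational function field\<close>

lemma k_automorphism_rhom:
  assumes "k_automorphism \<Phi>"
  shows "rhom \<Phi>"
proof
  show "\<Phi> (a + b) = \<Phi> a + \<Phi> b" "\<Phi> (a * b) = \<Phi> a * \<Phi> b" for a b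
    using assms by (auto simp: k_automorphism_def)
  have "\<Phi> (rat_const 1) = rat_const 1" using assms unfolding k_automorphism_def by blast
  then show "\<Phi> 1 = 1" by (simp add: rat_const.one)
qed

lemma rhom_field:
  fixes \<Phi> :: "'a::field \<Rightarrow> 'b::field"
  assumes "rhom \<Phi>"
  shows "\<Phi> a = 0 \<longleftrightarrow> a = 0" "\<Phi> (inverse a) = inverse (\<Phi> a)" "\<Phi> (a / b) = \<Phi> a / \<Phi> b"
proof -
  interpret rhom \<Phi> by (rule assms)
  have *: "\<Phi> a * \<Phi> (inverse a) = 1" if "a \<noteq> 0" for a
    using that by (simp add: mult[symmetric] one)
  show "\<Phi> a = 0 \<longleftrightarrow> a = 0" using *[of a] zero by (cases "a = 0") auto
  show inv: "\<Phi> (inverse a) = inverse (\<Phi> a)" for a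
    using *[of a] zero by (cases "a = 0") (auto simp: inverse_unique)
  show "\<Phi> (a / b) = \<Phi> a / \<Phi> b" by (simp add: divide_inverse mult inv)
qed

lemma k_automorphism_comp:
  "k_automorphism \<Phi> \<Longrightarrow> k_automorphism \<Psi> \<Longrightarrow> k_automorphism (\<Phi> \<circ> \<Psi>)"
  unfolding k_automorphism_def by (auto intro: bij_comp)

text \<open>
  The first premise makes the substitution \<open>X\<close> injective on polynomials, so that it extends to
  quotients, and the second makes the extension surjective.
\<close>

lemma substitution_automorphism:
  fixes X :: "'n \<Rightarrow> ('n::{finite,linorder}, 'k::field) mpoly" and Y :: "'n \<Rightarrow> ('n, 'k) ratfun"
  assumes YX: "\<And>i. mpoly_eval rat_const Y (X i) = of_mpoly (mvar i)"
    and XY: "\<And>\<Phi> i. rhom \<Phi> \<Longrightarrow> (\<And>p. \<Phi> (of_mpoly p) = of_mpoly (mpoly_eval mconst X p)) \<Longrightarrow>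
      \<Phi> (Y i) = of_mpoly (mvar i)"
  obtains \<Phi> where "k_automorphism \<Phi>" "\<And>p. \<Phi> (of_mpoly p) = of_mpoly (mpoly_eval mconst X p)"
    "\<And>p. \<Phi> (mpoly_eval rat_const Y p) = of_mpoly p"
proof -
  define \<alpha> where "\<alpha> = mpoly_eval mconst X"
  interpret \<alpha>: rhom \<alpha> unfolding \<alpha>_def by (rule rhom_mpoly_eval[OF rhom_mconst])
  have evY: "rhom (mpoly_eval rat_const Y)" by (rule rhom_mpoly_eval[OF rhom_rat_const])
  have const: "\<alpha> (mconst a) = mconst a" for a
    unfolding \<alpha>_def by (rule mpoly_eval_mconst[OF rhom_mconst])
  have "mpoly_eval rat_const Y (\<alpha> p) = of_mpoly p" for p
    by (rule mpoly_hom_eqI[OF rhom_comp[OF evY \<alpha>.rhom_axioms] rhom_of_mpoly])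
      (simp_all add: const mpoly_eval_mconst[OF rhom_rat_const] rat_const_def[symmetric],
       simp add: \<alpha>_def mpoly_eval_mvar[OF rhom_mconst] YX)
  then have inj: "\<alpha> p = 0 \<longleftrightarrow> p = 0" for p
    by (metis \<alpha>.zero of_mpoly_eq_0)
  define \<Phi> where "\<Phi> = (\<lambda>z. SOME w. \<exists>p q. q \<noteq> 0 \<and> z = of_mpoly p / of_mpoly q \<and>
    w = of_mpoly (\<alpha> p) / (of_mpoly (\<alpha> q) :: ('n, 'k) ratfun))"
  have \<Phi>: "\<Phi> (of_mpoly p / of_mpoly q) = of_mpoly (\<alpha> p) / of_mpoly (\<alpha> q)" if q: "q \<noteq> 0" for p q
  proof -
    have "\<exists>r s. s \<noteq> 0 \<and> of_mpoly p / of_mpoly q = (of_mpoly r / of_mpoly s :: ('n, 'k) ratfun) \<and>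
        \<Phi> (of_mpoly p / of_mpoly q) = of_mpoly (\<alpha> r) / of_mpoly (\<alpha> s)"
      unfolding \<Phi>_def by (rule someI) (use q in blast)
    then obtain r s where rs: "s \<noteq> 0" "of_mpoly p / of_mpoly q = (of_mpoly r / of_mpoly s :: ('n, 'k) ratfun)"
      "\<Phi> (of_mpoly p / of_mpoly q) = of_mpoly (\<alpha> r) / of_mpoly (\<alpha> s)" by blast
    then have "of_mpoly (p * s) = (of_mpoly (r * q) :: ('n, 'k) ratfun)"
      using q by (simp add: of_mpoly.mult frac_eq_eq)
    then have "\<alpha> (p * s) = \<alpha> (r * q)" by (simp only: of_mpoly_inj)
    then have "of_mpoly (\<alpha> p) * of_mpoly (\<alpha> s) = (of_mpoly (\<alpha> r) * of_mpoly (\<alpha> q) :: ('n, 'k) ratfun)"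
      unfolding \<alpha>.mult of_mpoly.mult[symmetric] by (simp only:)
    then show ?thesis using rs(1,3) q inj by (simp add: frac_eq_eq)
  qed
  have \<Phi>_of: "\<Phi> (of_mpoly p) = of_mpoly (\<alpha> p)" for p
    using \<Phi>[of 1 p] by (simp add: \<alpha>.one of_mpoly.one)
  have rhom: "rhom \<Phi>"
  proof
    fix a b :: "('n, 'k) ratfun"
    obtain p q where a: "q \<noteq> 0" "a = of_mpoly p / of_mpoly q" by (rule ratfun_cases)
    obtain r s where b: "s \<noteq> 0" "b = of_mpoly r / of_mpoly s" by (rule ratfun_cases)
    have "a + b = of_mpoly (p * s + r * q) / of_mpoly (q * s)"
      using a b by (simp add: add_frac_eq of_mpoly.hom_simps)
    then show "\<Phi> (a + b) = \<Phi> a + \<Phi> b"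
      using a b inj \<Phi>[of "q * s" "p * s + r * q"] \<Phi>[of q p] \<Phi>[of s r]
      by (simp add: add_frac_eq of_mpoly.hom_simps \<alpha>.hom_simps)
    have "a * b = of_mpoly (p * r) / of_mpoly (q * s)" using a b by (simp add: of_mpoly.hom_simps)
    then show "\<Phi> (a * b) = \<Phi> a * \<Phi> b"
      using a b inj \<Phi>[of "q * s" "p * r"] \<Phi>[of q p] \<Phi>[of s r]
      by (simp add: of_mpoly.hom_simps \<alpha>.hom_simps)
    show "\<Phi> 1 = 1" using \<Phi>_of[of 1] by (simp add: \<alpha>.one of_mpoly.one)
  qed
  have \<Phi>Y: "\<Phi> (mpoly_eval rat_const Y p) = of_mpoly p" for p
  proof (rule mpoly_hom_eqI[OF rhom_comp[OF rhom evY] rhom_of_mpoly])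
    show "\<Phi> (mpoly_eval rat_const Y (mconst a)) = of_mpoly (mconst a)" for a
      by (simp add: mpoly_eval_mconst[OF rhom_rat_const] rat_const_def \<Phi>_of const)
    show "\<Phi> (mpoly_eval rat_const Y (mvar i)) = of_mpoly (mvar i)" for i
      using XY[OF rhom] \<Phi>_of by (simp add: mpoly_eval_mvar[OF rhom_rat_const] \<alpha>_def)
  qed
  have "bij \<Phi>"
    unfolding bij_def
  proof
    show "inj \<Phi>"
    proof (rule injI)
      fix x y assume "\<Phi> x = \<Phi> y"
      then have "\<Phi> (x - y) = 0" by (simp add: rhom.diff[OF rhom])
      then show "x = y" by (simp add: rhom_field(1)[OF rhom])
    qed
    show "surj \<Phi>"
    proof (rule surjI)
      fix z :: "('n, 'k) ratfun"
      obtain p q where "q \<noteq> 0" "z = of_mpoly p / of_mpoly q" by (rule ratfun_cases)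
      show "\<Phi> (SOME w. \<Phi> w = z) = z"
      proof (rule someI)
        show "\<Phi> (mpoly_eval rat_const Y p / mpoly_eval rat_const Y q) = z"
          using \<open>z = _\<close> by (simp add: rhom_field(3)[OF rhom] \<Phi>Y)
      qed
    qed
  qed
  then have "k_automorphism \<Phi>"
    unfolding k_automorphism_def
    by (auto simp: rhom.add[OF rhom] rhom.mult[OF rhom] rat_const_def \<Phi>_of const)
  then show ?thesis using that \<Phi>_of \<Phi>Y unfolding \<alpha>_def by blast
qed

lemma polynomial_automorphism:
  fixes X Z :: "'n \<Rightarrow> ('n::{finite,linorder}, 'k::field) mpoly"
  assumes ZX: "\<And>i. mpoly_eval mconst Z (X i) = mvar i" and XZ: "\<And>i. mpoly_eval mconst X (Z i) = mvar i"
  obtains \<Phi> where "k_automorphism \<Phi>" "\<Phi> ` polys = polys"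
    "\<And>p. \<Phi> (of_mpoly p) = of_mpoly (mpoly_eval mconst X p)" "\<And>p. \<Phi> (of_mpoly (mpoly_eval mconst Z p)) = of_mpoly p"
proof -
  have ev: "mpoly_eval rat_const (\<lambda>i. of_mpoly (Z i)) p = of_mpoly (mpoly_eval mconst Z p)" for p
    unfolding rhom_map_mpoly_eval[OF rhom_of_mpoly rhom_mconst] rat_const_def ..
  obtain \<Phi> where \<Phi>: "k_automorphism \<Phi>" "\<And>p. \<Phi> (of_mpoly p) = of_mpoly (mpoly_eval mconst X p)"
    "\<And>p. \<Phi> (mpoly_eval rat_const (\<lambda>i. of_mpoly (Z i)) p) = of_mpoly p"
    by (rule substitution_automorphism[of "\<lambda>i. of_mpoly (Z i)" X]) (simp_all add: ev ZX XZ)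
  have "\<Phi> ` polys = polys"
  proof
    show "\<Phi> ` polys \<subseteq> polys" using \<Phi>(2) by (auto simp: polys_def)
    show "polys \<subseteq> \<Phi> ` polys"
    proof
      fix z :: "('n, 'k) ratfun" assume "z \<in> polys"
      then obtain p where "z = of_mpoly p" by (auto simp: polys_def)
      then have "z = \<Phi> (of_mpoly (mpoly_eval mconst Z p))" using \<Phi>(3) ev by simp
      then show "z \<in> \<Phi> ` polys" by simp
    qed
  qed
  then show ?thesis using that \<Phi> ev by simp
qed

section \<open>Transport of structure along an automorphism\<close>

context
  fixes \<Phi> :: "('n::{finite,linorder}, 'k::field) ratfun \<Rightarrow> ('n, 'k) ratfun"
  assumes \<Phi>: "k_automorphism \<Phi>"
begin

lemma automorphism_bij: "bij \<Phi>" and automorphism_const: "\<Phi> (rat_const c) = rat_const c"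
  using \<Phi> by (auto simp: k_automorphism_def)

interpretation rhom \<Phi> by (rule k_automorphism_rhom[OF \<Phi>])
lemmas field_hom = rhom_field[OF k_automorphism_rhom[OF \<Phi>]]

lemma automorphism_eq [simp]: "\<Phi> a = \<Phi> b \<longleftrightarrow> a = b"
  using automorphism_bij by (auto simp: bij_def dest: injD)

lemma automorphism_intermediate_field:
  assumes "intermediate_field M"
  shows "intermediate_field (\<Phi> ` M)"
  unfolding intermediate_field_def
proof (intro conjI ballI subsetI)
  fix x :: "('n, 'k) ratfun" assume "x \<in> range rat_const"
  then obtain c where "x = \<Phi> (rat_const c)" using automorphism_const by auto
  then show "x \<in> \<Phi> ` M" using assms unfolding intermediate_field_def by blast
qed (use assms in \<open>auto simp: intermediate_field_def image_iff add[symmetric] mult[symmetric] neg[symmetric]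
      field_hom(2)[symmetric]\<close>)

lemma automorphism_subfield:
  assumes "subfield_of F"
  shows "subfield_of (\<Phi> ` F)"
proof -
  note R = subfield_subring[OF assms]
  have "1 \<in> \<Phi> ` F" using imageI[OF subring_1[OF R], of \<Phi>] by (simp add: one)
  moreover have "\<Phi> a + \<Phi> b \<in> \<Phi> ` F" "\<Phi> a * \<Phi> b \<in> \<Phi> ` F" if "a \<in> F" "b \<in> F" for a b
    using imageI[OF subring_add[OF R that], of \<Phi>] imageI[OF subring_mult[OF R that], of \<Phi>]
    by (simp_all add: add mult)
  moreover have "- \<Phi> a \<in> \<Phi> ` F" "inverse (\<Phi> a) \<in> \<Phi> ` F" if "a \<in> F" for a
    using imageI[OF subring_neg[OF R that], of \<Phi>] imageI[OF subfield_inverse[OF assms that], of \<Phi>]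
    by (simp_all add: neg field_hom(2))
  ultimately show ?thesis unfolding subfield_of_def subring_of_def by blast
qed

lemma automorphism_subfield_vimage: "subfield_of F \<Longrightarrow> subfield_of (\<Phi> -` F)"
  unfolding subfield_of_def subring_of_def by (auto simp: add mult neg field_hom(2) one)

lemma automorphism_maximal_subfield:
  assumes "maximal_subfield F"
  shows "maximal_subfield (\<Phi> ` F)"
  unfolding maximal_subfield_def
proof (intro conjI allI impI)
  show "subfield_of (\<Phi> ` F)" using assms automorphism_subfield by (simp add: maximal_subfield_def)
  show "\<Phi> ` F \<noteq> UNIV"
  proof
    assume eq: "\<Phi> ` F = UNIV"
    have "a \<in> F" for a
    proof -
      have "\<Phi> a \<in> \<Phi> ` F" by (simp add: eq)
      then show ?thesis by auto
    qed
    then show False using assms by (auto simp: maximal_subfield_def)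
  qed
  fix F' assume F': "subfield_of F'" "\<Phi> ` F \<subseteq> F'"
  have im: "\<Phi> ` (\<Phi> -` F') = F'" using automorphism_bij by (simp add: bij_def)
  have "\<Phi> -` F' = F \<or> \<Phi> -` F' = UNIV"
    using assms automorphism_subfield_vimage[OF F'(1)] F'(2) unfolding maximal_subfield_def
    by (metis image_subset_iff_subset_vimage)
  then show "F' = \<Phi> ` F \<or> F' = UNIV"
  proof
    assume "\<Phi> -` F' = UNIV"
    then have "F' = range \<Phi>" using im by simp
    then show ?thesis using automorphism_bij by (simp add: bij_def)
  qed (use im in simp)
qed

lemma automorphism_quot_field: "quot_field (\<Phi> ` B) = \<Phi> ` quot_field B"
proof
  show "quot_field (\<Phi> ` B) \<subseteq> \<Phi> ` quot_field B"
  proof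
    fix z assume "z \<in> quot_field (\<Phi> ` B)"
    then obtain a b where "a \<in> B" "b \<in> B" "b \<noteq> 0" "z = \<Phi> (a / b)"
      unfolding quot_field_def by (auto simp: field_hom zero)
    then show "z \<in> \<Phi> ` quot_field B" unfolding quot_field_def by blast
  qed
  show "\<Phi> ` quot_field B \<subseteq> quot_field (\<Phi> ` B)"
  proof
    fix z assume "z \<in> \<Phi> ` quot_field B"
    then obtain a b where "a \<in> B" "b \<in> B" "b \<noteq> 0" "z = \<Phi> a / \<Phi> b"
      unfolding quot_field_def by (auto simp: field_hom)
    then show "z \<in> quot_field (\<Phi> ` B)"
      unfolding quot_field_def using field_hom(1) by blast
  qed
qed

lemma automorphism_mono_independent:
  assumes "mono_independent f g"
  shows "mono_independent (\<Phi> f) (\<Phi> g)"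
  unfolding mono_independent_def
proof (intro allI impI)
  fix N c i j
  assume 0: "(\<Sum>(i, j)\<in>{..N} \<times> {..N}. rat_const (c i j) * \<Phi> f ^ i * \<Phi> g ^ j) = 0" and ij: "i \<le> N" "j \<le> (N::nat)"
  have "\<Phi> (\<Sum>(i, j)\<in>{..N} \<times> {..N}. rat_const (c i j) * f ^ i * g ^ j) = 0"
    using 0 by (simp add: sum mult power automorphism_const case_prod_beta)
  then have "(\<Sum>(i, j)\<in>{..N} \<times> {..N}. rat_const (c i j) * f ^ i * g ^ j) = 0"
    by (simp add: field_hom(1))
  then show "c i j = 0" using assms ij unfolding mono_independent_def by blast
qed

end

lemma intermediate_field_subfield: "intermediate_field M \<Longrightarrow> subfield_of M"
proof -
  assume M: "intermediate_field M"
  then have "rat_const 1 \<in> M" by (auto simp: intermediate_field_def)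
  then show ?thesis using M by (simp add: intermediate_field_def subfield_of_def subring_of_def rat_const.one)
qed

lemma subfield_containing_variables:
  fixes F :: "('n::{finite,linorder}, 'k::field) ratfun set"
  assumes F: "subfield_of F" "range rat_const \<subseteq> F" "range (\<lambda>i. of_mpoly (mvar i)) \<subseteq> F"
  shows "F = UNIV"
proof -
  note R = subfield_subring[OF F(1)]
  have poly: "of_mpoly p \<in> F" for p
    by (induction p rule: mpoly_induct)
      (use F in \<open>auto simp: of_mpoly.hom_simps rat_const_def intro: subring_add[OF R] subring_mult[OF R]\<close>)
  have "z \<in> F" for z
  proof -
    obtain p q where "z = of_mpoly p / of_mpoly q" by (rule ratfun_cases)
    then show ?thesis unfolding divide_inverse
      using subring_mult[OF R] subfield_inverse[OF F(1)] poly by auto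
  qed
  then show ?thesis by blast
qed

section \<open>The field modification\<close>

lemma polys_powers: "z \<in> polys \<Longrightarrow> of_mpoly p ^ n * z \<in> polys"
  by (intro polys_mult polys_power) auto

lemma polys_subset_polys_loc: "polys \<subseteq> polys_loc"
proof
  fix z :: "('n::{finite,linorder}, 'k::field) ratfun" assume "z \<in> polys"
  then obtain p where "z = of_mpoly p / of_mpoly (mvar first_var) ^ 0" by (auto simp: polys_def)
  then show "z \<in> polys_loc" unfolding polys_loc_def by blast
qed

lemma first_poly_pCons_0: "first_poly (pCons 0 f) = mvar first_var * first_poly f"
  by (simp add: first_poly_def map_poly_pCons mconst.zero)

lemma mvar_nonzero: "mvar i \<noteq> (0 :: ('n, 'k::field) mpoly)"
  using mvar_add_mconst_nonzero[of i 0] by (simp add: mconst_def)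

lemma rhom_eps: "rhom (eps :: ('n::{finite,linorder}, 'k::field) mpoly \<Rightarrow> ('n, 'k) mpoly)"
  using rhom_mpoly_eval[OF rhom_mconst] by (simp add: eps_def[abs_def])

lemma eps_mvar: "eps (mvar i :: ('n::{finite,linorder}, 'k::field) mpoly) = (if i = first_var then mvar i else 0)"
  unfolding eps_def by (simp add: mpoly_eval_mvar[OF rhom_mconst])

lemma eps_first_poly: "eps (first_poly f) = (first_poly f :: ('n::{finite,linorder}, 'k::field) mpoly)"
proof -
  note r = rhom_eps and v = eps_mvar
  have "eps (mconst a) = (mconst a :: ('n, 'k) mpoly)" for a
    unfolding eps_def by (rule mpoly_eval_mconst[OF rhom_mconst])
  then show ?thesis
    unfolding first_poly_def poly_map_poly_hom[OF r]
    by (simp add: v map_poly_map_poly mconst.zero rhom.zero[OF r] o_def)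
qed

text \<open>The inverse automorphism maps \<open>k[x]\<close> into \<open>k[x, 1/x_1]\<close> and
  \<open>x_1\<close> to \<open>x_j / x_1\<close>. So an element of the new field with denominator a
  power of \<open>x_1\<close> comes from an element of \<open>M\<close> to which
  \<open>no_poles\<close> applies. This also shows that the new ring is exactly the image of
  \<open>M \<inter> polys\<close>, whose restriction to the curve is known not to be normal.\<close>

lemma dagger_after_modification:
  fixes M :: "('n::{finite,linorder}, 'k::field_char_0) ratfun set"
  assumes M: "intermediate_field M" "quot_field (M \<inter> polys) = M"
    and fg: "f \<in> M \<inter> polys" "g \<in> M \<inter> polys" "mono_independent f g"
    and j: "j \<noteq> first_var"
    and no_poles: "\<And>h f s t. h \<in> M \<Longrightarrow> h * of_mpoly (mvar first_var ^ s * mvar j ^ t) = of_mpoly f \<Longrightarrow> h \<in> polys"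
  shows "\<exists>\<phi>. k_automorphism \<phi> \<and> dagger (\<phi> ` M) \<and> \<phi> ` polys \<subseteq> polys"
proof -
  obtain \<rho> :: "'k poly" and b p q E where curve:
    "[:0, 0, 1:] dvd \<rho>" "b first_var = 0" "b j = 1" "of_mpoly p \<in> M" "of_mpoly q \<in> M"
    "E \<ge> 2" "degree (curve \<rho> b p) = E" "degree (curve \<rho> b q) = E - 1"
    by (rule curve_consecutive_degrees[OF M(1) j[symmetric] fg]) blast
  let ?x = "\<lambda>i. of_mpoly (mvar i) :: ('n, 'k) ratfun"
  define \<tau> where "\<tau> = ?x j / ?x first_var"
  define at_pt where "at_pt = (\<lambda>f \<tau>. poly (map_poly rat_const f) (\<tau> :: ('n, 'k) ratfun))"
  define X where "X = (\<lambda>i. if i = first_var then first_poly \<rho> + mvar j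
    else if i = j then mvar first_var * (first_poly \<rho> + mvar j)
    else mvar i + first_poly (\<rho> * monom 1 (b i)))"
  \<comment> \<open>Solves the substitution \<open>X\<close> backwards: as
    \<open>X j = x_1 * X first_var\<close>, the quotient \<open>\<tau>\<close> recovers
    \<open>x_1\<close>, and subtracting the \<open>\<rho>\<close> terms evaluated at
    \<open>\<tau>\<close> recovers the other variables.\<close>
  define Y where "Y = (\<lambda>i. if i = first_var then \<tau> else if i = j then ?x first_var - at_pt \<rho> \<tau>
    else ?x i - at_pt (\<rho> * monom 1 (b i)) \<tau>)"
  have x0: "?x i \<noteq> 0" for i by (simp add: mvar_nonzero)
  have evY: "rhom (mpoly_eval rat_const Y)" by (rule rhom_mpoly_eval[OF rhom_rat_const])
  have evX: "rhom (mpoly_eval mconst X)" by (rule rhom_mpoly_eval[OF rhom_mconst])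
  have Y_first_poly: "mpoly_eval rat_const Y (first_poly f) = at_pt f \<tau>" for f
  proof -
    have "map_poly (mpoly_eval rat_const Y) (map_poly mconst f) = map_poly rat_const f"
      by (rule poly_eqI) (simp add: coeff_map_poly mconst.zero rat_const.zero rhom.zero[OF evY]
          mpoly_eval_mconst[OF rhom_rat_const])
    moreover have "mpoly_eval rat_const Y (mvar first_var) = \<tau>"
      by (simp add: mpoly_eval_mvar[OF rhom_rat_const] Y_def)
    ultimately show ?thesis unfolding first_poly_def poly_map_poly_hom[OF evY] at_pt_def by simp
  qed
  have XY: "\<Phi> (Y i) = ?x i"
    if \<Phi>: "rhom \<Phi>" "\<And>p. \<Phi> (of_mpoly p) = of_mpoly (mpoly_eval mconst X p)" for \<Phi> i
  proof -
    have var: "\<Phi> (?x i) = of_mpoly (X i)" for i by (simp add: \<Phi>(2) mpoly_eval_mvar[OF rhom_mconst])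
    have "X first_var \<noteq> 0"
      using var[of first_var] x0[of first_var] rhom_field(1)[OF \<Phi>(1)] by (auto simp: of_mpoly.zero)
    then have \<Phi>\<tau>: "\<Phi> \<tau> = ?x first_var"
      unfolding \<tau>_def rhom_field(3)[OF \<Phi>(1)] var using j by (simp add: X_def of_mpoly.mult)
    have const: "\<Phi> (rat_const a) = rat_const a" for a
      by (simp add: rat_const_def \<Phi>(2) mpoly_eval_mconst[OF rhom_mconst])
    have at: "\<Phi> (at_pt f \<tau>) = of_mpoly (first_poly f)" for f
      unfolding at_pt_def poly_map_poly_hom[OF \<Phi>(1)] of_mpoly_first_poly
      by (simp add: map_poly_map_poly rat_const.zero rhom.zero[OF \<Phi>(1)] o_def const \<Phi>\<tau>)
    show ?thesis
      by (simp add: Y_def \<Phi>\<tau> rhom.diff[OF \<Phi>(1)] at) (simp add: var X_def j of_mpoly.add)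
  qed
  have YX: "mpoly_eval rat_const Y (X i) = ?x i" for i
    using j x0 by (simp add: X_def rhom.hom_simps[OF evY] Y_first_poly mpoly_eval_mvar[OF rhom_rat_const])
      (simp add: Y_def \<tau>_def)
  have "\<exists>\<phi>. k_automorphism \<phi> \<and> (\<forall>p. \<phi> (of_mpoly p) = of_mpoly (mpoly_eval mconst X p)) \<and>
    (\<forall>p. \<phi> (mpoly_eval rat_const Y p) = of_mpoly p)"
  proof (rule substitution_automorphism[of Y X])
    show "mpoly_eval rat_const Y (X i) = ?x i" for i by (rule YX)
    show "\<Psi> (Y i) = ?x i"
      if "rhom \<Psi>" "\<And>p. \<Psi> (of_mpoly p) = of_mpoly (mpoly_eval mconst X p)" for \<Psi> i
      using that by (rule XY)
  qed blast
  then obtain \<phi> where \<phi>: "k_automorphism \<phi>" "\<And>p. \<phi> (of_mpoly p) = of_mpoly (mpoly_eval mconst X p)"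
    "\<And>p. \<phi> (mpoly_eval rat_const Y p) = of_mpoly p"
    by blast
  have hom: "rhom \<phi>" by (rule k_automorphism_rhom[OF \<phi>(1)])
  have \<phi>polys: "\<phi> ` polys \<subseteq> polys" using \<phi>(2) by (auto simp: polys_def)
  \<comment> \<open>The ring \<open>k[x, 1/x_1]\<close>, described by clearing denominators. It
    contains every \<open>Y i\<close>, hence the preimage of \<open>k[x]\<close>.\<close>
  define B where "B = {z. \<exists>N. ?x first_var ^ N * z \<in> polys}"
  have B_polys: "of_mpoly p \<in> B" for p unfolding B_def by (auto intro: exI[of _ 0])
  have B_add: "x + y \<in> B" and B_mult: "x * y \<in> B" if xy: "x \<in> B" "y \<in> B" for x y
  proof -
    obtain m n where mn: "?x first_var ^ m * x \<in> polys" "?x first_var ^ n * y \<in> polys"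
      using xy unfolding B_def by blast
    have "?x first_var ^ n * (?x first_var ^ m * x) + ?x first_var ^ m * (?x first_var ^ n * y) \<in> polys"
      by (rule polys_add[OF polys_powers[OF mn(1)] polys_powers[OF mn(2)]])
    then have "?x first_var ^ (m + n) * (x + y) \<in> polys" by (simp add: power_add algebra_simps)
    then show "x + y \<in> B" unfolding B_def by blast
    have "(?x first_var ^ m * x) * (?x first_var ^ n * y) \<in> polys" using mn by (rule polys_mult)
    then have "?x first_var ^ (m + n) * (x * y) \<in> polys" by (simp add: power_add mult_ac)
    then show "x * y \<in> B" unfolding B_def by blast
  qed
  have \<tau>B: "\<tau> \<in> B" unfolding B_def \<tau>_def using x0 by (intro CollectI exI[of _ 1]) simp
  have atB: "at_pt f \<tau> \<in> B" for f
    unfolding at_pt_def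
  proof (induction f)
    case 0
    show ?case using B_polys[of 0] by (simp add: of_mpoly.zero)
  next
    case (pCons a f)
    have "poly (map_poly rat_const (pCons a f)) \<tau> = of_mpoly (mconst a) + \<tau> * poly (map_poly rat_const f) \<tau>"
      by (simp add: map_poly_pCons rat_const.zero rat_const_def)
    then show ?case using pCons B_add B_mult \<tau>B B_polys by simp
  qed
  have YB: "Y i \<in> B" for i
  proof -
    have "x - at_pt f \<tau> \<in> B" if "x \<in> B" for x f
      using B_add[OF that B_mult[OF B_polys[of "mconst (- 1)"] atB[of f]]]
      by (simp add: mconst.neg mconst.one of_mpoly.neg of_mpoly.one)
    then show ?thesis unfolding Y_def using \<tau>B B_polys by auto
  qed
  have evY_B: "mpoly_eval rat_const Y p \<in> B" for p
    by (rule mpoly_eval_in[OF rhom_rat_const]) (auto simp: YB B_add B_mult rat_const_def B_polys)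
  have loc: "\<phi> ` M \<inter> polys_loc \<subseteq> \<phi> ` (M \<inter> polys)"
  proof
    fix z assume "z \<in> \<phi> ` M \<inter> polys_loc"
    then obtain w p k where w: "w \<in> M" "z = \<phi> w" "z = of_mpoly p / ?x first_var ^ k"
      unfolding polys_loc_def by blast
    have "\<phi> (Y first_var) = ?x first_var"
      using \<phi>(3)[of "mvar first_var"] by (simp add: mpoly_eval_mvar[OF rhom_rat_const])
    then have \<phi>\<tau>: "\<phi> \<tau> = ?x first_var" by (simp add: Y_def)
    have "z * ?x first_var ^ k = of_mpoly p" using w(3) x0 by simp
    then have "\<phi> (w * \<tau> ^ k) = \<phi> (mpoly_eval rat_const Y p)"
      unfolding w(2) by (simp add: rhom.mult[OF hom] rhom.power[OF hom] \<phi>\<tau> \<phi>(3))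
    then have "w * \<tau> ^ k = mpoly_eval rat_const Y p" by (simp add: automorphism_eq[OF \<phi>(1)])
    then obtain N where "?x first_var ^ N * (w * \<tau> ^ k) \<in> polys" using evY_B[of p] unfolding B_def by auto
    \<comment> \<open>The extra factor clears the denominator of
      \<open>\<tau> ^ k = x_j^k / x_1^k\<close>, so \<open>w\<close> is multiplied only by powers of
      \<open>x_1\<close> and \<open>x_j\<close>.\<close>
    then have "?x first_var ^ k * (?x first_var ^ N * (w * \<tau> ^ k)) \<in> polys" by (rule polys_powers)
    also have "?x first_var ^ k * (?x first_var ^ N * (w * \<tau> ^ k)) = w * of_mpoly (mvar first_var ^ N * mvar j ^ k)"
      using x0 by (simp add: \<tau>_def power_divide of_mpoly.hom_simps)
    finally have "w \<in> polys" using no_poles[OF w(1)] unfolding polys_def by auto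
    then show "z \<in> \<phi> ` (M \<inter> polys)" using w by blast
  qed
  have R: "\<phi> ` M \<inter> polys = \<phi> ` (M \<inter> polys)"
    using loc \<phi>polys polys_subset_polys_loc by blast
  \<comment> \<open>\<open>eps\<close> kills all variables but \<open>x_1\<close>. The values
    \<open>b first_var = 0\<close> and \<open>b j = 1\<close> are the exponents left by
    \<open>X first_var\<close> and \<open>X j\<close>.\<close>
  have eps_X: "eps (mpoly_eval mconst X r) = first_poly (curve \<rho> b r)" for r
  proof (rule mpoly_hom_eqI[OF rhom_comp[OF rhom_eps evX] rhom_comp[OF rhom_first_poly rhom_curve]])
    show "eps (mpoly_eval mconst X (mconst a)) = first_poly (curve \<rho> b (mconst a))" for a
      using eps_first_poly[of "[:a:]"] by (simp add: mpoly_eval_mconst[OF rhom_mconst] curve_mconst first_poly_const)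
    fix i
    have "eps (X i) = first_poly (\<rho> * monom 1 (b i))"
      using j curve(2,3)
      by (simp add: X_def rhom.hom_simps[OF rhom_eps] eps_first_poly eps_mvar monom_0 flip: one_pCons)
        (simp add: monom_altdef first_poly_pCons_0)
    then show "eps (mpoly_eval mconst X (mvar i)) = first_poly (curve \<rho> b (mvar i))"
      by (simp add: mpoly_eval_mvar[OF rhom_mconst] curve_def mpoly_eval_mvar[OF rhom_const_poly])
  qed
  have "eps_image (\<phi> ` (M \<inter> polys)) = (\<lambda>r. of_mpoly (first_poly (curve \<rho> b r))) ` {r. of_mpoly r \<in> M}"
  proof (intro equalityI subsetI)
    fix z assume "z \<in> eps_image (\<phi> ` (M \<inter> polys))"
    then obtain p w where p: "z = of_mpoly (eps p)" "of_mpoly p = \<phi> w" "w \<in> M" "w \<in> polys"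
      unfolding eps_image_def by blast
    then obtain r where r: "w = of_mpoly r" by (auto simp: polys_def)
    then have "p = mpoly_eval mconst X r" using p(2) by (simp add: \<phi>(2))
    then show "z \<in> (\<lambda>r. of_mpoly (first_poly (curve \<rho> b r))) ` {r. of_mpoly r \<in> M}"
      using p r eps_X by auto
  next
    fix z :: "('n, 'k) ratfun" assume "z \<in> (\<lambda>r. of_mpoly (first_poly (curve \<rho> b r))) ` {r. of_mpoly r \<in> M}"
    then obtain r where r: "of_mpoly r \<in> M" "z = of_mpoly (eps (mpoly_eval mconst X r))" by (auto simp: eps_X)
    moreover have "of_mpoly (mpoly_eval mconst X r) \<in> \<phi> ` (M \<inter> polys)"
      using r(1) by (intro image_eqI[of _ _ "of_mpoly r"]) (auto simp: \<phi>(2))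
    ultimately show "z \<in> eps_image (\<phi> ` (M \<inter> polys))" unfolding eps_image_def by blast
  qed
  moreover have "\<not> normal_domain ((\<lambda>r. of_mpoly (first_poly (curve \<rho> b r)) :: ('n, 'k) ratfun) ` {r. of_mpoly r \<in> M})"
    using M(1) curve
    by (intro curve_image_not_normal[of _ \<rho> p q E])
      (auto simp: intermediate_field_def of_mpoly.hom_simps rat_const_def)
  moreover have "quot_field (\<phi> ` M \<inter> polys) = \<phi> ` M"
    unfolding R automorphism_quot_field[OF \<phi>(1)] M(2) ..
  moreover have "\<phi> ` M \<inter> polys = \<phi> ` M \<inter> polys_loc"
    using loc R polys_subset_polys_loc by blast
  ultimately have "dagger (\<phi> ` M)" unfolding dagger_def R by simp
  then show ?thesis using \<phi>(1) \<phi>polys by blast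
qed

theorem theorem1p5:
  fixes M :: "('n::{finite,linorder}, 'k::field_char_0) ratfun set"
  assumes "intermediate_field M"
    and "trdeg M \<ge> 2"
    and "M \<noteq> UNIV"
    and "minimal_field M"
  shows "\<exists>\<phi> :: ('n, 'k) ratfun \<Rightarrow> ('n, 'k) ratfun.
           k_automorphism \<phi> \<and> dagger (\<phi> ` M) \<and> \<phi> ` polys \<subseteq> polys"
proof -
  let ?x = "\<lambda>i. of_mpoly (mvar i) :: ('n, 'k) ratfun"
  have const_M: "range rat_const \<subseteq> M" using assms(1) by (simp add: intermediate_field_def)
  obtain F where F: "maximal_subfield F" "M \<subseteq> F"
  proof (rule maximal_subfield_exists[OF intermediate_field_subfield[OF assms(1)] assms(3), of "range ?x"])
    show "F = UNIV" if "subfield_of F" "M \<subseteq> F" "range ?x \<subseteq> F" for F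
      using that const_M by (intro subfield_containing_variables) auto
  qed auto
  have sf: "subfield_of F" "F \<noteq> UNIV" using F by (auto simp: maximal_subfield_def)
  note R = subfield_subring[OF sf(1)]
  obtain l where l: "?x l \<notin> F"
    using subfield_containing_variables[of F] sf const_M F(2) by blast
  \<comment> \<open>A shear adding \<open>x_l\<close>, which is outside \<open>F\<close>, to every
    coordinate in \<open>F\<close>. It fixes \<open>x_l\<close>, so subtraction inverts it, and
    afterwards no coordinate lies in the image of \<open>F\<close>.\<close>
  define \<kappa> where "\<kappa> = (\<lambda>i. if ?x i \<in> F then mvar l else (0 :: ('n, 'k) mpoly))"
  have \<kappa>: "mpoly_eval mconst X (\<kappa> i) = (if ?x i \<in> F then X l else 0)" for X :: "'n \<Rightarrow> ('n, 'k) mpoly" and i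
    unfolding \<kappa>_def by (simp add: mpoly_eval_mvar[OF rhom_mconst] rhom.zero[OF rhom_mpoly_eval[OF rhom_mconst]])
  note ev = rhom_mpoly_eval[OF rhom_mconst]
  obtain \<Phi> where \<Phi>: "k_automorphism \<Phi>" "\<Phi> ` polys = polys"
    "\<And>p. \<Phi> (of_mpoly (mpoly_eval mconst (\<lambda>i. mvar i + \<kappa> i) p)) = of_mpoly p"
    by (rule polynomial_automorphism[of "\<lambda>i. mvar i + \<kappa> i" "\<lambda>i. mvar i - \<kappa> i"])
      (use l in \<open>auto simp: rhom.hom_simps[OF ev] mpoly_eval_mvar[OF rhom_mconst] \<kappa>, auto simp: \<kappa>_def\<close>)
  have x_notin: "?x i \<notin> \<Phi> ` F" for i
  proof
    assume "?x i \<in> \<Phi> ` F"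
    moreover have "\<Phi> (of_mpoly (mvar i + \<kappa> i)) = ?x i"
      using \<Phi>(3)[of "mvar i"] by (simp add: mpoly_eval_mvar[OF rhom_mconst])
    ultimately have *: "of_mpoly (mvar i + \<kappa> i) \<in> F" by (metis automorphism_eq[OF \<Phi>(1)] imageE)
    show False
    proof (cases "?x i \<in> F")
      case True
      then have "?x i + ?x l \<in> F" using * by (simp add: \<kappa>_def of_mpoly.add)
      from subring_add[OF R this subring_neg[OF R True]] l show False by simp
    next
      case False
      then show False using * by (simp add: \<kappa>_def)
    qed
  qed
  obtain S :: "('n, 'k) ratfun set" where S: "finite S" "S \<subseteq> M" "alg_independent S" "trdeg M = enat (card S)"
    by (rule trdeg_attained)
  \<comment> \<open>Transcendence degree at least 2 forces at least two variables, which provides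
    the index \<open>j\<close>.\<close>
  have "2 \<le> card S" using assms(2) S(4) by (simp add: numeral_eq_enat)
  also have "card S \<le> card (UNIV :: 'n set)" by (rule card_alg_independent_le[OF S(1,3)])
  finally have "UNIV \<noteq> {first_var :: 'n}" by (metis card_1_singleton_iff numeral_le_one_iff semiring_norm(69) One_nat_def)
  then obtain j :: 'n where j: "j \<noteq> first_var" by auto
  have const_F: "range rat_const \<subseteq> \<Phi> ` F"
    using const_M F(2) automorphism_const[OF \<Phi>(1)] by (metis image_subsetI rangeI subset_iff image_eqI)
  obtain c1 cj where poles: "\<And>h f s t. h \<in> \<Phi> ` F \<Longrightarrow>
      h * of_mpoly ((mvar first_var + mconst c1) ^ s * (mvar j + mconst cj) ^ t) = of_mpoly f \<Longrightarrow> h \<in> polys"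
    by (rule general_translates_no_poles[OF automorphism_maximal_subfield[OF \<Phi>(1) F(1)] const_F
          x_notin[of first_var] x_notin[of j]]) blast
  \<comment> \<open>The translation that turns the general hyperplanes \<open>x_1 + c1 = 0\<close>
    and \<open>x_j + cj = 0\<close> into coordinate hyperplanes.\<close>
  define c where "c = (\<lambda>i. if i = first_var then mconst c1 else if i = j then mconst cj else (0 :: ('n, 'k) mpoly))"
  have c: "mpoly_eval mconst X (c i) = c i" for X :: "'n \<Rightarrow> ('n, 'k) mpoly" and i
    unfolding c_def by (simp add: mpoly_eval_mconst[OF rhom_mconst] rhom.zero[OF ev])
  obtain \<Psi> where \<Psi>: "k_automorphism \<Psi>" "\<Psi> ` polys = polys"
    "\<And>p. \<Psi> (of_mpoly (mpoly_eval mconst (\<lambda>i. mvar i + c i) p)) = of_mpoly p"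
    by (rule polynomial_automorphism[of "\<lambda>i. mvar i + c i" "\<lambda>i. mvar i - c i"])
      (auto simp: rhom.hom_simps[OF ev] mpoly_eval_mvar[OF rhom_mconst] c)
  define \<Theta> where "\<Theta> = \<Psi> \<circ> \<Phi>"
  have \<Theta>: "k_automorphism \<Theta>" unfolding \<Theta>_def by (rule k_automorphism_comp[OF \<Psi>(1) \<Phi>(1)])
  have \<Theta>polys: "\<Theta> ` polys = polys" unfolding \<Theta>_def image_comp[symmetric] \<Phi>(2) \<Psi>(2) ..
  have \<Theta>R: "\<Theta> ` M \<inter> polys = \<Theta> ` (M \<inter> polys)"
    using \<Theta>polys image_Int[of \<Theta> M polys] automorphism_bij[OF \<Theta>] by (simp add: bij_def)
  obtain f g where fg: "f \<in> M \<inter> polys" "g \<in> M \<inter> polys" "mono_independent f g"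
    by (rule mono_independent_exists[OF assms(2,4)])
  have "\<exists>\<phi>. k_automorphism \<phi> \<and> dagger (\<phi> ` \<Theta> ` M) \<and> \<phi> ` polys \<subseteq> polys"
  proof (rule dagger_after_modification[OF automorphism_intermediate_field[OF \<Theta> assms(1)] _ _ _
        automorphism_mono_independent[OF \<Theta> fg(3)] j])
    show "quot_field (\<Theta> ` M \<inter> polys) = \<Theta> ` M"
      unfolding \<Theta>R automorphism_quot_field[OF \<Theta>] quot_field_minimal[OF assms(1,4)] ..
    show "\<Theta> f \<in> \<Theta> ` M \<inter> polys" "\<Theta> g \<in> \<Theta> ` M \<inter> polys" unfolding \<Theta>R using fg by auto
    fix h p s t
    assume h: "h \<in> \<Theta> ` M" "h * of_mpoly (mvar first_var ^ s * mvar j ^ t) = of_mpoly p"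
    obtain w where w: "w \<in> \<Phi> ` M" "h = \<Psi> w" using h(1) unfolding \<Theta>_def by auto
    define \<sigma> where "\<sigma> = mpoly_eval mconst (\<lambda>i. mvar i + c i)"
    have \<sigma>: "rhom \<sigma>" unfolding \<sigma>_def by (rule ev)
    have var: "\<sigma> (mvar i) = mvar i + c i" for i unfolding \<sigma>_def by (rule mpoly_eval_mvar[OF rhom_mconst])
    have "\<Psi> (w * of_mpoly (\<sigma> (mvar first_var ^ s * mvar j ^ t))) = \<Psi> (of_mpoly (\<sigma> p))"
      using h(2) w(2) unfolding \<sigma>_def rhom.mult[OF k_automorphism_rhom[OF \<Psi>(1)]] \<Psi>(3) by simp
    then have "w * of_mpoly (\<sigma> (mvar first_var ^ s * mvar j ^ t)) = of_mpoly (\<sigma> p)"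
      by (simp only: automorphism_eq[OF \<Psi>(1)])
    moreover have "\<sigma> (mvar first_var ^ s * mvar j ^ t) = (mvar first_var + mconst c1) ^ s * (mvar j + mconst cj) ^ t"
      using j by (simp add: rhom.mult[OF \<sigma>] rhom.power[OF \<sigma>] var c_def)
    moreover have "w \<in> \<Phi> ` F" using w(1) F(2) by auto
    ultimately have "w \<in> polys" using poles by simp
    then show "h \<in> polys" using w(2) \<Psi>(2) by blast
  qed
  then obtain \<phi> where \<phi>: "k_automorphism \<phi>" "dagger (\<phi> ` \<Theta> ` M)" "\<phi> ` polys \<subseteq> polys" by blast
  have "(\<phi> \<circ> \<Theta>) ` polys \<subseteq> polys" unfolding image_comp[symmetric] \<Theta>polys by (rule \<phi>(3))
  moreover have "dagger ((\<phi> \<circ> \<Theta>) ` M)" using \<phi>(2) by (simp add: image_comp)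
  ultimately show ?thesis using k_automorphism_comp[OF \<phi>(1) \<Theta>] by blast
qed

end
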